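(* Let $m,n,k$ be non-negative integers such that $k+1\leq n$, and put $l=n-k-1$. Then for every complete separable metric $\mathrm{LC}^{2m+n-1}$-space $M$ with the $m\text{-}\mathrm{DD}^{\{n,k\}}$-property, the product $M\times\mathbb R^{2l+1}$ has the $m\text{-}\mathrm{DD}^{\{n,n\}}$-property.
   Context: All maps are continuous; $\mathbb I=[0,1]$. A space $M$ is $\mathrm{LC}^{d}$ if for every $x\in M$ and every neighborhood $U$ of $x$ there is a neighborhood $V\subset U$ of $x$ such that for all $0\le i\leq d$ every map $\mathbb S^i\to V$ extends to a map $\mathbb I^{i+1}\to U$ (where $\mathbb S^i$ is identified with the boundary of $\mathbb I^{i+1}$). For non-negative integers $m,a,b$, a metrizable space $N$ has the $m\text{-}\mathrm{DD}^{\{a,b\}}$-property if any two maps $f\colon\mathbb I^m\times\mathbb I^a\to N$, $g\colon\mathbb I^m\times\mathbb I^b\to N$ can be approximated (arbitrarily closely, in the uniform convergence topology) by maps $f'\colon\mathbb I^m\times\mathbb I^a\to N$ and $g'\colon\mathbb I^m\times\mathbb I^b\to N$, respectively, such that $f'(\{z\}\times\mathbb I^a)\cap g'(\{z\}\times\mathbb I^b)=\varnothing$ for all $z\in\mathbb I^m$. *)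

theory Defs
  imports "HOL-Analysis.Analysis"
begin

definition unit_cube_set :: "nat \<Rightarrow> (nat \<Rightarrow> real) set" where
  "unit_cube_set n = {x \<in> topspace (Euclidean_space n). \<forall>i<n. 0 \<le> x i \<and> x i \<le> 1}"

definition unit_cube :: "nat \<Rightarrow> (nat \<Rightarrow> real) topology" where
  "unit_cube n = subtopology (Euclidean_space n) (unit_cube_set n)"

definition unit_cube_boundary :: "nat \<Rightarrow> (nat \<Rightarrow> real) set" where
  "unit_cube_boundary n = Euclidean_space n frontier_of unit_cube_set n"

text \<open>The sphere of dimension \<open>i\<close> is realised as the boundary of the cube of dimension \<open>i + 1\<close>.\<close>

definition LC :: "nat \<Rightarrow> 'a topology \<Rightarrow> bool" where
  "LC d X \<longleftrightarrow>
     (\<forall>x \<in> topspace X. \<forall>U. openin X U \<and> x \<in> U \<longrightarrow>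
       (\<exists>V. openin X V \<and> x \<in> V \<and> V \<subseteq> U \<and>
         (\<forall>i\<le>d. \<forall>f.
            continuous_map (subtopology (unit_cube (i + 1)) (unit_cube_boundary (i + 1)))
              (subtopology X V) f \<longrightarrow>
            (\<exists>g. continuous_map (unit_cube (i + 1)) (subtopology X U) g \<and>
                 (\<forall>p \<in> unit_cube_boundary (i + 1). g p = f p)))))"

text \<open>Closeness is measured by an arbitrary metric inducing the topology of \<open>N\<close>. As the domains are
  compact, the choice of this metric does not matter; see \<open>DD_property_iff_metric\<close> below.\<close>

definition DD_property_metric :: "nat \<Rightarrow> nat \<Rightarrow> nat \<Rightarrow> 'a metric \<Rightarrow> bool" where
  "DD_property_metric m a b D \<longleftrightarrow>
     (\<forall>f g. continuous_map (prod_topology (unit_cube m) (unit_cube a)) (mtopology_of D) f \<and>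
            continuous_map (prod_topology (unit_cube m) (unit_cube b)) (mtopology_of D) g \<longrightarrow>
       (\<forall>\<epsilon>>0. \<exists>f' g'.
          continuous_map (prod_topology (unit_cube m) (unit_cube a)) (mtopology_of D) f' \<and>
          continuous_map (prod_topology (unit_cube m) (unit_cube b)) (mtopology_of D) g' \<and>
          (\<forall>p \<in> unit_cube_set m \<times> unit_cube_set a. mdist D (f p) (f' p) < \<epsilon>) \<and>
          (\<forall>p \<in> unit_cube_set m \<times> unit_cube_set b. mdist D (g p) (g' p) < \<epsilon>) \<and>
          (\<forall>z \<in> unit_cube_set m.
             f' ` ({z} \<times> unit_cube_set a) \<inter> g' ` ({z} \<times> unit_cube_set b) = {})))"

definition DD_property :: "nat \<Rightarrow> nat \<Rightarrow> nat \<Rightarrow> 'a topology \<Rightarrow> bool" where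
  "DD_property m a b N \<longleftrightarrow>
     metrizable_space N \<and> (\<forall>D. mtopology_of D = N \<longrightarrow> DD_property_metric m a b D)"

lemma topspace_unit_cube [simp]: "topspace (unit_cube n) = unit_cube_set n"
  by (auto simp: unit_cube_def unit_cube_set_def)

lemma compact_space_unit_cube: "compact_space (unit_cube n)"
proof -
  let ?B = "\<lambda>i. if i < n then {0..1} else {0::real}"
  have eq: "unit_cube_set n = PiE UNIV ?B"
  proof (rule set_eqI)
    fix x :: "nat \<Rightarrow> real"
    have "(\<forall>i. x i \<in> ?B i) \<longleftrightarrow> (\<forall>i\<ge>n. x i = 0) \<and> (\<forall>i<n. 0 \<le> x i \<and> x i \<le> 1)"
      by (auto simp: not_less[symmetric])
    then show "x \<in> unit_cube_set n \<longleftrightarrow> x \<in> PiE UNIV ?B"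
      by (simp only: unit_cube_set_def topspace_Euclidean_space PiE_UNIV_domain Pi_iff) simp
  qed
  have "compactin (powertop_real UNIV) (PiE UNIV ?B)"
    unfolding compactin_PiE by simp
  then have "compactin (powertop_real UNIV) (unit_cube_set n)"
    using eq by simp
  moreover have "unit_cube n = subtopology (powertop_real UNIV) (unit_cube_set n)"
  proof -
    have "{x. \<forall>i\<ge>n. x i = 0} \<inter> unit_cube_set n = unit_cube_set n"
      unfolding unit_cube_set_def topspace_Euclidean_space by blast
    then show ?thesis
      unfolding unit_cube_def Euclidean_space_def subtopology_subtopology by simp
  qed
  ultimately show ?thesis
    by (simp add: compactin_subspace)
qed

lemma uniform_closeness_metric_independent:
  assumes K: "compactin (mtopology_of D) K" and eq: "mtopology_of D' = mtopology_of D"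
    and "\<epsilon> > 0"
  obtains \<delta> where "\<delta> > 0"
    "\<And>x y. x \<in> K \<Longrightarrow> y \<in> mspace D \<Longrightarrow> mdist D x y < \<delta> \<Longrightarrow> mdist D' x y < \<epsilon>"
proof -
  interpret D: Metric_space "mspace D" "mdist D" by auto
  interpret D': Metric_space "mspace D'" "mdist D'" by auto
  have top: "D'.mtopology = D.mtopology"
    using eq by (simp add: mtopology_of_def)
  have sp: "mspace D' = mspace D"
    using eq by (metis topspace_mtopology_of)
  have K': "compactin D.mtopology K" using K by (simp add: mtopology_of_def)
  then have KD: "K \<subseteq> mspace D" using compactin_subset_topspace by fastforce
  let ?C = "(\<lambda>y. D'.mball y (\<epsilon>/2)) ` K"
  have cov: "K \<subseteq> \<Union>?C"
  proof
    fix x assume x: "x \<in> K"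
    then have "x \<in> mspace D'" using KD sp by blast
    then have "x \<in> D'.mball x (\<epsilon>/2)" using \<open>\<epsilon> > 0\<close> by simp
    then show "x \<in> \<Union>?C" using x by blast
  qed
  have op: "\<And>U. U \<in> ?C \<Longrightarrow> openin D.mtopology U"
    using top D'.openin_mball by (metis imageE)
  obtain \<delta> where "\<delta> > 0" and \<delta>: "\<And>x. x \<in> K \<Longrightarrow> \<exists>U \<in> ?C. D.mball x \<delta> \<subseteq> U"
    using D.lebesgue_number[OF K' cov op] by metis
  have "mdist D' x y < \<epsilon>" if h: "x \<in> K" "y \<in> mspace D" "mdist D x y < \<delta>" for x y
  proof -
    obtain w where w: "w \<in> K" "D.mball x \<delta> \<subseteq> D'.mball w (\<epsilon>/2)" using \<delta>[OF h(1)] by blast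
    have "x \<in> D.mball x \<delta>" "y \<in> D.mball x \<delta>"
      using h KD \<open>\<delta> > 0\<close> by auto
    then have "x \<in> D'.mball w (\<epsilon>/2)" "y \<in> D'.mball w (\<epsilon>/2)"
      using w(2) by blast+
    then show ?thesis
      using D'.triangle[of x w y] D'.commute[of x w] by auto
  qed
  then show thesis using that \<open>\<delta> > 0\<close> by blast
qed

lemma DD_property_metric_cong:
  assumes DD: "DD_property_metric m a b D" and eq: "mtopology_of D' = mtopology_of D"
  shows "DD_property_metric m a b D'"
  unfolding DD_property_metric_def eq
proof (intro allI impI, elim conjE)
  fix f g and \<epsilon> :: real
  let ?A = "prod_topology (unit_cube m) (unit_cube a)"
  let ?B = "prod_topology (unit_cube m) (unit_cube b)"
  let ?N = "mtopology_of D"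
  assume f: "continuous_map ?A ?N f" and g: "continuous_map ?B ?N g" and "\<epsilon> > 0"
  have cA: "compact_space ?A" and cB: "compact_space ?B"
    by (simp_all add: compact_space_prod_topology compact_space_unit_cube)
  have "compactin ?N (f ` topspace ?A)" "compactin ?N (g ` topspace ?B)"
    using image_compactin[OF _ f] image_compactin[OF _ g] cA cB
    by (simp_all add: compact_space_def)
  then have K: "compactin ?N (f ` topspace ?A \<union> g ` topspace ?B)"
    by (rule compactin_Un)
  obtain \<delta> where "\<delta> > 0" and \<delta>:
    "\<And>x y. x \<in> f ` topspace ?A \<union> g ` topspace ?B \<Longrightarrow> y \<in> mspace D \<Longrightarrow>
       mdist D x y < \<delta> \<Longrightarrow> mdist D' x y < \<epsilon>"
    using uniform_closeness_metric_independent[OF K eq \<open>\<epsilon> > 0\<close>] by metis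
  obtain f' g' where f': "continuous_map ?A ?N f'" and g': "continuous_map ?B ?N g'"
    and cl: "\<forall>p \<in> unit_cube_set m \<times> unit_cube_set a. mdist D (f p) (f' p) < \<delta>"
      "\<forall>p \<in> unit_cube_set m \<times> unit_cube_set b. mdist D (g p) (g' p) < \<delta>"
    and disj: "\<forall>z \<in> unit_cube_set m.
             f' ` ({z} \<times> unit_cube_set a) \<inter> g' ` ({z} \<times> unit_cube_set b) = {}"
    using DD[unfolded DD_property_metric_def] f g \<open>\<delta> > 0\<close> by metis
  have "f' p \<in> mspace D" if "p \<in> unit_cube_set m \<times> unit_cube_set a" for p
    using continuous_map_image_subset_topspace[OF f'] that by auto
  moreover have "g' p \<in> mspace D" if "p \<in> unit_cube_set m \<times> unit_cube_set b" for p
    using continuous_map_image_subset_topspace[OF g'] that by auto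
  ultimately have
    "\<forall>p \<in> unit_cube_set m \<times> unit_cube_set a. mdist D' (f p) (f' p) < \<epsilon>"
    "\<forall>p \<in> unit_cube_set m \<times> unit_cube_set b. mdist D' (g p) (g' p) < \<epsilon>"
    using cl \<delta> by auto
  then show "\<exists>f' g'. continuous_map ?A ?N f' \<and> continuous_map ?B ?N g' \<and>
      (\<forall>p \<in> unit_cube_set m \<times> unit_cube_set a. mdist D' (f p) (f' p) < \<epsilon>) \<and>
      (\<forall>p \<in> unit_cube_set m \<times> unit_cube_set b. mdist D' (g p) (g' p) < \<epsilon>) \<and>
      (\<forall>z \<in> unit_cube_set m.
         f' ` ({z} \<times> unit_cube_set a) \<inter> g' ` ({z} \<times> unit_cube_set b) = {})"
    using f' g' disj by blast
qed

lemma DD_property_iff_metric: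
  "DD_property m a b (mtopology_of D) \<longleftrightarrow> DD_property_metric m a b D"
proof -
  have "metrizable_space (mtopology_of D)"
    by (simp add: mtopology_of_def Metric_space.metrizable_space_mtopology)
  then show ?thesis
    unfolding DD_property_def by (auto intro: DD_property_metric_cong)
qed

end

theory Submission
  imports Defs
begin

text \<open>
  Write a map into \<open>M \<times> \<real>\<^bsup>2l+1\<^esup>\<close> as a pair, and choose \<open>m + n\<close> linear forms on \<open>\<I>\<^bsup>m\<^esup> \<times> \<I>\<^bsup>n\<^esup>\<close> whose
  coefficients form a Vandermonde matrix. Any \<open>l + 1 = n - k\<close> of them can be solved for the last
  \<open>l + 1\<close> fibre coordinates, so a joint level set of \<open>l + 1\<close> forms lies in the graph of a map from
  \<open>\<I>\<^bsup>m\<^esup> \<times> \<I>\<^bsup>k\<^esup>\<close>. By \<open>m\<close>-\<open>DD\<^bsup>{n,k}\<^esup>\<close> and \<open>LC\<close>, the components in \<open>M\<close> can be approximated so that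
  neither of them meets, fibrewise, the values of the other on such a graph. Only finitely many graphs
  matter, because a single fine grid of levels suffices. After this step the points at which the
  components in \<open>M\<close> coincide form compact sets \<open>P\<close> and \<open>Q\<close> at which at most \<open>l\<close> forms take a grid
  value. Hence \<open>P\<close> and \<open>Q\<close> have fine open covers of order \<open>l + 1\<close>, and on them the components in
  \<open>\<real>\<^bsup>2l+1\<^esup>\<close> are approximated by maps into finite unions of \<open>l\<close>-dimensional affine subspaces, which
  become disjoint after a small translation. No fibring is needed here, since \<open>P\<close> and \<open>Q\<close> have dimension
  \<open>l\<close> as subsets of the whole of \<open>\<I>\<^bsup>m\<^esup> \<times> \<I>\<^bsup>n\<^esup>\<close>.
\<close>

subsection \<open>Cubes and uniform continuity\<close>

text \<open>The \<open>DD\<close> hypothesis perturbs a map only on the lower-dimensional cube that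
  parametrizes a graph, whereas the new map is needed on the full cube. \<open>LC\<close> bridges
  this: a close perturbation is joined to the original by a small homotopy, which is run inside a
  thin neighbourhood of the graph. Clearing one graph must not spoil another; pairs already
  separated form a compact set, so their values keep a positive distance and a smaller second
  perturbation is harmless. The mesh of the grid is dictated by the moduli of continuity of the
  Euclidean components, and is fixed before the components in \<open>M\<close> are moved. All
  \<open>m + n\<close> forms are used because together they separate points, so that grid cells are
  small. The number \<open>2 * l + 1\<close> enters at the end: two affine subspaces of dimension at
  most \<open>l\<close> have at most \<open>2 * l\<close> directions between them, so a nonzero
  functional in \<open>2 * l + 1\<close> coordinates is constant on each, and all translations that
  make them meet lie in one hyperplane. A point of the moment curve close to 0 avoids the finitely
  many hyperplanes that occur.\<close>

lemma unit_cube_set_iff: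
  "x \<in> unit_cube_set n \<longleftrightarrow> (\<forall>i<n. 0 \<le> x i \<and> x i \<le> 1) \<and> (\<forall>i\<ge>n. x i = 0)"
  by (auto simp: unit_cube_set_def topspace_Euclidean_space)

lemma Euclidean_space_eq_top_of_set:
  "Euclidean_space n = top_of_set (topspace (Euclidean_space n))"
  by (simp add: Euclidean_space_def euclidean_product_topology)

lemma unit_cube_eq_top_of_set: "unit_cube n = top_of_set (unit_cube_set n)"
proof -
  have "{x. \<forall>i\<ge>n. x i = 0} \<inter> unit_cube_set n = unit_cube_set n"
    by (auto simp: unit_cube_set_iff)
  then show ?thesis
    by (simp add: unit_cube_def Euclidean_space_def euclidean_product_topology subtopology_subtopology)
qed

lemma prod_unit_cube_eq_top_of_set:
  "prod_topology (unit_cube m) (unit_cube n) = top_of_set (unit_cube_set m \<times> unit_cube_set n)"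
  by (simp add: unit_cube_eq_top_of_set subtopology_Times)

lemma compact_unit_cube_set: "compact (unit_cube_set n)"
  using compact_space_unit_cube[of n] unfolding unit_cube_eq_top_of_set
  by (simp add: compact_space_def compactin_subtopology)

lemma compact_Icc_fun:
  fixes a b :: "nat \<Rightarrow> real"
  shows "compact {a..b}"
proof -
  have "{a..b} = PiE UNIV (\<lambda>i. {a i..b i})"
    by (auto simp: le_fun_def PiE_UNIV_domain Pi_iff)
  moreover have "compactin (powertop_real UNIV) (PiE UNIV (\<lambda>i. {a i..b i}))"
    unfolding compactin_PiE by simp
  ultimately show ?thesis
    by (simp add: euclidean_product_topology)
qed

lemma continuous_on_apply:
  fixes f :: "'b::topological_space \<Rightarrow> nat \<Rightarrow> real"
  shows "continuous_on S f \<Longrightarrow> continuous_on S (\<lambda>x. f x i)"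
  by (rule continuous_on_product_then_coordinatewise)

lemma mem_unit_cube_boundary:
  "x \<in> unit_cube_boundary n \<longleftrightarrow> x \<in> unit_cube_set n \<and> (\<exists>i<n. x i = 0 \<or> x i = 1)"
proof -
  let ?E = "Euclidean_space n" and ?Q = "unit_cube_set n"
  let ?O = "{x \<in> topspace ?E. \<forall>i<n. 0 < x i \<and> x i < 1}"
  have sub: "?Q \<subseteq> topspace ?E" by (auto simp: unit_cube_set_def)
  have clo: "closedin ?E ?Q"
    unfolding closedin_Euclidean_space_iff
    using sub compact_unit_cube_set compact_imp_closed by blast
  have "open {x :: nat \<Rightarrow> real. \<forall>i\<in>{..<n}. x i \<in> {0<..<1}}"
    using product_topology_basis'[of "{..<n}" "\<lambda>_. {0<..<1::real}" "\<lambda>i. i"] by simp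
  then have "openin (top_of_set (topspace ?E)) (topspace ?E \<inter> {x. \<forall>i\<in>{..<n}. x i \<in> {0<..<1}})"
    by (rule openin_open_Int)
  then have "openin ?E (topspace ?E \<inter> {x. \<forall>i\<in>{..<n}. x i \<in> {0<..<1}})"
    by (simp only: Euclidean_space_eq_top_of_set[symmetric])
  moreover have "topspace ?E \<inter> {x. \<forall>i\<in>{..<n}. x i \<in> {0<..<1}} = ?O" by auto
  ultimately have O: "openin ?E ?O" by simp
  have Oi: "?O \<subseteq> ?E interior_of ?Q"
    by (rule interior_of_maximal[OF _ O]) (auto simp: unit_cube_set_def)
  have "?E interior_of ?Q \<subseteq> ?O"
  proof
    fix x assume x: "x \<in> ?E interior_of ?Q"
    then have xQ: "x \<in> ?Q" using interior_of_subset[of ?E ?Q] by blast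
    have "0 < x i \<and> x i < 1" if i: "i < n" for i
    proof (rule ccontr)
      assume "\<not> (0 < x i \<and> x i < 1)"
      then have xi: "x i = 0 \<or> x i = 1" using xQ i unfolding unit_cube_set_iff by force
      \<comment> \<open>A path that starts at \<open>x\<close> and leaves the cube across the face
        on which \<open>x\<close> lies, so \<open>x\<close> cannot be interior.\<close>
      define \<gamma> where "\<gamma> t = x(i := if x i = 0 then - t else 1 + t)" for t :: real
      have gt: "\<gamma> t \<in> topspace ?E" for t
        using xQ i by (auto simp: \<gamma>_def unit_cube_set_iff topspace_Euclidean_space)
      have "continuous_on UNIV \<gamma>"
      proof (rule continuous_on_coordinatewise_then_product)
        show "continuous_on UNIV (\<lambda>t. \<gamma> t j)" for j
          by (cases "j = i"; cases "x i = 0") (simp_all add: \<gamma>_def continuous_intros)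
      qed
      then have "continuous_map euclideanreal ?E \<gamma>"
        using gt unfolding Euclidean_space_def euclidean_product_topology
        by (auto simp: continuous_map_in_subtopology topspace_Euclidean_space)
      then have "openin euclideanreal {t \<in> topspace euclideanreal. \<gamma> t \<in> ?E interior_of ?Q}"
        by (rule openin_continuous_map_preimage) simp
      then have "open {t. \<gamma> t \<in> ?E interior_of ?Q}" by simp
      moreover have "\<gamma> 0 = x" using xi by (auto simp: \<gamma>_def fun_eq_iff)
      then have "0 \<in> {t. \<gamma> t \<in> ?E interior_of ?Q}" using x by simp
      ultimately obtain e where e: "e > 0" "\<And>t. dist t 0 < e \<Longrightarrow> \<gamma> t \<in> ?E interior_of ?Q"
        unfolding open_dist by blast
      then have "\<gamma> (e/2) \<in> ?Q"
        using interior_of_subset[of ?E ?Q] by (auto simp: dist_real_def subset_iff)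
      then show False
        using i e(1) xi by (auto simp: \<gamma>_def unit_cube_set_iff split: if_splits)
    qed
    then show "x \<in> ?O" using xQ sub by blast
  qed
  then have "?E interior_of ?Q = ?O" using Oi by blast
  then have "unit_cube_boundary n = ?Q - ?O"
    using clo by (simp add: unit_cube_boundary_def frontier_of_def closure_of_closedin)
  then show ?thesis
    by (auto simp: unit_cube_set_iff topspace_Euclidean_space) (metis less_eq_real_def)+
qed

lemma mdist_refl: "x \<in> mspace M \<Longrightarrow> mdist M x x = 0"
  by simp

lemma continuous_map_to_mspace:
  assumes "continuous_map (top_of_set S) (mtopology_of M) f" "x \<in> S"
  shows "f x \<in> mspace M"
  using continuous_map_image_subset_topspace[OF assms(1)] assms(2) by auto

lemma continuous_map_compose_on:
  assumes "continuous_map (top_of_set T) Y g" "continuous_on S f" "f ` S \<subseteq> T"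
  shows "continuous_map (top_of_set S) Y (\<lambda>x. g (f x))"
  using continuous_map_compose[of "top_of_set S" "top_of_set T" f Y g] assms
  by (auto simp: o_def)

lemma continuous_map_subset_on:
  assumes "continuous_map (top_of_set T) Y g" "S \<subseteq> T"
  shows "continuous_map (top_of_set S) Y g"
  using continuous_map_compose_on[OF assms(1), of S "\<lambda>x. x"] assms(2) by simp

text \<open>Uniform continuity, with nearness in the domain measured by any continuous \<open>G\<close> that vanishes
  only on the diagonal.\<close>

lemma uniformly_close:
  fixes K :: "'b::t2_space set" and G :: "'b \<times> 'b \<Rightarrow> real"
  assumes K: "compact K" and \<phi>: "continuous_map (top_of_set K) (mtopology_of M) \<phi>"
    and "\<epsilon> > 0" and G: "continuous_on (K \<times> K) G"
    and G0: "\<And>x y. x \<in> K \<Longrightarrow> y \<in> K \<Longrightarrow> x \<noteq> y \<Longrightarrow> 0 < G (x, y)"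
  obtains \<eta> where "\<eta> > 0"
    "\<And>x y. x \<in> K \<Longrightarrow> y \<in> K \<Longrightarrow> G (x, y) < \<eta> \<Longrightarrow> mdist M (\<phi> x) (\<phi> y) < \<epsilon>"
proof -
  let ?d = "\<lambda>q. mdist M (\<phi> (fst q)) (\<phi> (snd q))"
  have "continuous_map (top_of_set (K \<times> K)) (mtopology_of M) (\<lambda>q. \<phi> (fst q))"
    "continuous_map (top_of_set (K \<times> K)) (mtopology_of M) (\<lambda>q. \<phi> (snd q))"
    by (rule continuous_map_compose_on[OF \<phi>]; auto intro!: continuous_intros)+
  then have d: "continuous_on (K \<times> K) ?d"
    using continuous_map_mdist[of "top_of_set (K \<times> K)" M] by simp
  \<comment> \<open>Pairs whose images are at least \<open>\<epsilon>\<close> apart: a compact set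
    off the diagonal, so the minimum of \<open>G\<close> on it is positive and serves as
    \<open>\<eta>\<close>.\<close>
  define S where "S = (K \<times> K) \<inter> ?d -` {\<epsilon>..}"
  have cKK: "compact (K \<times> K)" using K by (simp add: compact_Times)
  have "closedin (top_of_set (K \<times> K)) S"
    unfolding S_def using continuous_closedin_preimage[OF d] by simp
  then have S: "compact S" using closedin_compact[OF cKK] by blast
  have Sub: "S \<subseteq> K \<times> K" by (auto simp: S_def)
  show ?thesis
  proof (cases "S = {}")
    case True
    then have "?d (x,y) < \<epsilon>" if "x \<in> K" "y \<in> K" for x y
      using that unfolding S_def by fastforce
    then show ?thesis using that[of 1] by auto
  next
    case False
    then obtain q where q: "q \<in> S" "\<And>r. r \<in> S \<Longrightarrow> G q \<le> G r"
      using continuous_attains_inf[OF S False continuous_on_subset[OF G Sub]] by blast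
    have "fst q \<noteq> snd q"
    proof
      assume "fst q = snd q"
      moreover have "\<phi> (snd q) \<in> mspace M"
        using q(1) Sub continuous_map_to_mspace[OF \<phi>] by auto
      ultimately show False using q(1) \<open>\<epsilon> > 0\<close> by (auto simp: S_def mdist_refl)
    qed
    then have "0 < G q" using G0[of "fst q" "snd q"] q(1) Sub by auto
    moreover have "mdist M (\<phi> x) (\<phi> y) < \<epsilon>" if "x \<in> K" "y \<in> K" "G (x, y) < G q" for x y
      using q(2)[of "(x,y)"] that unfolding S_def by fastforce
    ultimately show ?thesis using that by blast
  qed
qed

subsection \<open>Small extensions in locally connected spaces\<close>

text \<open>A Lebesgue number for the neighbourhoods \<open>V q\<close> makes the size in
  \<open>LC\<close> uniform. The balls have radius \<open>\<epsilon>/2\<close> because the extension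
  stays near \<open>q\<close> rather than near \<open>p\<close>, and \<open>p\<close> itself lies in
  the same ball.\<close>

lemma LC_uniform_on_compact:
  assumes LC: "LC d (mtopology_of M)" and K: "compactin (mtopology_of M) K" and "\<epsilon> > 0"
  obtains \<delta> where "\<delta> > 0"
    "\<And>p i f. \<lbrakk>p \<in> K; i \<le> d;
       continuous_map (top_of_set (unit_cube_boundary (Suc i))) (mtopology_of M) f;
       \<And>x. x \<in> unit_cube_boundary (Suc i) \<Longrightarrow> mdist M p (f x) < \<delta>\<rbrakk> \<Longrightarrow>
       \<exists>g. continuous_map (top_of_set (unit_cube_set (Suc i))) (mtopology_of M) g \<and>
         (\<forall>x\<in>unit_cube_boundary (Suc i). g x = f x) \<and>
         (\<forall>x\<in>unit_cube_set (Suc i). mdist M p (g x) < \<epsilon>)"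
proof -
  interpret M: Metric_space "mspace M" "mdist M" by simp
  have KM: "K \<subseteq> mspace M" using K compactin_subset_topspace by fastforce
  have mt: "mtopology_of M = M.mtopology" by (simp add: mtopology_of_def)
  have sub: "subtopology (unit_cube (Suc i)) (unit_cube_boundary (Suc i))
      = top_of_set (unit_cube_boundary (Suc i))" for i
    unfolding unit_cube_eq_top_of_set subtopology_subtopology
    by (rule arg_cong[where f = top_of_set]) (auto simp: mem_unit_cube_boundary)
  define good where "good V U \<longleftrightarrow> (\<forall>i\<le>d. \<forall>f.
      continuous_map (top_of_set (unit_cube_boundary (Suc i))) (subtopology (mtopology_of M) V) f \<longrightarrow>
      (\<exists>g. continuous_map (top_of_set (unit_cube_set (Suc i))) (subtopology (mtopology_of M) U) g \<and>
           (\<forall>p \<in> unit_cube_boundary (Suc i). g p = f p)))" for V U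
  have "\<exists>V. openin M.mtopology V \<and> q \<in> V \<and> V \<subseteq> M.mball q (\<epsilon>/2) \<and> good V (M.mball q (\<epsilon>/2))"
    if q: "q \<in> K" for q
  proof -
    have "q \<in> topspace (mtopology_of M)" "openin (mtopology_of M) (M.mball q (\<epsilon>/2))"
      "q \<in> M.mball q (\<epsilon>/2)"
      using q KM \<open>\<epsilon> > 0\<close> by (auto simp: mt)
    then show ?thesis
      using LC unfolding LC_def good_def Suc_eq_plus1[symmetric] sub
      unfolding unit_cube_eq_top_of_set mt by blast
  qed
  then obtain V where V: "\<And>q. q \<in> K \<Longrightarrow> openin M.mtopology (V q)" "\<And>q. q \<in> K \<Longrightarrow> q \<in> V q"
    "\<And>q. q \<in> K \<Longrightarrow> V q \<subseteq> M.mball q (\<epsilon>/2)" "\<And>q. q \<in> K \<Longrightarrow> good (V q) (M.mball q (\<epsilon>/2))"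
    by metis
  have "\<exists>\<delta>>0. \<forall>x\<in>K. \<exists>U\<in>V ` K. M.mball x \<delta> \<subseteq> U"
  proof (rule M.lebesgue_number)
    show "compactin M.mtopology K" using K mt by simp
    show "K \<subseteq> \<Union> (V ` K)" using V(2) by blast
    show "openin M.mtopology U" if "U \<in> V ` K" for U using V(1) that by blast
  qed
  then obtain \<delta> where \<delta>: "\<delta> > 0" "\<And>p. p \<in> K \<Longrightarrow> \<exists>q\<in>K. M.mball p \<delta> \<subseteq> V q"
    by blast
  show thesis
  proof (rule that[OF \<delta>(1)])
    fix p i f
    let ?B = "unit_cube_boundary (Suc i)" and ?C = "unit_cube_set (Suc i)"
    assume p: "p \<in> K" and i: "i \<le> d" and f: "continuous_map (top_of_set ?B) (mtopology_of M) f"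
      and cl: "\<And>x. x \<in> ?B \<Longrightarrow> mdist M p (f x) < \<delta>"
    obtain q where q: "q \<in> K" "M.mball p \<delta> \<subseteq> V q" using \<delta>(2)[OF p] by blast
    have "f ` ?B \<subseteq> M.mball p \<delta>"
      using continuous_map_to_mspace[OF f] cl p KM by auto
    then have "continuous_map (top_of_set ?B) (subtopology (mtopology_of M) (V q)) f"
      using f q(2) by (simp add: continuous_map_in_subtopology) blast
    then obtain g where
      g: "continuous_map (top_of_set ?C) (subtopology (mtopology_of M) (M.mball q (\<epsilon>/2))) g"
        "\<forall>p \<in> ?B. g p = f p"
      using V(4)[OF q(1)] i unfolding good_def by blast
    have "mdist M p (g x) < \<epsilon>" if x: "x \<in> ?C" for x
    proof -
      have "g x \<in> M.mball q (\<epsilon>/2)"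
        using continuous_map_image_subset_topspace[OF g(1)] x by auto
      moreover have "p \<in> M.mball q (\<epsilon>/2)"
        using V(3)[OF q(1)] q(2) M.centre_in_mball_iff[of p \<delta>] p KM \<delta>(1) by blast
      ultimately show ?thesis
        using M.triangle[of p q "g x"] M.commute[of p q] by auto
    qed
    then show "\<exists>g. continuous_map (top_of_set ?C) (mtopology_of M) g \<and>
         (\<forall>x\<in>?B. g x = f x) \<and> (\<forall>x\<in>?C. mdist M p (g x) < \<epsilon>)"
      using g by (auto simp: continuous_map_in_subtopology)
  qed
qed

lemma continuous_on_coord: "continuous_on S (\<lambda>x :: nat \<Rightarrow> real. x i)"
  by (rule continuous_on_apply) (rule continuous_on_id)

text \<open>The part of the boundary of a box on which a map is prescribed. Directions in
  \<open>L\<close> are free. Degenerate directions contribute no face, since that face would be the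
  whole box; thus \<open>faces_off {} a b\<close> is the boundary of the box within its affine
  hull.\<close>

definition faces_off :: "nat set \<Rightarrow> (nat \<Rightarrow> real) \<Rightarrow> (nat \<Rightarrow> real) \<Rightarrow> (nat \<Rightarrow> real) set" where
  "faces_off L a b = {x \<in> {a..b}. \<exists>i. i \<notin> L \<and> a i < b i \<and> (x i = a i \<or> x i = b i)}"

lemma faces_off_subset: "faces_off L a b \<subseteq> {a..b}"
  by (auto simp: faces_off_def)

lemma closed_faces_off:
  assumes "finite {i. a i < b i}"
  shows "closed (faces_off L a b)"
proof -
  have "faces_off L a b = {a..b} \<inter> (\<Union>i\<in>{i. a i < b i} - L. (\<lambda>x. x i) -` {a i} \<union> (\<lambda>x. x i) -` {b i})"
    by (auto simp: faces_off_def)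
  moreover have "closed ((\<lambda>x :: nat \<Rightarrow> real. x i) -` {c})" for i c
    by (rule closed_vimage) simp_all
  ultimately show ?thesis
    using assms compact_imp_closed[OF compact_Icc_fun[of a b]]
    by (auto intro!: closed_Int closed_UN closed_Un)
qed

text \<open>A box is a cube in its nondegenerate coordinates.\<close>

lemma box_extension_of_cube_extension:
  fixes a b :: "nat \<Rightarrow> real"
  assumes fin: "finite {i. a i < b i}" and ne: "{i. a i < b i} \<noteq> {}"
    and card: "card {i. a i < b i} \<le> Suc d" and ab: "a \<le> b"
    and ext: "\<And>i f. \<lbrakk>i \<le> d;
       continuous_map (top_of_set (unit_cube_boundary (Suc i))) (mtopology_of M) f;
       \<And>x. x \<in> unit_cube_boundary (Suc i) \<Longrightarrow> mdist M p (f x) < \<delta>\<rbrakk> \<Longrightarrow>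
       \<exists>g. continuous_map (top_of_set (unit_cube_set (Suc i))) (mtopology_of M) g \<and>
         (\<forall>x\<in>unit_cube_boundary (Suc i). g x = f x) \<and>
         (\<forall>x\<in>unit_cube_set (Suc i). mdist M p (g x) < \<epsilon>)"
    and h: "continuous_map (top_of_set (faces_off {} a b)) (mtopology_of M) h"
    and cl: "\<And>x. x \<in> faces_off {} a b \<Longrightarrow> mdist M p (h x) < \<delta>"
  obtains h' where "continuous_map (top_of_set {a..b}) (mtopology_of M) h'"
    "\<And>x. x \<in> faces_off {} a b \<Longrightarrow> h' x = h x" "\<And>x. x \<in> {a..b} \<Longrightarrow> mdist M p (h' x) < \<epsilon>"
proof -
  let ?I = "{i. a i < b i}"
  obtain e where e: "card ?I = Suc e" using fin ne by (metis card_gt_0_iff gr0_implies_Suc)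
  obtain \<sigma> where \<sigma>: "bij_betw \<sigma> {0..<Suc e} ?I" using ex_bij_betw_nat_finite[OF fin] e by auto
  define \<tau> where "\<tau> = inv_into {0..<Suc e} \<sigma>"
  have \<sigma>I: "a (\<sigma> j) < b (\<sigma> j)" if "j < Suc e" for j
    using \<sigma> that unfolding bij_betw_def by auto
  have \<tau>e: "\<tau> i < Suc e" and \<sigma>\<tau>: "\<sigma> (\<tau> i) = i" if "a i < b i" for i
    using that \<sigma> inv_into_into[of i \<sigma> "{0..<Suc e}"] f_inv_into_f[of i \<sigma> "{0..<Suc e}"]
    unfolding \<tau>_def bij_betw_def by auto
  have \<tau>\<sigma>: "\<tau> (\<sigma> j) = j" if "j < Suc e" for j
    unfolding \<tau>_def by (rule inv_into_f_f) (use \<sigma> that in \<open>auto simp: bij_betw_def\<close>)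
  have aleb: "a i \<le> b i" for i using ab by (simp add: le_fun_def)
  \<comment> \<open>\<open>\<psi>\<close> is the affine map from the cube to the box and
    \<open>\<kappa>\<close> its inverse, with the nondegenerate coordinates enumerated by
    \<open>\<sigma>\<close>.\<close>
  define \<psi> where "\<psi> u i = (if a i < b i then a i + (b i - a i) * u (\<tau> i) else a i)"
    for u :: "nat \<Rightarrow> real" and i
  define \<kappa> where "\<kappa> x j = (if j < Suc e then (x (\<sigma> j) - a (\<sigma> j)) / (b (\<sigma> j) - a (\<sigma> j)) else 0)"
    for x :: "nat \<Rightarrow> real" and j
  let ?C = "unit_cube_set (Suc e)" and ?B = "unit_cube_boundary (Suc e)"
  have \<psi>C: "\<psi> u \<in> {a..b}" if "u \<in> ?C" for u
  proof -
    have "a i \<le> \<psi> u i \<and> \<psi> u i \<le> b i" for i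
    proof (cases "a i < b i")
      case True
      then have "0 \<le> u (\<tau> i) \<and> u (\<tau> i) \<le> 1" using that \<tau>e by (auto simp: unit_cube_set_iff)
      then have "0 \<le> (b i - a i) * u (\<tau> i)" "(b i - a i) * u (\<tau> i) \<le> b i - a i"
        using True by (auto intro!: mult_nonneg_nonneg mult_left_le)
      moreover have "\<psi> u i = a i + (b i - a i) * u (\<tau> i)" using True by (simp add: \<psi>_def)
      ultimately show ?thesis by linarith
    qed (use aleb[of i] in \<open>simp add: \<psi>_def\<close>)
    then show ?thesis by (simp add: le_fun_def)
  qed
  have \<psi>B: "\<psi> u \<in> faces_off {} a b" if "u \<in> ?B" for u
  proof -
    from that obtain j where j: "j < Suc e" "u j = 0 \<or> u j = 1" and u: "u \<in> ?C"
      by (auto simp: mem_unit_cube_boundary)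
    then have "\<psi> u (\<sigma> j) = a (\<sigma> j) \<or> \<psi> u (\<sigma> j) = b (\<sigma> j)"
      using \<sigma>I[OF j(1)] \<tau>\<sigma>[OF j(1)] by (auto simp: \<psi>_def)
    then show ?thesis using \<psi>C[OF u] \<sigma>I[OF j(1)] by (auto simp: faces_off_def)
  qed
  have \<kappa>C: "\<kappa> x \<in> ?C" if "x \<in> {a..b}" for x
  proof -
    have "0 \<le> \<kappa> x j \<and> \<kappa> x j \<le> 1" if "j < Suc e" for j
      using \<open>x \<in> {a..b}\<close> \<sigma>I[OF that] that by (auto simp: \<kappa>_def le_fun_def)
    then show ?thesis by (simp add: unit_cube_set_iff) (simp add: \<kappa>_def)
  qed
  have \<kappa>B: "\<kappa> x \<in> ?B" if "x \<in> faces_off {} a b" for x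
  proof -
    from that obtain i where i: "a i < b i" "x i = a i \<or> x i = b i" and x: "x \<in> {a..b}"
      by (auto simp: faces_off_def)
    have "\<kappa> x (\<tau> i) = 0 \<or> \<kappa> x (\<tau> i) = 1"
      using i \<tau>e[OF i(1)] by (auto simp: \<kappa>_def \<sigma>\<tau>)
    then show ?thesis using \<kappa>C[OF x] \<tau>e[OF i(1)] by (auto simp: mem_unit_cube_boundary)
  qed
  have \<psi>\<kappa>: "\<psi> (\<kappa> x) = x" if "x \<in> {a..b}" for x
  proof
    fix i
    show "\<psi> (\<kappa> x) i = x i"
    proof (cases "a i < b i")
      case True
      then show ?thesis using \<tau>e[OF True] \<sigma>\<tau>[OF True] by (simp add: \<psi>_def \<kappa>_def)
    next
      case False
      then have "a i = b i" using aleb[of i] by simp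
      moreover have "a i \<le> x i" "x i \<le> b i" using that by (auto simp: le_fun_def)
      ultimately show ?thesis by (simp add: \<psi>_def)
    qed
  qed
  have c\<psi>: "continuous_on ?B \<psi>"
  proof (rule continuous_on_coordinatewise_then_product)
    show "continuous_on ?B (\<lambda>u. \<psi> u i)" for i
      by (cases "a i < b i") (auto simp: \<psi>_def intro!: continuous_on_add continuous_on_mult continuous_on_coord)
  qed
  have c\<kappa>: "continuous_on {a..b} \<kappa>"
  proof (rule continuous_on_coordinatewise_then_product)
    show "continuous_on {a..b} (\<lambda>x. \<kappa> x j)" for j
      using \<sigma>I[of j]
      by (cases "j < Suc e") (auto simp: \<kappa>_def intro!: continuous_on_divide continuous_on_diff continuous_on_coord)
  qed
  have "continuous_map (top_of_set ?B) (mtopology_of M) (\<lambda>u. h (\<psi> u))"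
    using \<psi>B by (intro continuous_map_compose_on[OF h c\<psi>]) auto
  then obtain g where g: "continuous_map (top_of_set ?C) (mtopology_of M) g"
    "\<forall>x\<in>?B. g x = h (\<psi> x)" "\<forall>x\<in>?C. mdist M p (g x) < \<epsilon>"
    using ext[of e "\<lambda>u. h (\<psi> u)"] card e cl \<psi>B by auto
  show thesis
  proof (rule that[of "\<lambda>x. g (\<kappa> x)"])
    show "continuous_map (top_of_set {a..b}) (mtopology_of M) (\<lambda>x. g (\<kappa> x))"
      using \<kappa>C by (intro continuous_map_compose_on[OF g(1) c\<kappa>]) auto
    show "g (\<kappa> x) = h x" if "x \<in> faces_off {} a b" for x
      using \<kappa>B[OF that] g(2) \<psi>\<kappa>[of x] that faces_off_subset[of "{}" a b] by auto
    show "mdist M p (g (\<kappa> x)) < \<epsilon>" if "x \<in> {a..b}" for x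
      using \<kappa>C[OF that] g(3) by blast
  qed
qed

text \<open>On a box with all edges short, \<open>\<phi>\<close> is nearly its value at the corner
  \<open>a\<close>, so the uniform form of \<open>LC\<close> centred at \<open>\<phi> a\<close>
  applies. Halving \<open>\<delta>\<close> and \<open>\<epsilon>\<close> pays for the oscillation of
  \<open>\<phi>\<close> over the box.\<close>

lemma box_extension_base:
  fixes a\<^sub>0 b\<^sub>0 :: "nat \<Rightarrow> real"
  assumes LC: "LC d (mtopology_of M)"
    and \<phi>: "continuous_map (top_of_set {a\<^sub>0..b\<^sub>0}) (mtopology_of M) \<phi>"
    and fin: "finite {i. a\<^sub>0 i < b\<^sub>0 i}" and card: "card {i. a\<^sub>0 i < b\<^sub>0 i} \<le> Suc d"
    and "\<epsilon> > 0"
  shows "\<exists>\<delta>>0. \<exists>\<eta>>0. \<forall>a b h. a\<^sub>0 \<le> a \<longrightarrow> a \<le> b \<longrightarrow> b \<le> b\<^sub>0 \<longrightarrow> (\<forall>i. b i - a i \<le> \<eta>) \<longrightarrow>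
      continuous_map (top_of_set (faces_off {} a b)) (mtopology_of M) h \<longrightarrow>
      (\<forall>x\<in>faces_off {} a b. mdist M (\<phi> x) (h x) < \<delta>) \<longrightarrow>
      (\<exists>h'. continuous_map (top_of_set {a..b}) (mtopology_of M) h' \<and>
         (\<forall>x\<in>faces_off {} a b. h' x = h x) \<and> (\<forall>x\<in>{a..b}. mdist M (\<phi> x) (h' x) < \<epsilon>))"
proof -
  let ?K = "{a\<^sub>0..b\<^sub>0}" and ?I = "{i. a\<^sub>0 i < b\<^sub>0 i}"
  have "compactin (top_of_set ?K) ?K"
    using compact_Icc_fun[of a\<^sub>0 b\<^sub>0] by (simp add: compactin_subtopology)
  then have K: "compactin (mtopology_of M) (\<phi> ` ?K)"
    using image_compactin[OF _ \<phi>] by blast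
  have "\<epsilon>/2 > 0" using \<open>\<epsilon> > 0\<close> by simp
  from LC_uniform_on_compact[OF LC K this] obtain \<delta> where "\<delta> > 0" and
    \<delta>: "\<And>p i f. \<lbrakk>p \<in> \<phi> ` ?K; i \<le> d;
       continuous_map (top_of_set (unit_cube_boundary (Suc i))) (mtopology_of M) f;
       \<And>x. x \<in> unit_cube_boundary (Suc i) \<Longrightarrow> mdist M p (f x) < \<delta>\<rbrakk> \<Longrightarrow>
       \<exists>g. continuous_map (top_of_set (unit_cube_set (Suc i))) (mtopology_of M) g \<and>
         (\<forall>x\<in>unit_cube_boundary (Suc i). g x = f x) \<and>
         (\<forall>x\<in>unit_cube_set (Suc i). mdist M p (g x) < \<epsilon>/2)"
    by blast
  \<comment> \<open>Only coordinates that vary within the big box are summed, which keeps the sum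
    finite and still separates its points.\<close>
  define G where "G q = (\<Sum>i\<in>?I. \<bar>fst q i - snd q i\<bar>)" for q :: "(nat \<Rightarrow> real) \<times> (nat \<Rightarrow> real)"
  have "continuous_on (?K \<times> ?K) G"
    unfolding G_def
    by (intro continuous_on_sum continuous_on_rabs continuous_on_diff continuous_on_apply
        continuous_on_fst continuous_on_snd continuous_on_id)
  moreover have "0 < G (x, y)" if "x \<in> ?K" "y \<in> ?K" "x \<noteq> y" for x y
  proof -
    obtain i where i: "x i \<noteq> y i" using \<open>x \<noteq> y\<close> by (auto simp: fun_eq_iff)
    moreover have "a\<^sub>0 i \<le> x i" "x i \<le> b\<^sub>0 i" "a\<^sub>0 i \<le> y i" "y i \<le> b\<^sub>0 i"
      using that by (auto simp: le_fun_def)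
    ultimately have "i \<in> ?I" by (auto simp: not_less) 
    then show ?thesis unfolding G_def using i by (intro sum_pos2[OF fin]) auto
  qed
  moreover have "min (\<delta>/2) (\<epsilon>/2) > 0" using \<open>\<delta> > 0\<close> \<open>\<epsilon> > 0\<close> by simp
  ultimately obtain \<eta> where "\<eta> > 0" and
    \<eta>: "\<And>x y. x \<in> ?K \<Longrightarrow> y \<in> ?K \<Longrightarrow> G (x, y) < \<eta> \<Longrightarrow> mdist M (\<phi> x) (\<phi> y) < min (\<delta>/2) (\<epsilon>/2)"
    using uniformly_close[OF compact_Icc_fun \<phi>] by metis
  have "\<exists>h'. continuous_map (top_of_set {a..b}) (mtopology_of M) h' \<and>
         (\<forall>x\<in>faces_off {} a b. h' x = h x) \<and> (\<forall>x\<in>{a..b}. mdist M (\<phi> x) (h' x) < \<epsilon>)"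
    if ab: "a\<^sub>0 \<le> a" "a \<le> b" "b \<le> b\<^sub>0" and len: "\<forall>i. b i - a i \<le> \<eta> / (card ?I + 1)"
      and h: "continuous_map (top_of_set (faces_off {} a b)) (mtopology_of M) h"
      and cl: "\<forall>x\<in>faces_off {} a b. mdist M (\<phi> x) (h x) < \<delta>/2" for a b h
  proof -
    have sub: "{a..b} \<subseteq> ?K" using ab by (meson atLeastatMost_subset_iff)
    have aK: "a \<in> {a..b}" using ab by simp
    have I: "{i. a i < b i} \<subseteq> ?I"
      using ab unfolding le_fun_def by (smt (verit) mem_Collect_eq subsetI)
    have \<phi>M: "\<phi> x \<in> mspace M" if "x \<in> {a..b}" for x
      using continuous_map_to_mspace[OF \<phi>] that sub by blast
    have osc: "mdist M (\<phi> a) (\<phi> x) < min (\<delta>/2) (\<epsilon>/2)" if x: "x \<in> {a..b}" for x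
    proof -
      have "\<bar>a i - x i\<bar> \<le> \<eta> / (card ?I + 1)" for i
        using x len[rule_format, of i] by (auto simp: le_fun_def) (smt (verit))
      then have "G (a, x) \<le> real (card ?I) * (\<eta> / (card ?I + 1))"
        unfolding G_def by (intro sum_bounded_above) auto
      also have "\<dots> < \<eta>" using \<open>\<eta> > 0\<close> by (simp add: field_simps)
      finally show ?thesis using \<eta> aK x sub by blast
    qed
    show ?thesis
    proof (cases "{i. a i < b i} = {}")
      \<comment> \<open>The box is a single point without boundary, so nothing is prescribed and
        \<open>\<phi>\<close> itself serves; \<open>LC\<close> starts only with boxes of dimension
        1.\<close>
      case True
      then have "faces_off {} a b = {}" by (auto simp: faces_off_def)
      moreover have "continuous_map (top_of_set {a..b}) (mtopology_of M) \<phi>"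
        using continuous_map_subset_on[OF \<phi> sub] .
      ultimately show ?thesis using \<open>\<epsilon> > 0\<close> \<phi>M
        by (intro exI[of _ \<phi>]) (auto simp: mdist_refl)
    next
      case False
      have fin': "finite {i. a i < b i}" using finite_subset[OF I fin] .
      have card': "card {i. a i < b i} \<le> Suc d" using card_mono[OF fin I] card by linarith
      have cl': "mdist M (\<phi> a) (h x) < \<delta>" if x: "x \<in> faces_off {} a b" for x
      proof -
        have "x \<in> {a..b}" using x faces_off_subset by blast
        then show ?thesis
          using mdist_triangle[OF \<phi>M[OF aK] \<phi>M continuous_map_to_mspace[OF h x], of x]
            osc[of x] cl[rule_format, OF x] by linarith
      qed
      have p: "\<phi> a \<in> \<phi> ` ?K" using aK sub by blast
      obtain h' where h': "continuous_map (top_of_set {a..b}) (mtopology_of M) h'"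
        "\<And>x. x \<in> faces_off {} a b \<Longrightarrow> h' x = h x"
        "\<And>x. x \<in> {a..b} \<Longrightarrow> mdist M (\<phi> a) (h' x) < \<epsilon>/2"
        by (rule box_extension_of_cube_extension[OF fin' False card' ab(2) \<delta>[OF p] h cl']) auto
      have "mdist M (\<phi> x) (h' x) < \<epsilon>" if x: "x \<in> {a..b}" for x
        using mdist_triangle[OF \<phi>M[OF x] \<phi>M[OF aK] continuous_map_to_mspace[OF h'(1) x]]
          osc[OF x] h'(3)[OF x] mdist_commute[of M "\<phi> x" "\<phi> a"] by linarith
      then show ?thesis using h' by blast
    qed
  qed
  then show ?thesis
    using \<open>\<delta> > 0\<close> \<open>\<eta> > 0\<close>
    by (intro exI[of _ "\<delta>/2"] conjI exI[of _ "\<eta> / (card ?I + 1)"]) auto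
qed

lemma Icc_fun_upd_iff:
  fixes a b x :: "nat \<Rightarrow> real"
  assumes "a s \<le> p" "q \<le> b s"
  shows "x \<in> {a(s := p)..b(s := q)} \<longleftrightarrow> x \<in> {a..b} \<and> p \<le> x s \<and> x s \<le> q"
proof -
  have "x \<in> {a(s := p)..b(s := q)} \<longleftrightarrow> (\<forall>i. (a(s := p)) i \<le> x i \<and> x i \<le> (b(s := q)) i)"
    by (auto simp: le_fun_def)
  also have "\<dots> \<longleftrightarrow> (\<forall>i. i \<noteq> s \<longrightarrow> a i \<le> x i \<and> x i \<le> b i) \<and> p \<le> x s \<and> x s \<le> q"
    by (metis fun_upd_apply)
  also have "\<dots> \<longleftrightarrow> (\<forall>i. a i \<le> x i \<and> x i \<le> b i) \<and> p \<le> x s \<and> x s \<le> q"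
    using assms by (metis order_trans)
  finally show ?thesis by (auto simp: le_fun_def)
qed

text \<open>A box is cut into thin slabs along each coordinate of \<open>L\<close>: the partial map is extended first to
  the walls between slabs and then to the slabs.\<close>

lemma box_extension:
  fixes a\<^sub>0 b\<^sub>0 :: "nat \<Rightarrow> real"
  assumes LC: "LC d (mtopology_of M)"
    and \<phi>: "continuous_map (top_of_set {a\<^sub>0..b\<^sub>0}) (mtopology_of M) \<phi>"
    and fin: "finite {i. a\<^sub>0 i < b\<^sub>0 i}" and card: "card {i. a\<^sub>0 i < b\<^sub>0 i} \<le> Suc d"
    and "finite L"
  shows "\<forall>\<epsilon>>0. \<exists>\<delta>>0. \<exists>\<eta>>0. \<forall>a b h. a\<^sub>0 \<le> a \<longrightarrow> a \<le> b \<longrightarrow> b \<le> b\<^sub>0 \<longrightarrow>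
      (\<forall>i. i \<notin> L \<longrightarrow> b i - a i \<le> \<eta>) \<longrightarrow>
      continuous_map (top_of_set (faces_off L a b)) (mtopology_of M) h \<longrightarrow>
      (\<forall>x\<in>faces_off L a b. mdist M (\<phi> x) (h x) < \<delta>) \<longrightarrow>
      (\<exists>h'. continuous_map (top_of_set {a..b}) (mtopology_of M) h' \<and>
         (\<forall>x\<in>faces_off L a b. h' x = h x) \<and> (\<forall>x\<in>{a..b}. mdist M (\<phi> x) (h' x) < \<epsilon>))"
  using \<open>finite L\<close>
proof (induction L rule: finite_induct)
  case empty
  show ?case using box_extension_base[OF LC \<phi> fin card] by simp
next
  case (insert s L)
  show ?case
  proof (intro allI impI)
    fix \<epsilon> :: real assume "\<epsilon> > 0"
    \<comment> \<open>Two uses of the induction hypothesis with chained tolerances: maps on the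
      walls come out within \<open>\<delta>1\<close>, which is the input accuracy for filling the
      slabs within \<open>\<epsilon>\<close>.\<close>
    obtain \<delta>1 \<eta>1 where p1: "\<delta>1 > 0" "\<eta>1 > 0" and
      E1: "\<And>a b h. a\<^sub>0 \<le> a \<Longrightarrow> a \<le> b \<Longrightarrow> b \<le> b\<^sub>0 \<Longrightarrow> \<forall>i. i \<notin> L \<longrightarrow> b i - a i \<le> \<eta>1 \<Longrightarrow>
        continuous_map (top_of_set (faces_off L a b)) (mtopology_of M) h \<Longrightarrow>
        \<forall>x\<in>faces_off L a b. mdist M (\<phi> x) (h x) < \<delta>1 \<Longrightarrow>
        \<exists>h'. continuous_map (top_of_set {a..b}) (mtopology_of M) h' \<and>
         (\<forall>x\<in>faces_off L a b. h' x = h x) \<and> (\<forall>x\<in>{a..b}. mdist M (\<phi> x) (h' x) < \<epsilon>)"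
      using insert.IH[rule_format, OF \<open>\<epsilon> > 0\<close>] by blast
    obtain \<delta>2 \<eta>2 where p2: "\<delta>2 > 0" "\<eta>2 > 0" and
      E2: "\<And>a b h. a\<^sub>0 \<le> a \<Longrightarrow> a \<le> b \<Longrightarrow> b \<le> b\<^sub>0 \<Longrightarrow> \<forall>i. i \<notin> L \<longrightarrow> b i - a i \<le> \<eta>2 \<Longrightarrow>
        continuous_map (top_of_set (faces_off L a b)) (mtopology_of M) h \<Longrightarrow>
        \<forall>x\<in>faces_off L a b. mdist M (\<phi> x) (h x) < \<delta>2 \<Longrightarrow>
        \<exists>h'. continuous_map (top_of_set {a..b}) (mtopology_of M) h' \<and>
         (\<forall>x\<in>faces_off L a b. h' x = h x) \<and> (\<forall>x\<in>{a..b}. mdist M (\<phi> x) (h' x) < \<delta>1)"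
      using insert.IH[rule_format, OF \<open>\<delta>1 > 0\<close>] by blast
    have "\<exists>h'. continuous_map (top_of_set {a..b}) (mtopology_of M) h' \<and>
         (\<forall>x\<in>faces_off (insert s L) a b. h' x = h x) \<and> (\<forall>x\<in>{a..b}. mdist M (\<phi> x) (h' x) < \<epsilon>)"
      if ab: "a\<^sub>0 \<le> a" "a \<le> b" "b \<le> b\<^sub>0"
        and len: "\<forall>i. i \<notin> insert s L \<longrightarrow> b i - a i \<le> min \<eta>1 \<eta>2"
        and h: "continuous_map (top_of_set (faces_off (insert s L) a b)) (mtopology_of M) h"
        and cl: "\<forall>x\<in>faces_off (insert s L) a b. mdist M (\<phi> x) (h x) < min \<delta>1 \<delta>2" for a b h
    proof (cases "a s < b s")
      \<comment> \<open>The direction \<open>s\<close> is degenerate and has no faces, so freeing it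
        changes nothing.\<close>
      case False
      then have "a s = b s" using ab(2) by (simp add: le_fun_def order_antisym not_less)
      then have F: "faces_off (insert s L) a b = faces_off L a b"
        unfolding faces_off_def by (intro Collect_cong) (metis insert_iff less_irrefl)
      have "\<forall>i. i \<notin> L \<longrightarrow> b i - a i \<le> \<eta>1"
        using len \<open>a s = b s\<close> p1 by (metis diff_self insert_iff less_eq_real_def min.boundedE)
      then show ?thesis using E1[OF ab] h cl unfolding F by auto
    next
      case True
      let ?F = "faces_off (insert s L) a b"
      obtain N where N: "real N > (b s - a s) / \<eta>1" "N > 0"
        using reals_Archimedean2 by (metis True diff_gt_0_iff_gt divide_pos_pos of_nat_0_less_iff order_less_trans p1(2))
      define w where "w = (b s - a s) / N"
      have w: "w > 0" "w \<le> \<eta>1" "N * w = b s - a s"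
        using N True p1 by (auto simp: w_def field_simps)
      define t where "t r = a s + real r * w" for r
      have t0: "t 0 = a s" and tN: "t N = b s" using w(3) by (auto simp: t_def)
      have tmono: "t r \<le> t q \<longleftrightarrow> r \<le> q" for r q using w(1) by (simp add: t_def)
      have tinj: "t r = t q \<longleftrightarrow> r = q" for r q using w(1) by (simp add: t_def)
      have tS: "t (Suc r) = t r + w" for r by (simp add: t_def algebra_simps)
      have tab: "a s \<le> t r" "r \<le> N \<Longrightarrow> t r \<le> b s" for r using tmono[of 0 r] tmono[of r N] t0 tN by auto
      have fin': "finite {i. a i < b i}"
      proof (rule finite_subset[OF _ fin])
        show "{i. a i < b i} \<subseteq> {i. a\<^sub>0 i < b\<^sub>0 i}"
          using ab unfolding le_fun_def by (smt (verit) mem_Collect_eq subsetI)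
      qed
      let ?aw = "\<lambda>r. a(s := t r)" and ?bw = "\<lambda>r. b(s := t r)"
      have wall: "x \<in> {?aw r..?bw r} \<longleftrightarrow> x \<in> {a..b} \<and> x s = t r" if "r \<le> N" for r x
        using Icc_fun_upd_iff[of a s "t r" "t r" b x] tab[of r] that by auto
      have slab: "x \<in> {?aw r..?bw (Suc r)} \<longleftrightarrow> x \<in> {a..b} \<and> t r \<le> x s \<and> x s \<le> t (Suc r)"
        if "r < N" for r x
        using Icc_fun_upd_iff[of a s "t r" "t (Suc r)" b x] tab[of r] tab[of "Suc r"] that by auto
      have box: "a\<^sub>0 \<le> ?aw r" "?aw r \<le> ?bw q" "?bw q \<le> b\<^sub>0" if "r \<le> q" "q \<le> N" for r q
      proof -
        have "a\<^sub>0 s \<le> a s" "b s \<le> b\<^sub>0 s" using ab by (auto simp: le_fun_def)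
        then have "a\<^sub>0 s \<le> t r" "t r \<le> t q" "t q \<le> b\<^sub>0 s"
          using tab[of r] tab[of q] tmono[of r q] that by auto
        then show "a\<^sub>0 \<le> ?aw r" "?aw r \<le> ?bw q" "?bw q \<le> b\<^sub>0"
          using ab by (auto simp: le_fun_def)
      qed
      \<comment> \<open>A wall is degenerate in direction \<open>s\<close>; its boundary in the
        remaining directions is therefore exactly its part of the prescribed set.\<close>
      have Fw: "faces_off L (?aw r) (?bw r) = ?F \<inter> {?aw r..?bw r}" if "r \<le> N" for r
      proof (rule set_eqI)
        fix x
        have "(\<exists>i. i \<notin> L \<and> ?aw r i < ?bw r i \<and> (x i = ?aw r i \<or> x i = ?bw r i)) \<longleftrightarrow>
            (\<exists>i. i \<notin> insert s L \<and> a i < b i \<and> (x i = a i \<or> x i = b i))"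
          by (metis fun_upd_apply insert_iff less_irrefl)
        then show "x \<in> faces_off L (?aw r) (?bw r) \<longleftrightarrow> x \<in> ?F \<inter> {?aw r..?bw r}"
          using wall[OF that, of x] unfolding faces_off_def by blast
      qed
      have "\<exists>hw. continuous_map (top_of_set {?aw r..?bw r}) (mtopology_of M) hw \<and>
         (\<forall>x\<in>faces_off L (?aw r) (?bw r). hw x = h x) \<and>
         (\<forall>x\<in>{?aw r..?bw r}. mdist M (\<phi> x) (hw x) < \<delta>1)" if "r \<le> N" for r
      proof (rule E2)
        show "\<forall>i. i \<notin> L \<longrightarrow> ?bw r i - ?aw r i \<le> \<eta>2" using len p2(2) by auto
        show "continuous_map (top_of_set (faces_off L (?aw r) (?bw r))) (mtopology_of M) h"
          by (rule continuous_map_subset_on[OF h]) (use Fw[OF that] in auto)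
        show "\<forall>x\<in>faces_off L (?aw r) (?bw r). mdist M (\<phi> x) (h x) < \<delta>2"
          using cl Fw[OF that] by auto
      qed (use box[of r r] that in auto)
      then obtain hw where hw: "\<And>r. r \<le> N \<Longrightarrow> continuous_map (top_of_set {?aw r..?bw r}) (mtopology_of M) (hw r)"
        "\<And>r x. r \<le> N \<Longrightarrow> x \<in> ?F \<Longrightarrow> x \<in> {?aw r..?bw r} \<Longrightarrow> hw r x = h x"
        "\<And>r x. r \<le> N \<Longrightarrow> x \<in> {?aw r..?bw r} \<Longrightarrow> mdist M (\<phi> x) (hw r x) < \<delta>1"
        using Fw by (metis (no_types, lifting) IntI)
      \<comment> \<open>Index \<open>Suc N\<close> stands for the prescribed set \<open>?F\<close>,
        the indices up to \<open>N\<close> for the walls: one finite closed family for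
        pasting.\<close>
      define P where "P r = (if r \<le> N then {?aw r..?bw r} else ?F)" for r
      have PN: "P r = {?aw r..?bw r}" if "r \<le> N" for r using that by (simp add: P_def)
      have PF: "P r = ?F" if "\<not> r \<le> N" for r using that by (simp add: P_def)
      define p where "p r = (if r \<le> N then hw r else h)" for r
      define T where "T = \<Union> (P ` {..Suc N})"
      have PT: "P r \<subseteq> T" if "r \<le> Suc N" for r using that by (auto simp: T_def)
      have FT: "?F \<subseteq> T" using PT[of "Suc N"] by (simp add: P_def)
      obtain g where g: "continuous_map (top_of_set T) (mtopology_of M) g"
        "\<And>x r. \<lbrakk>r \<in> {..Suc N}; x \<in> topspace (top_of_set T) \<inter> P r\<rbrakk> \<Longrightarrow> g x = p r x"
      proof (rule pasting_lemma_exists_closed[of "{..Suc N}" "top_of_set T" P "mtopology_of M" p])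
        show "topspace (top_of_set T) \<subseteq> \<Union> (P ` {..Suc N})" by (simp add: T_def)
        show "closedin (top_of_set T) (P r)" if "r \<in> {..Suc N}" for r
          using PT[of r] that closed_faces_off[OF fin'] compact_imp_closed[OF compact_Icc_fun]
          by (intro closed_subset) (auto simp: P_def)
        show "continuous_map (subtopology (top_of_set T) (P r)) (mtopology_of M) (p r)"
          if "r \<in> {..Suc N}" for r
          using PT[of r] that hw(1)[of r] h
          by (auto simp: subtopology_subtopology Int_absorb1 P_def p_def)
        show "p r x = p q x" if "r \<in> {..Suc N}" "q \<in> {..Suc N}"
          "x \<in> topspace (top_of_set T) \<inter> P r \<inter> P q" for r q x
        proof -
          have x: "x \<in> P r" "x \<in> P q" using that by blast+
          consider "r \<le> N" "q \<le> N" | "r \<le> N" "\<not> q \<le> N" | "\<not> r \<le> N" "q \<le> N" | "\<not> r \<le> N" "\<not> q \<le> N"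
            by blast
          then show ?thesis
          proof cases
            case 1
            then have "x s = t r" "x s = t q" using x wall PN by metis+
            then show ?thesis using tinj by metis
          next
            case 2 then show ?thesis using x hw(2) PN PF by (metis p_def)
          next
            case 3 then show ?thesis using x hw(2) PN PF by (metis p_def)
          next
            case 4 then show ?thesis by (simp add: p_def)
          qed
        qed
      qed auto
      have gF: "g x = h x" if "x \<in> ?F" for x
        using g(2)[of "Suc N" x] FT that by (auto simp: P_def p_def)
      have gcl: "mdist M (\<phi> x) (g x) < \<delta>1" if "x \<in> T" for x
      proof -
        obtain r where r: "r \<le> Suc N" "x \<in> P r" using \<open>x \<in> T\<close> by (auto simp: T_def)
        then have "g x = p r x" using g(2)[of r x] \<open>x \<in> T\<close> by auto
        then show ?thesis using r hw(3)[of r x] cl by (auto simp: P_def p_def split: if_splits)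
      qed
      \<comment> \<open>A face of a slab lies in a wall if its direction is \<open>s\<close>, and in
        the prescribed set otherwise; \<open>g\<close> is defined on both.\<close>
      have FsT: "faces_off L (?aw r) (?bw (Suc r)) \<subseteq> T" if r: "r < N" for r
      proof
        fix x assume x: "x \<in> faces_off L (?aw r) (?bw (Suc r))"
        then have xs: "x \<in> {a..b}" using slab[OF r] faces_off_subset by blast
        from x obtain i where i: "i \<notin> L" "?aw r i < ?bw (Suc r) i" "x i = ?aw r i \<or> x i = ?bw (Suc r) i"
          by (auto simp: faces_off_def)
        show "x \<in> T"
        proof (cases "i = s")
          case True
          then have "x \<in> {?aw r..?bw r} \<or> x \<in> {?aw (Suc r)..?bw (Suc r)}"
            using i(3) xs r wall[of r x] wall[of "Suc r" x] by auto
          then have "x \<in> P r \<or> x \<in> P (Suc r)" using r by (simp add: P_def)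
          then show ?thesis using PT[of r] PT[of "Suc r"] r by auto
        next
          case False
          then have "x \<in> ?F" using i xs by (auto simp: faces_off_def)
          then show ?thesis using FT by blast
        qed
      qed
      have "\<exists>hs. continuous_map (top_of_set {?aw r..?bw (Suc r)}) (mtopology_of M) hs \<and>
         (\<forall>x\<in>faces_off L (?aw r) (?bw (Suc r)). hs x = g x) \<and>
         (\<forall>x\<in>{?aw r..?bw (Suc r)}. mdist M (\<phi> x) (hs x) < \<epsilon>)" if "r < N" for r
      proof (rule E1)
        show "\<forall>i. i \<notin> L \<longrightarrow> ?bw (Suc r) i - ?aw r i \<le> \<eta>1" using len w(2) tS by auto
        show "continuous_map (top_of_set (faces_off L (?aw r) (?bw (Suc r)))) (mtopology_of M) g"
          by (rule continuous_map_subset_on[OF g(1) FsT[OF that]])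
        show "\<forall>x\<in>faces_off L (?aw r) (?bw (Suc r)). mdist M (\<phi> x) (g x) < \<delta>1"
          using gcl FsT[OF that] by auto
      qed (use box[of r "Suc r"] that in auto)
      then obtain hs where hs: "\<And>r. r < N \<Longrightarrow> continuous_map (top_of_set {?aw r..?bw (Suc r)}) (mtopology_of M) (hs r)"
        "\<And>r x. r < N \<Longrightarrow> x \<in> faces_off L (?aw r) (?bw (Suc r)) \<Longrightarrow> hs r x = g x"
        "\<And>r x. r < N \<Longrightarrow> x \<in> {?aw r..?bw (Suc r)} \<Longrightarrow> mdist M (\<phi> x) (hs r x) < \<epsilon>"
        by metis
      have cover: "\<exists>r<N. x \<in> {?aw r..?bw (Suc r)}" if x: "x \<in> {a..b}" for x
      proof -
        have xs: "a s \<le> x s" "x s \<le> b s" using x by (auto simp: le_fun_def)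
        define r where "r = (LEAST r. x s \<le> t (Suc r))"
        have ex: "x s \<le> t (Suc (N - 1))" using xs tN N(2) by simp
        have r1: "x s \<le> t (Suc r)" unfolding r_def by (rule LeastI[of "\<lambda>r. x s \<le> t (Suc r)", OF ex])
        have "r \<le> N - 1" unfolding r_def by (rule Least_le) (rule ex)
        moreover have "t r \<le> x s"
        proof (cases r)
          case 0 then show ?thesis using xs t0 by simp
        next
          case (Suc q)
          then have "\<not> x s \<le> t (Suc q)"
            unfolding r_def by (intro not_less_Least) simp
          then show ?thesis using Suc by simp
        qed
        ultimately show ?thesis using r1 slab[of r x] x N(2) by (intro exI[of _ r]) auto
      qed
      have sface: "x \<in> faces_off L (?aw r) (?bw (Suc r))"
        if "r < N" "x \<in> {?aw r..?bw (Suc r)}" "x s = t r \<or> x s = t (Suc r)" for r x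
      proof -
        have "s \<notin> L \<and> ?aw r s < ?bw (Suc r) s \<and> (x s = ?aw r s \<or> x s = ?bw (Suc r) s)"
          using insert.hyps that(3) tS[of r] w(1) by auto
        then show ?thesis unfolding faces_off_def using that(2) by blast
      qed
      obtain H where H: "continuous_map (top_of_set {a..b}) (mtopology_of M) H"
        "\<And>x r. \<lbrakk>r \<in> {..<N}; x \<in> topspace (top_of_set {a..b}) \<inter> {?aw r..?bw (Suc r)}\<rbrakk> \<Longrightarrow> H x = hs r x"
      proof (rule pasting_lemma_exists_closed[of "{..<N}" "top_of_set {a..b}" "\<lambda>r. {?aw r..?bw (Suc r)}" "mtopology_of M" hs])
        show "topspace (top_of_set {a..b}) \<subseteq> (\<Union>r<N. {?aw r..?bw (Suc r)})"
          using cover unfolding topspace_euclidean_subtopology by blast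
        show "closedin (top_of_set {a..b}) {?aw r..?bw (Suc r)}" if "r \<in> {..<N}" for r
          using slab[of r] that compact_imp_closed[OF compact_Icc_fun] by (intro closed_subset) auto
        show "continuous_map (subtopology (top_of_set {a..b}) {?aw r..?bw (Suc r)}) (mtopology_of M) (hs r)"
          if "r \<in> {..<N}" for r
        proof -
          have "{a..b} \<inter> {?aw r..?bw (Suc r)} = {?aw r..?bw (Suc r)}" using slab[of r] that by auto
          then show ?thesis using hs(1)[of r] that by (simp add: subtopology_subtopology)
        qed
        \<comment> \<open>Distinct slabs meet at most in a common wall, where both extensions agree
          with \<open>g\<close>.\<close>
        have *: "hs r x = hs q x" if "r < q" "q < N" "x \<in> {?aw r..?bw (Suc r)}" "x \<in> {?aw q..?bw (Suc q)}" for r q x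
        proof -
          have "t q \<le> x s" "x s \<le> t (Suc r)" using that slab[of r x] slab[of q x] by auto
          moreover have "t (Suc r) \<le> t q" using tmono that(1) by simp
          ultimately have "x s = t (Suc r)" "x s = t q" by auto
          then have "hs r x = g x" "hs q x = g x"
            using that by (auto intro!: hs(2) sface)
          then show ?thesis by simp
        qed
        show "hs r x = hs q x" if "r \<in> {..<N}" "q \<in> {..<N}"
          "x \<in> topspace (top_of_set {a..b}) \<inter> {?aw r..?bw (Suc r)} \<inter> {?aw q..?bw (Suc q)}" for r q x
        proof -
          have x: "x \<in> {?aw r..?bw (Suc r)}" "x \<in> {?aw q..?bw (Suc q)}" and rq: "r < N" "q < N"
            using that by blast+
          then show ?thesis
            using *[OF _ _ x] *[OF _ _ x(2,1)] by (metis linorder_cases)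
        qed
      qed auto
      have Hs: "H x = hs r x" if "r < N" "x \<in> {?aw r..?bw (Suc r)}" for r x
        using H(2)[of r x] that slab[of r x] unfolding topspace_euclidean_subtopology by blast
      have "H x = h x" if x: "x \<in> ?F" for x
      proof -
        have xab: "x \<in> {a..b}" using x faces_off_subset by blast
        then obtain r where r: "r < N" "x \<in> {?aw r..?bw (Suc r)}" using cover by blast
        from x obtain i where i: "i \<noteq> s" "i \<notin> L" "a i < b i" "x i = a i \<or> x i = b i"
          by (auto simp: faces_off_def)
        have "i \<notin> L \<and> ?aw r i < ?bw (Suc r) i \<and> (x i = ?aw r i \<or> x i = ?bw (Suc r) i)"
          using i by simp
        then have "x \<in> faces_off L (?aw r) (?bw (Suc r))"
          unfolding faces_off_def using r(2) by blast
        then show ?thesis using Hs[OF r] hs(2)[OF r(1)] gF[OF x] by simp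
      qed
      moreover have "mdist M (\<phi> x) (H x) < \<epsilon>" if "x \<in> {a..b}" for x
        using cover[OF that] Hs hs(3) by force
      ultimately show ?thesis using H(1) by blast
    qed
    then show "\<exists>\<delta>>0. \<exists>\<eta>>0. \<forall>a b h. a\<^sub>0 \<le> a \<longrightarrow> a \<le> b \<longrightarrow> b \<le> b\<^sub>0 \<longrightarrow>
      (\<forall>i. i \<notin> insert s L \<longrightarrow> b i - a i \<le> \<eta>) \<longrightarrow>
      continuous_map (top_of_set (faces_off (insert s L) a b)) (mtopology_of M) h \<longrightarrow>
      (\<forall>x\<in>faces_off (insert s L) a b. mdist M (\<phi> x) (h x) < \<delta>) \<longrightarrow>
      (\<exists>h'. continuous_map (top_of_set {a..b}) (mtopology_of M) h' \<and>
         (\<forall>x\<in>faces_off (insert s L) a b. h' x = h x) \<and> (\<forall>x\<in>{a..b}. mdist M (\<phi> x) (h' x) < \<epsilon>))"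
      using p1 p2 by (intro exI[of _ "min \<delta>1 \<delta>2"] conjI exI[of _ "min \<eta>1 \<eta>2"]) (simp_all add: min_less_iff_conj)
  qed
qed

subsection \<open>Approximation off a graph\<close>

lemma continuous_on_if_const:
  "continuous_on S f \<Longrightarrow> continuous_on S g \<Longrightarrow> continuous_on S (\<lambda>x. if P then f x else g x)"
  by (cases P) simp_all

text \<open>A homotopy is an extension over a box with \<open>m + k + 1\<close> nondegenerate
  coordinates, prescribed only at the two ends of the last one; this is the origin of
  \<open>m + k \<le> d\<close>. All other coordinates are put into \<open>L\<close> and may be long;
  only the time direction has to be short.\<close>

lemma small_homotopy:
  assumes LC: "LC d (mtopology_of M)" and d: "m + k \<le> d" and "\<epsilon> > 0"
    and f\<^sub>0: "continuous_map (top_of_set (unit_cube_set m \<times> unit_cube_set k)) (mtopology_of M) f\<^sub>0"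
  shows "\<exists>\<delta>>0. \<forall>f\<^sub>1.
     continuous_map (top_of_set (unit_cube_set m \<times> unit_cube_set k)) (mtopology_of M) f\<^sub>1 \<longrightarrow>
     (\<forall>p \<in> unit_cube_set m \<times> unit_cube_set k. mdist M (f\<^sub>0 p) (f\<^sub>1 p) < \<delta>) \<longrightarrow>
     (\<exists>H. continuous_map (top_of_set ((unit_cube_set m \<times> unit_cube_set k) \<times> {0..1})) (mtopology_of M) H \<and>
       (\<forall>p \<in> unit_cube_set m \<times> unit_cube_set k. H (p, 0) = f\<^sub>0 p \<and> H (p, 1) = f\<^sub>1 p \<and>
         (\<forall>t\<in>{0..1::real}. mdist M (f\<^sub>0 p) (H (p, t)) < \<epsilon>)))"
proof -
  let ?Q = "unit_cube_set m \<times> unit_cube_set k"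
  define a\<^sub>0 where "a\<^sub>0 = (\<lambda>i::nat. 0::real)"
  define b\<^sub>0 where "b\<^sub>0 = (\<lambda>i. if i \<le> m + k then 1 else 0::real)"
  \<comment> \<open>Drops the time coordinate \<open>m + k\<close> and splits the rest into base and
    fibre, so that \<open>f\<^sub>0\<close> becomes constant in time.\<close>
  define \<pi> where "\<pi> x = ((\<lambda>i. if i < m then x i else 0), (\<lambda>i. if i < k then x (m + i) else 0))"
    for x :: "nat \<Rightarrow> real"
  have I: "{i. a\<^sub>0 i < b\<^sub>0 i} = {..m + k}" by (auto simp: a\<^sub>0_def b\<^sub>0_def)
  have \<pi>Q: "\<pi> x \<in> ?Q" if "x \<in> {a\<^sub>0..b\<^sub>0}" for x
  proof -
    have "0 \<le> x i" for i using that by (auto simp: le_fun_def a\<^sub>0_def)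
    moreover have "x i \<le> 1" for i
    proof -
      have "x i \<le> b\<^sub>0 i" using that by (auto simp: le_fun_def)
      also have "\<dots> \<le> 1" by (simp add: b\<^sub>0_def)
      finally show ?thesis .
    qed
    ultimately show ?thesis by (simp add: \<pi>_def unit_cube_set_iff)
  qed
  have \<pi>c: "continuous_on S \<pi>" for S
  proof -
    have "continuous_on S (\<lambda>x :: nat \<Rightarrow> real. \<lambda>i. if i < m then x i else 0)"
      by (intro continuous_on_coordinatewise_then_product continuous_on_if_const continuous_on_coord
        continuous_on_const)
    moreover have "continuous_on S (\<lambda>x :: nat \<Rightarrow> real. \<lambda>i. if i < k then x (m + i) else 0)"
      by (intro continuous_on_coordinatewise_then_product continuous_on_if_const continuous_on_coord
        continuous_on_const)
    ultimately show ?thesis unfolding \<pi>_def by (rule continuous_on_Pair)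
  qed
  have \<phi>: "continuous_map (top_of_set {a\<^sub>0..b\<^sub>0}) (mtopology_of M) (\<lambda>x. f\<^sub>0 (\<pi> x))"
    using \<pi>Q by (intro continuous_map_compose_on[OF f\<^sub>0 \<pi>c]) blast
  let ?L = "{..<m + k}"
  have "finite {i. a\<^sub>0 i < b\<^sub>0 i}" "card {i. a\<^sub>0 i < b\<^sub>0 i} \<le> Suc d" "finite ?L"
    using d by (auto simp: I)
  from box_extension[OF LC \<phi> this, rule_format, OF \<open>\<epsilon> > 0\<close>]
  obtain \<delta> \<eta> where p: "\<delta> > 0" "\<eta> > 0" and E: "\<And>a b h. a\<^sub>0 \<le> a \<Longrightarrow> a \<le> b \<Longrightarrow> b \<le> b\<^sub>0 \<Longrightarrow>
      \<forall>i. i \<notin> ?L \<longrightarrow> b i - a i \<le> \<eta> \<Longrightarrow>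
      continuous_map (top_of_set (faces_off ?L a b)) (mtopology_of M) h \<Longrightarrow>
      \<forall>x\<in>faces_off ?L a b. mdist M (f\<^sub>0 (\<pi> x)) (h x) < \<delta> \<Longrightarrow>
      \<exists>h'. continuous_map (top_of_set {a..b}) (mtopology_of M) h' \<and>
         (\<forall>x\<in>faces_off ?L a b. h' x = h x) \<and> (\<forall>x\<in>{a..b}. mdist M (f\<^sub>0 (\<pi> x)) (h' x) < \<epsilon>)"
    by blast
  show ?thesis
  proof (intro exI[of _ \<delta>] conjI allI impI, fact p(1))
    fix f\<^sub>1 assume f\<^sub>1: "continuous_map (top_of_set ?Q) (mtopology_of M) f\<^sub>1"
      and "\<forall>p\<in>?Q. mdist M (f\<^sub>0 p) (f\<^sub>1 p) < \<delta>"
    then have cl: "\<And>p. p \<in> ?Q \<Longrightarrow> mdist M (f\<^sub>0 p) (f\<^sub>1 p) < \<delta>" by blast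
    \<comment> \<open>Time is squeezed into an interval of length \<open>e \<le> \<eta>\<close> for
      the box extension; \<open>j\<close> rescales it from the unit interval.\<close>
    define e where "e = min \<eta> 1"
    have e: "0 < e" "e \<le> \<eta>" "e \<le> 1" using p by (auto simp: e_def)
    define b where "b = (\<lambda>i. if i < m + k then 1 else if i = m + k then e else 0)"
    have ab: "a\<^sub>0 \<le> b" "b \<le> b\<^sub>0" using e by (auto simp: le_fun_def a\<^sub>0_def b\<^sub>0_def b_def)
    let ?F = "faces_off ?L a\<^sub>0 b"
    have sub: "{a\<^sub>0..b} \<subseteq> {a\<^sub>0..b\<^sub>0}" using ab(2) by (simp add: atLeastatMost_subset_iff)
    have F: "x \<in> ?F \<longleftrightarrow> x \<in> {a\<^sub>0..b} \<and> (x (m + k) = 0 \<or> x (m + k) = e)" for x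
    proof -
      have "(\<exists>i. i \<notin> ?L \<and> a\<^sub>0 i < b i \<and> (x i = a\<^sub>0 i \<or> x i = b i)) \<longleftrightarrow>
          (x (m + k) = 0 \<or> x (m + k) = e)"
        using e(1) by (auto simp: a\<^sub>0_def b_def split: if_splits)
      then show ?thesis unfolding faces_off_def by blast
    qed
    have FQ: "\<pi> x \<in> ?Q" if "x \<in> ?F" for x using that F sub \<pi>Q by blast
    \<comment> \<open>On \<open>?F\<close> the last coordinate is 0 or \<open>e\<close>; the cut at
      \<open>e / 2\<close> merely falls between the two ends.\<close>
    define h where "h x = (if x (m + k) \<le> e / 2 then f\<^sub>0 (\<pi> x) else f\<^sub>1 (\<pi> x))" for x
    have hc: "continuous_map (top_of_set ?F) (mtopology_of M) (\<lambda>x. f\<^sub>0 (\<pi> x))"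
      "continuous_map (top_of_set ?F) (mtopology_of M) (\<lambda>x. f\<^sub>1 (\<pi> x))"
      using FQ by (intro continuous_map_compose_on[OF f\<^sub>0 \<pi>c] continuous_map_compose_on[OF f\<^sub>1 \<pi>c]; blast)+
    have h: "continuous_map (top_of_set ?F) (mtopology_of M) h"
      unfolding h_def
    proof (rule continuous_map_cases_le)
      show "continuous_map (top_of_set ?F) euclideanreal (\<lambda>x. x (m + k))"
        by (simp add: continuous_on_coord)
      show "f\<^sub>0 (\<pi> x) = f\<^sub>1 (\<pi> x)" if "x \<in> topspace (top_of_set ?F)" "x (m + k) = e / 2" for x
        using that F[of x] e(1) by auto
    qed (use hc in \<open>auto intro: continuous_map_from_subtopology\<close>)
    have "mdist M (f\<^sub>0 (\<pi> x)) (h x) < \<delta>" if "x \<in> ?F" for x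
      using FQ[OF that] cl[of "\<pi> x"] p(1) continuous_map_to_mspace[OF f\<^sub>0, of "\<pi> x"]
      by (auto simp: h_def mdist_refl)
    moreover have "\<forall>i. i \<notin> ?L \<longrightarrow> b i - a\<^sub>0 i \<le> \<eta>" using e p by (auto simp: a\<^sub>0_def b_def)
    ultimately obtain h' where h': "continuous_map (top_of_set {a\<^sub>0..b}) (mtopology_of M) h'"
      "\<forall>x\<in>?F. h' x = h x" "\<forall>x\<in>{a\<^sub>0..b}. mdist M (f\<^sub>0 (\<pi> x)) (h' x) < \<epsilon>"
      using E[of a\<^sub>0 b h] ab h by auto
    define j where "j q = (\<lambda>i. if i < m then fst (fst q) i else if i < m + k then snd (fst q) (i - m)
        else if i = m + k then e * snd q else 0)" for q :: "((nat \<Rightarrow> real) \<times> (nat \<Rightarrow> real)) \<times> real"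
    have jb: "j (p, t) \<in> {a\<^sub>0..b}" if "p \<in> ?Q" "t \<in> {0..1}" for p t
    proof -
      have "0 \<le> j (p, t) i \<and> j (p, t) i \<le> b i" for i
        using that e(1) mult_left_le[of t e]
        by (auto simp: j_def b_def unit_cube_set_iff mem_Times_iff)
      then show ?thesis by (simp add: le_fun_def a\<^sub>0_def)
    qed
    have \<pi>j: "\<pi> (j (p, t)) = p" if "p \<in> ?Q" for p t
      using that by (auto simp: j_def \<pi>_def unit_cube_set_iff mem_Times_iff prod_eq_iff fun_eq_iff)
    have je: "j (p, t) (m + k) = e * t" for p t by (simp add: j_def)
    have jc: "continuous_on (?Q \<times> {0..1}) j"
    proof (rule continuous_on_coordinatewise_then_product)
      show "continuous_on (?Q \<times> {0..1}) (\<lambda>q. j q i)" for i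
      proof -
        consider "i < m" | "\<not> i < m" "i < m + k" | "i = m + k" | "i > m + k" by linarith
        then show ?thesis
          by cases (auto simp: j_def intro!: continuous_on_apply[where f = "\<lambda>q. fst (fst q)"]
              continuous_on_apply[where f = "\<lambda>q. snd (fst q)"] continuous_on_mult
              continuous_on_fst continuous_on_snd continuous_on_id)
      qed
    qed
    have Hc: "continuous_map (top_of_set (?Q \<times> {0..1})) (mtopology_of M) (\<lambda>q. h' (j q))"
    proof (rule continuous_map_compose_on[OF h'(1) jc])
      show "j ` (?Q \<times> {0..1}) \<subseteq> {a\<^sub>0..b}" using jb by blast
    qed
    have "h' (j (p, 0)) = f\<^sub>0 p \<and> h' (j (p, 1)) = f\<^sub>1 p \<and>
         (\<forall>t\<in>{0..1::real}. mdist M (f\<^sub>0 p) (h' (j (p, t))) < \<epsilon>)" if p: "p \<in> ?Q" for p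
    proof -
      have "j (p, 0) \<in> ?F" "j (p, 1) \<in> ?F" using jb[OF p, of 0] jb[OF p, of 1] F je by auto
      then have "h' (j (p, 0)) = h (j (p, 0))" "h' (j (p, 1)) = h (j (p, 1))" using h'(2) by blast+
      moreover have "mdist M (f\<^sub>0 p) (h' (j (p, t))) < \<epsilon>" if "t \<in> {0..1}" for t
        using h'(3) jb[OF p that] \<pi>j[OF p, of t] by metis
      ultimately show ?thesis using e(1) by (simp add: h_def \<pi>j[OF p] je)
    qed
    then show "\<exists>H. continuous_map (top_of_set (?Q \<times> {0..1})) (mtopology_of M) H \<and>
       (\<forall>p \<in> ?Q. H (p, 0) = f\<^sub>0 p \<and> H (p, 1) = f\<^sub>1 p \<and> (\<forall>t\<in>{0..1::real}. mdist M (f\<^sub>0 p) (H (p, t)) < \<epsilon>))"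
      using Hc by (intro exI[of _ "\<lambda>q. h' (j q)"]) blast
  qed
qed

definition truncate_fun :: "nat \<Rightarrow> (nat \<Rightarrow> real) \<Rightarrow> nat \<Rightarrow> real" where
  "truncate_fun k x = (\<lambda>i. if i < k then x i else 0)"

text \<open>The graph of \<open>\<alpha>\<close> over the base and the first \<open>k\<close> fibre
  coordinates, cut down to the cube. The values of \<open>\<alpha>\<close> are not confined to the
  unit interval, so there may be nothing above some points.\<close>

definition graph_set :: "nat \<Rightarrow> nat \<Rightarrow> nat \<Rightarrow> ((nat \<Rightarrow> real) \<times> (nat \<Rightarrow> real) \<Rightarrow> nat \<Rightarrow> real) \<Rightarrow>
    ((nat \<Rightarrow> real) \<times> (nat \<Rightarrow> real)) set" where
  "graph_set m n k \<alpha> = {(z, x) \<in> unit_cube_set m \<times> unit_cube_set n.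
     \<forall>i. k \<le> i \<and> i < n \<longrightarrow> x i = \<alpha> (z, truncate_fun k x) i}"

lemma continuous_on_truncate: "continuous_on S (truncate_fun k)"
  unfolding truncate_fun_def
  by (intro continuous_on_coordinatewise_then_product continuous_on_if_const continuous_on_coord
        continuous_on_const)

lemma truncate_unit_cube: "x \<in> unit_cube_set n \<Longrightarrow> k \<le> n \<Longrightarrow> truncate_fun k x \<in> unit_cube_set k"
  by (auto simp: truncate_fun_def unit_cube_set_iff)

text \<open>\<open>DD\<close> is applied to \<open>f\<close> and to \<open>gA\<close>, which is
  \<open>g\<close> along the graph, viewed as a map on the product of the \<open>m\<close>-cube and
  the \<open>k\<close>-cube. The resulting \<open>gB\<close> is grafted onto \<open>g\<close> by a
  small homotopy. On the graph \<open>g'\<close> then takes values of \<open>gB\<close> in the same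
  fibre, and \<open>f'\<close> misses these.\<close>

lemma approximate_off_graph:
  assumes LC: "LC d (mtopology_of M)" and d: "m + k \<le> d" and "k \<le> n"
    and DD: "DD_property_metric m n k M" and "\<epsilon> > 0"
    and \<alpha>: "continuous_on (unit_cube_set m \<times> unit_cube_set k) \<alpha>"
    and f: "continuous_map (top_of_set (unit_cube_set m \<times> unit_cube_set n)) (mtopology_of M) f"
    and g: "continuous_map (top_of_set (unit_cube_set m \<times> unit_cube_set n)) (mtopology_of M) g"
  obtains f' g'
  where "continuous_map (top_of_set (unit_cube_set m \<times> unit_cube_set n)) (mtopology_of M) f'"
    "continuous_map (top_of_set (unit_cube_set m \<times> unit_cube_set n)) (mtopology_of M) g'"
    "\<And>p. p \<in> unit_cube_set m \<times> unit_cube_set n \<Longrightarrow> mdist M (f p) (f' p) < \<epsilon>"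
    "\<And>p. p \<in> unit_cube_set m \<times> unit_cube_set n \<Longrightarrow> mdist M (g p) (g' p) < \<epsilon>"
    "\<And>z x y. x \<in> unit_cube_set n \<Longrightarrow> (z, y) \<in> graph_set m n k \<alpha> \<Longrightarrow> f' (z, x) \<noteq> g' (z, y)"
proof -
  let ?W = "unit_cube_set m \<times> unit_cube_set n" and ?Q = "unit_cube_set m \<times> unit_cube_set k"
  \<comment> \<open>\<open>\<alpha>\<close> may leave the cube, so \<open>e\<close> clamps the
    result: it is the cube point above \<open>(z, y)\<close> displaced by \<open>r\<close> from the
    graph.\<close>
  define clamp where "clamp t = max 0 (min 1 t)" for t :: real
  define e where "e z y r = (\<lambda>i. if i < k then y i else if i < n then clamp (\<alpha> (z, y) i + r i) else 0)"
    for z y r :: "nat \<Rightarrow> real"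
  have eW: "e z y r \<in> unit_cube_set n" if "y \<in> unit_cube_set k" for z y r
    using that \<open>k \<le> n\<close> by (auto simp: e_def unit_cube_set_iff clamp_def)
  have ec: "continuous_on S (\<lambda>q. e (Z q) (Y q) (R q))"
    if "continuous_on S Z" "continuous_on S Y" "continuous_on S R"
      "\<And>q. q \<in> S \<Longrightarrow> (Z q, Y q) \<in> ?Q" for S :: "((nat \<Rightarrow> real) \<times> (nat \<Rightarrow> real)) set" and Z Y R
  proof (rule continuous_on_coordinatewise_then_product)
    have "continuous_on S (\<lambda>q. \<alpha> (Z q, Y q))"
      using that by (intro continuous_on_compose2[OF \<alpha>] continuous_on_Pair) auto
    then show "continuous_on S (\<lambda>q. e (Z q) (Y q) (R q) i)" for i
      using that(2,3) unfolding e_def clamp_def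
      by (cases "i < k"; cases "i < n")
        (auto intro!: continuous_on_max continuous_on_min continuous_on_add intro: continuous_on_apply)
  qed
  define gA where "gA p = g (fst p, e (fst p) (snd p) (\<lambda>_. 0))" for p
  have gA: "continuous_map (top_of_set ?Q) (mtopology_of M) gA"
    unfolding gA_def
  proof (rule continuous_map_compose_on[OF g])
    show "continuous_on ?Q (\<lambda>p. (fst p, e (fst p) (snd p) (\<lambda>_. 0)))"
      by (intro continuous_on_Pair ec continuous_on_fst continuous_on_snd continuous_on_id continuous_on_const) auto
  qed (use eW in auto)
  define G where "G q = (\<Sum>i<m. \<bar>fst (fst q) i - fst (snd q) i\<bar>) + (\<Sum>i<n. \<bar>snd (fst q) i - snd (snd q) i\<bar>)"
    for q :: "((nat \<Rightarrow> real) \<times> (nat \<Rightarrow> real)) \<times> ((nat \<Rightarrow> real) \<times> (nat \<Rightarrow> real))"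
  have "continuous_on (?W \<times> ?W) G"
    unfolding G_def
    by (intro continuous_on_add continuous_on_sum continuous_on_rabs continuous_on_diff continuous_on_apply
        continuous_on_fst continuous_on_snd continuous_on_id)
  moreover have "0 < G (p, q)" if "p \<in> ?W" "q \<in> ?W" "p \<noteq> q" for p q
  proof -
    have "G (p, q) \<ge> 0" unfolding G_def by (intro add_nonneg_nonneg sum_nonneg) auto
    moreover have "G (p, q) \<noteq> 0"
    proof
      assume "G (p, q) = 0"
      moreover have "0 \<le> (\<Sum>i<m. \<bar>fst p i - fst q i\<bar>)" "0 \<le> (\<Sum>i<n. \<bar>snd p i - snd q i\<bar>)"
        by (simp_all add: sum_nonneg)
      ultimately have "(\<Sum>i<m. \<bar>fst p i - fst q i\<bar>) = 0" "(\<Sum>i<n. \<bar>snd p i - snd q i\<bar>) = 0"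
        unfolding G_def fst_conv snd_conv by linarith+
      then have "\<forall>i<m. fst p i = fst q i" "\<forall>i<n. snd p i = snd q i"
        by (auto simp: sum_nonneg_eq_0_iff)
      moreover have "\<forall>i\<ge>m. fst p i = fst q i" "\<forall>i\<ge>n. snd p i = snd q i"
        using that by (auto simp: unit_cube_set_iff)
      ultimately have "fst p = fst q" "snd p = snd q" by (metis ext not_less)+
      then show False using \<open>p \<noteq> q\<close> by (simp add: prod_eq_iff)
    qed
    ultimately show ?thesis by simp
  qed
  moreover have "\<epsilon>/2 > 0" using \<open>\<epsilon> > 0\<close> by simp
  moreover have "compact ?W" by (simp add: compact_Times compact_unit_cube_set)
  ultimately obtain \<eta> where "\<eta> > 0" and
    \<eta>: "\<And>p q. p \<in> ?W \<Longrightarrow> q \<in> ?W \<Longrightarrow> G (p, q) < \<eta> \<Longrightarrow> mdist M (g p) (g q) < \<epsilon>/2"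
    using uniformly_close[OF _ g] by metis
  \<comment> \<open>Displacing each of the \<open>n\<close> fibre coordinates by at most
    \<open>\<kappa>\<close> costs less than \<open>\<eta>\<close> in \<open>G\<close>.\<close>
  define \<kappa> where "\<kappa> = \<eta> / (n + 1)"
  have \<kappa>: "\<kappa> > 0" "n * \<kappa> < \<eta>" using \<open>\<eta> > 0\<close> by (auto simp: \<kappa>_def field_simps)
  have near: "mdist M (g (z, x)) (g (z, x')) < \<epsilon>/2"
    if "z \<in> unit_cube_set m" "x \<in> unit_cube_set n" "x' \<in> unit_cube_set n" "\<And>i. i < n \<Longrightarrow> \<bar>x i - x' i\<bar> \<le> \<kappa>" for z x x'
  proof (rule \<eta>)
    have "G ((z, x), (z, x')) \<le> real (card {..<n}) * \<kappa>"
      unfolding G_def using that(4) by simp (rule sum_bounded_above[of "{..<n}", simplified], auto)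
    then show "G ((z, x), (z, x')) < \<eta>" using \<kappa>(2) by simp
  qed (use that in auto)
  from small_homotopy[OF LC d \<open>\<epsilon>/2 > 0\<close> gA] obtain \<delta> where "\<delta> > 0" and \<delta>:
    "\<forall>f\<^sub>1. continuous_map (top_of_set ?Q) (mtopology_of M) f\<^sub>1 \<longrightarrow>
       (\<forall>p\<in>?Q. mdist M (gA p) (f\<^sub>1 p) < \<delta>) \<longrightarrow>
     (\<exists>H. continuous_map (top_of_set (?Q \<times> {0..1})) (mtopology_of M) H \<and>
       (\<forall>p \<in> ?Q. H (p, 0) = gA p \<and> H (p, 1) = f\<^sub>1 p \<and> (\<forall>t\<in>{0..1::real}. mdist M (gA p) (H (p, t)) < \<epsilon>/2)))"
    by blast
  have "min \<delta> \<epsilon> > 0" using \<open>\<delta> > 0\<close> \<open>\<epsilon> > 0\<close> by simp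
  from DD[unfolded DD_property_metric_def prod_unit_cube_eq_top_of_set, rule_format,
      OF conjI[OF f gA] this]
  obtain f' gB where f': "continuous_map (top_of_set ?W) (mtopology_of M) f'"
    and gB: "continuous_map (top_of_set ?Q) (mtopology_of M) gB"
    and f'cl: "\<forall>p\<in>?W. mdist M (f p) (f' p) < min \<delta> \<epsilon>"
    and gBcl: "\<forall>p\<in>?Q. mdist M (gA p) (gB p) < min \<delta> \<epsilon>"
    and disj: "\<forall>z\<in>unit_cube_set m. f' ` ({z} \<times> unit_cube_set n) \<inter> gB ` ({z} \<times> unit_cube_set k) = {}"
    by blast
  obtain H where H: "continuous_map (top_of_set (?Q \<times> {0..1})) (mtopology_of M) H"
    and H0: "\<And>p. p \<in> ?Q \<Longrightarrow> H (p, 0) = gA p" and H1: "\<And>p. p \<in> ?Q \<Longrightarrow> H (p, 1) = gB p"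
    and Hcl: "\<And>p t. p \<in> ?Q \<Longrightarrow> t \<in> {0..1::real} \<Longrightarrow> mdist M (gA p) (H (p, t)) < \<epsilon>/2"
    using \<delta>[rule_format, OF gB] gBcl unfolding min_less_iff_conj by blast
  define b where "b p = (fst p, truncate_fun k (snd p))" for p :: "(nat \<Rightarrow> real) \<times> (nat \<Rightarrow> real)"
  define r where "r p i = snd p i - \<alpha> (b p) i" for p i
  define \<rho> where "\<rho> p = (\<Sum>i\<in>{k..<n}. \<bar>r p i\<bar>)" for p
  \<comment> \<open>Subtracting from \<open>t\<close> its projection to
    \<open>{- \<kappa>..\<kappa>}\<close> moves every residual towards 0 by at most
    \<open>\<kappa>\<close> and annihilates those of size up to \<open>\<kappa>\<close>.\<close>
  define S where "S t = t - max (- \<kappa>) (min \<kappa> t)" for t :: real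
  define sh where "sh p = (fst p, e (fst p) (snd (b p)) (\<lambda>i. S (r p i)))" for p
  have bQ: "b p \<in> ?Q" if "p \<in> ?W" for p
    using that truncate_unit_cube[OF _ \<open>k \<le> n\<close>] by (auto simp: b_def)
  have bc: "continuous_on T b" for T
    unfolding b_def
    by (intro continuous_on_Pair continuous_on_fst continuous_on_id
        continuous_on_compose2[OF continuous_on_truncate[of UNIV] continuous_on_snd]) auto
  have rc: "continuous_on ?W (\<lambda>p. r p i)" for i
    unfolding r_def
    by (intro continuous_on_diff continuous_on_apply continuous_on_snd continuous_on_id
        continuous_on_compose2[OF \<alpha> bc]) (use bQ in blast)
  have \<rho>c: "continuous_on ?W \<rho>"
    unfolding \<rho>_def by (intro continuous_on_sum continuous_on_rabs rc)
  have \<rho>0: "\<rho> p \<ge> 0" for p unfolding \<rho>_def by (rule sum_nonneg) simp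
  have r\<rho>: "\<bar>r p i\<bar> \<le> \<rho> p" if "k \<le> i" "i < n" for p i
    unfolding \<rho>_def using member_le_sum[of i "{k..<n}" "\<lambda>i. \<bar>r p i\<bar>"] that by auto
  have shW: "sh p \<in> ?W" if "p \<in> ?W" for p
    using eW[of "snd (b p)"] bQ[OF that] that by (auto simp: sh_def)
  have shc: "continuous_on ?W sh"
    unfolding sh_def
  proof (intro continuous_on_Pair ec)
    show "continuous_on ?W (\<lambda>p. \<lambda>i. S (r p i))"
      unfolding S_def
      by (rule continuous_on_coordinatewise_then_product)
        (intro continuous_on_diff continuous_on_max continuous_on_min continuous_on_const rc)
    show "continuous_on ?W (\<lambda>p. snd (b p))" by (intro continuous_on_snd bc)
    show "(fst p, snd (b p)) \<in> ?Q" if "p \<in> ?W" for p using bQ[OF that] by (simp add: b_def)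
  qed (auto intro: continuous_on_fst continuous_on_id)
  \<comment> \<open>Outside the \<open>\<kappa>\<close>-neighbourhood of the graph, \<open>g\<close> is precomposed with a push by \<open>\<kappa>\<close> towards the
    graph. This frees the neighbourhood for the homotopy from \<open>gA\<close> to \<open>gB\<close>.\<close>
  define g' where "g' p = (if \<rho> p \<le> \<kappa> then H (b p, max 0 (1 - \<rho> p / \<kappa>)) else g (sh p))" for p
  have t01: "max 0 (1 - \<rho> p / \<kappa>) \<in> {0..1}" for p
    using \<rho>0[of p] \<kappa>(1) by auto
  have "continuous_map (top_of_set ?W) (mtopology_of M) g'"
    unfolding g'_def
  proof (rule continuous_map_cases_le)
    show "continuous_map (top_of_set ?W) euclideanreal \<rho>" using \<rho>c by simp
    have "continuous_map (top_of_set ?W) (mtopology_of M) (\<lambda>p. H (b p, max 0 (1 - \<rho> p / \<kappa>)))"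
    proof (rule continuous_map_compose_on[OF H])
      show "continuous_on ?W (\<lambda>p. (b p, max 0 (1 - \<rho> p / \<kappa>)))"
        using \<kappa>(1) by (intro continuous_on_Pair bc continuous_on_max continuous_on_diff continuous_on_divide
            continuous_on_const \<rho>c) auto
      show "(\<lambda>p. (b p, max 0 (1 - \<rho> p / \<kappa>))) ` ?W \<subseteq> ?Q \<times> {0..1}"
        using bQ t01 by blast
    qed
    then show "continuous_map (subtopology (top_of_set ?W) {p \<in> topspace (top_of_set ?W). \<rho> p \<le> \<kappa>})
        (mtopology_of M) (\<lambda>p. H (b p, max 0 (1 - \<rho> p / \<kappa>)))"
      by (rule continuous_map_from_subtopology)
    have "continuous_map (top_of_set ?W) (mtopology_of M) (\<lambda>p. g (sh p))"
      using shW by (intro continuous_map_compose_on[OF g shc]) blast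
    then show "continuous_map (subtopology (top_of_set ?W) {p \<in> topspace (top_of_set ?W). \<kappa> \<le> \<rho> p})
        (mtopology_of M) (\<lambda>p. g (sh p))"
      by (rule continuous_map_from_subtopology)
    show "H (b p, max 0 (1 - \<rho> p / \<kappa>)) = g (sh p)"
      if "p \<in> topspace (top_of_set ?W)" "\<rho> p = \<kappa>" for p
    proof -
      \<comment> \<open>At \<open>\<rho> p = \<kappa>\<close> every residual is at most
        \<open>\<kappa>\<close>, so the push ends on the clamped graph, while the homotopy is at
        time 0: both branches equal \<open>gA (b p)\<close>.\<close>
      have "S (r p i) = 0" if "k \<le> i" "i < n" for i
        using r\<rho>[OF that, of p] \<open>\<rho> p = \<kappa>\<close> by (auto simp: S_def)
      then have "sh p = (fst (b p), e (fst (b p)) (snd (b p)) (\<lambda>_. 0))"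
        by (auto simp: sh_def e_def b_def fun_eq_iff)
      then show ?thesis using H0[OF bQ] that \<kappa>(1) by (simp add: gA_def)
    qed
  qed auto
  moreover have "mdist M (g p) (g' p) < \<epsilon>" if p: "p \<in> ?W" for p
  proof (cases "\<rho> p \<le> \<kappa>")
    case True
    let ?x = "e (fst p) (snd (b p)) (\<lambda>_. 0)"
    have xW: "?x \<in> unit_cube_set n" using eW bQ[OF p] by auto
    \<comment> \<open>Clamping does not increase the distance to \<open>snd p i\<close>, which
      already lies in the unit interval.\<close>
    have "\<bar>snd p i - ?x i\<bar> \<le> \<kappa>" if "i < n" for i
    proof (cases "i < k")
      case True then show ?thesis using \<kappa>(1) by (simp add: e_def b_def truncate_fun_def)
    next
      case False
      have "\<bar>r p i\<bar> \<le> \<kappa>" using r\<rho>[of i p] False that \<open>\<rho> p \<le> \<kappa>\<close> by auto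
      moreover have "0 \<le> snd p i" "snd p i \<le> 1" using p that by (auto simp: unit_cube_set_iff)
      ultimately show ?thesis using False that by (auto simp: e_def r_def b_def clamp_def)
    qed
    then have "mdist M (g (fst p, snd p)) (g (fst p, ?x)) < \<epsilon>/2"
      using p xW by (intro near) auto
    moreover have "g (fst p, ?x) = gA (b p)" by (simp add: gA_def b_def)
    ultimately have "mdist M (g p) (gA (b p)) < \<epsilon>/2" by simp
    moreover have "mdist M (gA (b p)) (g' p) < \<epsilon>/2"
      using Hcl[OF bQ[OF p] t01] True by (simp add: g'_def)
    moreover have "g' p \<in> mspace M"
      using True continuous_map_to_mspace[OF H, of "(b p, max 0 (1 - \<rho> p / \<kappa>))"] bQ[OF p] t01[of p]
      by (simp add: g'_def)
    ultimately show ?thesis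
      using mdist_triangle[of "g p" M "gA (b p)" "g' p"] continuous_map_to_mspace[OF g p]
        continuous_map_to_mspace[OF gA bQ[OF p]] by linarith
  next
    case False
    have "\<bar>snd p i - snd (sh p) i\<bar> \<le> \<kappa>" if "i < n" for i
    proof (cases "i < k")
      case True then show ?thesis using \<kappa>(1) by (simp add: sh_def e_def b_def truncate_fun_def)
    next
      case False
      have "0 \<le> snd p i" "snd p i \<le> 1" using p that by (auto simp: unit_cube_set_iff)
      moreover have "\<alpha> (b p) i + S (r p i) = snd p i - max (- \<kappa>) (min \<kappa> (r p i))"
        by (simp add: S_def r_def)
      moreover have "(fst p, snd (b p)) = b p" by (simp add: b_def)
      ultimately show ?thesis using False that \<kappa>(1) by (simp add: sh_def e_def clamp_def)
    qed
    then have "mdist M (g (fst p, snd p)) (g (fst p, snd (sh p))) < \<epsilon>/2"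
      using p shW[OF p] by (intro near) auto
    moreover have "(fst p, snd (sh p)) = sh p" by (simp add: sh_def)
    ultimately show ?thesis using False \<open>\<epsilon> > 0\<close> by (simp add: g'_def)
  qed
  moreover have "f' (z, x) \<noteq> g' (z, y)" if "x \<in> unit_cube_set n" "(z, y) \<in> graph_set m n k \<alpha>" for z x y
  proof -
    have zy: "(z, y) \<in> ?W" and gr: "\<And>i. k \<le> i \<Longrightarrow> i < n \<Longrightarrow> y i = \<alpha> (z, truncate_fun k y) i"
      using that(2) by (auto simp: graph_set_def)
    \<comment> \<open>On the graph the residuals vanish and the homotopy is at time 1, where it is
      \<open>gB\<close>.\<close>
    have "\<rho> (z, y) = 0" unfolding \<rho>_def r_def b_def using gr by simp
    then have "g' (z, y) = gB (z, truncate_fun k y)"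
      using \<kappa>(1) H1[OF bQ[OF zy]] by (simp add: g'_def b_def)
    then show ?thesis
      using disj zy that(1) bQ[OF zy] by (force simp: b_def)
  qed
  ultimately show thesis using that f' f'cl by (metis min_less_iff_conj)
qed

section \<open>Perturbations that avoid prescribed coincidences\<close>

definition generic_avoidance ::
    "'a metric \<Rightarrow> 'b::topological_space set \<Rightarrow> ('b \<times> 'b) set \<Rightarrow> bool" where
  "generic_avoidance M W C \<longleftrightarrow>
     (\<forall>f g \<epsilon>. continuous_map (top_of_set W) (mtopology_of M) f \<longrightarrow>
        continuous_map (top_of_set W) (mtopology_of M) g \<longrightarrow> 0 < \<epsilon> \<longrightarrow>
        (\<exists>f' g'. continuous_map (top_of_set W) (mtopology_of M) f' \<and>
           continuous_map (top_of_set W) (mtopology_of M) g' \<and>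
           (\<forall>p\<in>W. mdist M (f p) (f' p) < \<epsilon>) \<and> (\<forall>p\<in>W. mdist M (g p) (g' p) < \<epsilon>) \<and>
           (\<forall>(p, q)\<in>C. f' p \<noteq> g' q)))"

lemma generic_avoidance_empty: "generic_avoidance M W {}"
  unfolding generic_avoidance_def
proof (intro allI impI)
  fix f g and \<epsilon> :: real
  assume "continuous_map (top_of_set W) (mtopology_of M) f"
    "continuous_map (top_of_set W) (mtopology_of M) g" "0 < \<epsilon>"
  then show "\<exists>f' g'. continuous_map (top_of_set W) (mtopology_of M) f' \<and>
           continuous_map (top_of_set W) (mtopology_of M) g' \<and>
           (\<forall>p\<in>W. mdist M (f p) (f' p) < \<epsilon>) \<and> (\<forall>p\<in>W. mdist M (g p) (g' p) < \<epsilon>) \<and>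
           (\<forall>(p, q)\<in>{}. f' p \<noteq> g' q)"
    by (intro exI[of _ f] exI[of _ g]) (auto simp: mdist_refl continuous_map_to_mspace)
qed

text \<open>\<open>DD\<close> with unequal dimensions treats \<open>f\<close> and \<open>g\<close>
  differently; exchanging them allows a graph to be cleared on either side.\<close>

lemma generic_avoidance_converse:
  assumes "generic_avoidance M W C"
  shows "generic_avoidance M W (C\<inverse>)"
  unfolding generic_avoidance_def
proof (intro allI impI)
  fix f g and \<epsilon> :: real
  assume "continuous_map (top_of_set W) (mtopology_of M) f"
    "continuous_map (top_of_set W) (mtopology_of M) g" "0 < \<epsilon>"
  from assms[unfolded generic_avoidance_def, rule_format, OF this(2,1,3)]
  obtain g' f' where "continuous_map (top_of_set W) (mtopology_of M) f'"
    "continuous_map (top_of_set W) (mtopology_of M) g'"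
    "\<forall>p\<in>W. mdist M (f p) (f' p) < \<epsilon>" "\<forall>p\<in>W. mdist M (g p) (g' p) < \<epsilon>"
    "\<forall>(p, q)\<in>C. g' p \<noteq> f' q"
    by blast
  moreover from this(5) have "\<forall>(p, q)\<in>C\<inverse>. f' p \<noteq> g' q" by fastforce
  ultimately show "\<exists>f' g'. continuous_map (top_of_set W) (mtopology_of M) f' \<and>
           continuous_map (top_of_set W) (mtopology_of M) g' \<and>
           (\<forall>p\<in>W. mdist M (f p) (f' p) < \<epsilon>) \<and> (\<forall>p\<in>W. mdist M (g p) (g' p) < \<epsilon>) \<and>
           (\<forall>(p, q)\<in>C\<inverse>. f' p \<noteq> g' q)"
    by blast
qed

text \<open>The distance between \<open>f1 p\<close> and \<open>g1 q\<close> has a positive lower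
  bound \<open>\<delta>\<close> on the compact set \<open>C\<^sub>1\<close>. A second perturbation,
  made for \<open>C\<^sub>2\<close> and moving each map by less than \<open>\<delta>/2\<close>,
  cannot create a coincidence there.\<close>

lemma generic_avoidance_Un:
  fixes W :: "'b::t2_space set"
  assumes C1: "generic_avoidance M W C\<^sub>1" "compact C\<^sub>1" "C\<^sub>1 \<subseteq> W \<times> W"
    and C2: "generic_avoidance M W C\<^sub>2"
  shows "generic_avoidance M W (C\<^sub>1 \<union> C\<^sub>2)"
  unfolding generic_avoidance_def
proof (intro allI impI)
  fix f g and \<epsilon> :: real
  assume fg: "continuous_map (top_of_set W) (mtopology_of M) f"
    "continuous_map (top_of_set W) (mtopology_of M) g" and "0 < \<epsilon>"
  then have "\<epsilon>/2 > 0" by simp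
  from C1(1)[unfolded generic_avoidance_def, rule_format, OF fg this]
  obtain f1 g1 where f1: "continuous_map (top_of_set W) (mtopology_of M) f1"
    and g1: "continuous_map (top_of_set W) (mtopology_of M) g1"
    and cl1: "\<forall>p\<in>W. mdist M (f p) (f1 p) < \<epsilon>/2" "\<forall>p\<in>W. mdist M (g p) (g1 p) < \<epsilon>/2"
    and av1: "\<forall>(p, q)\<in>C\<^sub>1. f1 p \<noteq> g1 q"
    by blast
  let ?d = "\<lambda>c. mdist M (f1 (fst c)) (g1 (snd c))"
  have "continuous_map (top_of_set C\<^sub>1) (mtopology_of M) (\<lambda>c. f1 (fst c))"
    "continuous_map (top_of_set C\<^sub>1) (mtopology_of M) (\<lambda>c. g1 (snd c))"
    using C1(3) by (auto intro!: continuous_map_compose_on[OF f1] continuous_map_compose_on[OF g1]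
        continuous_on_fst continuous_on_snd continuous_on_id)
  then have dc: "continuous_on C\<^sub>1 ?d"
    using continuous_map_mdist[of "top_of_set C\<^sub>1" M] by simp
  have "\<exists>\<delta>>0. \<forall>c\<in>C\<^sub>1. \<delta> \<le> ?d c"
  proof (cases "C\<^sub>1 = {}")
    case False
    then obtain c where c: "c \<in> C\<^sub>1" "\<forall>e\<in>C\<^sub>1. ?d c \<le> ?d e"
      using continuous_attains_inf[OF C1(2) False dc] by blast
    have "f1 (fst c) \<in> mspace M" "g1 (snd c) \<in> mspace M"
      using c(1) C1(3) continuous_map_to_mspace[OF f1] continuous_map_to_mspace[OF g1] by auto
    moreover have "f1 (fst c) \<noteq> g1 (snd c)" using av1 c(1) by fastforce
    ultimately have "?d c > 0" by (simp add: less_le)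
    then show ?thesis using c(2) by blast
  qed (auto intro: exI[of _ 1])
  then obtain \<delta> where \<delta>: "\<delta> > 0" "\<forall>c\<in>C\<^sub>1. \<delta> \<le> ?d c" by blast
  then have "min (\<epsilon>/2) (\<delta>/2) > 0" using \<open>\<epsilon> > 0\<close> by simp
  from C2(1)[unfolded generic_avoidance_def, rule_format, OF f1 g1 this]
  obtain f2 g2 where f2: "continuous_map (top_of_set W) (mtopology_of M) f2"
    and g2: "continuous_map (top_of_set W) (mtopology_of M) g2"
    and cl2: "\<forall>p\<in>W. mdist M (f1 p) (f2 p) < min (\<epsilon>/2) (\<delta>/2)" "\<forall>p\<in>W. mdist M (g1 p) (g2 p) < min (\<epsilon>/2) (\<delta>/2)"
    and av2: "\<forall>(p, q)\<in>C\<^sub>2. f2 p \<noteq> g2 q"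
    by blast
  have mem: "f p \<in> mspace M" "g p \<in> mspace M" "f1 p \<in> mspace M" "g1 p \<in> mspace M" "f2 p \<in> mspace M" "g2 p \<in> mspace M"
    if "p \<in> W" for p
    using that fg f1 g1 f2 g2 by (auto intro: continuous_map_to_mspace)
  have "mdist M (f p) (f2 p) < \<epsilon>" "mdist M (g p) (g2 p) < \<epsilon>" if "p \<in> W" for p
  proof -
    have "mdist M (f p) (f1 p) < \<epsilon>/2" "mdist M (g p) (g1 p) < \<epsilon>/2"
      "mdist M (f1 p) (f2 p) < \<epsilon>/2" "mdist M (g1 p) (g2 p) < \<epsilon>/2"
      using that cl1 cl2 by auto
    then show "mdist M (f p) (f2 p) < \<epsilon>" "mdist M (g p) (g2 p) < \<epsilon>"
      using mdist_triangle[of "f p" M "f1 p" "f2 p"] mdist_triangle[of "g p" M "g1 p" "g2 p"] mem[OF that]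
      by linarith+
  qed
  moreover have "f2 p \<noteq> g2 q" if "(p, q) \<in> C\<^sub>1" for p q
  proof
    assume eq: "f2 p = g2 q"
    have pq: "p \<in> W" "q \<in> W" using that C1(3) by auto
    have "\<delta> \<le> mdist M (f1 p) (g1 q)" using \<delta>(2) that by fastforce
    also have "\<dots> \<le> mdist M (f1 p) (f2 p) + mdist M (g1 q) (g2 q)"
      using mdist_triangle[of "f1 p" M "f2 p" "g1 q"] mem[OF pq(1)] mem[OF pq(2)] eq
        mdist_commute[of M "g2 q" "g1 q"] by simp
    also have "\<dots> < \<delta>" using cl2 pq by (metis add_strict_mono field_sum_of_halves min_less_iff_conj)
    finally show False by simp
  qed
  ultimately show "\<exists>f' g'. continuous_map (top_of_set W) (mtopology_of M) f' \<and>
           continuous_map (top_of_set W) (mtopology_of M) g' \<and>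
           (\<forall>p\<in>W. mdist M (f p) (f' p) < \<epsilon>) \<and> (\<forall>p\<in>W. mdist M (g p) (g' p) < \<epsilon>) \<and>
           (\<forall>(p, q)\<in>C\<^sub>1 \<union> C\<^sub>2. f' p \<noteq> g' q)"
    using f2 g2 av2 by (intro exI[of _ f2] exI[of _ g2]) auto
qed

lemma generic_avoidance_Union:
  fixes W :: "'b::t2_space set"
  assumes "finite \<C>" "\<And>C. C \<in> \<C> \<Longrightarrow> generic_avoidance M W C \<and> compact C \<and> C \<subseteq> W \<times> W"
  shows "generic_avoidance M W (\<Union>\<C>)"
  using assms
proof (induction \<C> rule: finite_induct)
  case empty then show ?case by (simp add: generic_avoidance_empty)
next
  case (insert C \<C>)
  then show ?case using generic_avoidance_Un[of M W C "\<Union>\<C>"] by simp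
qed

text \<open>Only the second point is confined to \<open>A\<close>; the first ranges over the whole
  fibre, as the \<open>n\<close>-dimensional side of \<open>DD\<close> provides.\<close>

definition same_fibre :: "nat \<Rightarrow> ((nat \<Rightarrow> real) \<times> (nat \<Rightarrow> real)) set \<Rightarrow>
    (((nat \<Rightarrow> real) \<times> (nat \<Rightarrow> real)) \<times> ((nat \<Rightarrow> real) \<times> (nat \<Rightarrow> real))) set" where
  "same_fibre n A = {(p, q). fst p = fst q \<and> snd p \<in> unit_cube_set n \<and> q \<in> A}"

lemma compact_same_fibre:
  assumes "compact A"
  shows "compact (same_fibre n A)"
proof -
  have "same_fibre n A = (\<lambda>(x, q). ((fst q, x), q)) ` (unit_cube_set n \<times> A)"
    by (force simp: same_fibre_def)
  moreover have "continuous_on (unit_cube_set n \<times> A) (\<lambda>(x, q). ((fst q, x), q))"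
    unfolding case_prod_unfold
    by (intro continuous_on_Pair continuous_on_fst continuous_on_snd continuous_on_id)
  ultimately show ?thesis
    using assms by (auto intro!: compact_continuous_image compact_Times compact_unit_cube_set)
qed

lemma compact_graph_set:
  assumes \<alpha>: "continuous_on (unit_cube_set m \<times> unit_cube_set k) \<alpha>" and "k \<le> n"
  shows "compact (graph_set m n k \<alpha>)"
proof -
  let ?W = "unit_cube_set m \<times> unit_cube_set n"
  have W: "compact ?W" by (simp add: compact_Times compact_unit_cube_set)
  have "continuous_on ?W (\<lambda>p. \<alpha> (fst p, truncate_fun k (snd p)))"
  proof (rule continuous_on_compose2[OF \<alpha>])
    show "continuous_on ?W (\<lambda>p. (fst p, truncate_fun k (snd p)))"
      by (intro continuous_on_Pair continuous_on_fst continuous_on_id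
          continuous_on_compose2[OF continuous_on_truncate[of UNIV] continuous_on_snd]) auto
  qed (use truncate_unit_cube[OF _ \<open>k \<le> n\<close>] in auto)
  then have "continuous_on ?W (\<lambda>p. snd p i - \<alpha> (fst p, truncate_fun k (snd p)) i)" for i
    by (intro continuous_on_diff continuous_on_apply continuous_on_snd continuous_on_id)
  then have "closedin (top_of_set ?W) (?W \<inter> (\<lambda>p. snd p i - \<alpha> (fst p, truncate_fun k (snd p)) i) -` {0})" for i
    by (rule continuous_closedin_preimage) simp
  then have "compact (?W \<inter> (\<lambda>p. snd p i - \<alpha> (fst p, truncate_fun k (snd p)) i) -` {0})" for i
    using closedin_compact[OF W] by blast
  then have cl: "closed (?W \<inter> (\<lambda>p. snd p i - \<alpha> (fst p, truncate_fun k (snd p)) i) -` {0})" for i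
    by (rule compact_imp_closed)
  have "compact (?W \<inter> (\<Inter>i\<in>{k..<n}. ?W \<inter> (\<lambda>p. snd p i - \<alpha> (fst p, truncate_fun k (snd p)) i) -` {0}))"
    by (intro compact_Int_closed[OF W] closed_INT ballI cl)
  moreover have "?W \<inter> (\<Inter>i\<in>{k..<n}. ?W \<inter> (\<lambda>p. snd p i - \<alpha> (fst p, truncate_fun k (snd p)) i) -` {0})
      = graph_set m n k \<alpha>"
    by (auto simp: graph_set_def)
  ultimately show ?thesis by simp
qed

lemma generic_avoidance_same_fibre_graph:
  assumes "LC d (mtopology_of M)" "m + k \<le> d" "k \<le> n" "DD_property_metric m n k M"
    and "continuous_on (unit_cube_set m \<times> unit_cube_set k) \<alpha>"
  shows "generic_avoidance M (unit_cube_set m \<times> unit_cube_set n) (same_fibre n (graph_set m n k \<alpha>))"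
  unfolding generic_avoidance_def
proof (intro allI impI)
  let ?W = "unit_cube_set m \<times> unit_cube_set n"
  fix f g and \<epsilon> :: real
  assume fg: "continuous_map (top_of_set ?W) (mtopology_of M) f"
    "continuous_map (top_of_set ?W) (mtopology_of M) g" and "0 < \<epsilon>"
  obtain f' g' where fg': "continuous_map (top_of_set ?W) (mtopology_of M) f'"
    "continuous_map (top_of_set ?W) (mtopology_of M) g'"
    "\<And>p. p \<in> ?W \<Longrightarrow> mdist M (f p) (f' p) < \<epsilon>" "\<And>p. p \<in> ?W \<Longrightarrow> mdist M (g p) (g' p) < \<epsilon>"
    and "\<And>z x y. x \<in> unit_cube_set n \<Longrightarrow> (z, y) \<in> graph_set m n k \<alpha> \<Longrightarrow> f' (z, x) \<noteq> g' (z, y)"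
    by (rule approximate_off_graph[OF assms(1-4) \<open>0 < \<epsilon>\<close> assms(5) fg]) blast
  from this(5) have "\<forall>(p, q)\<in>same_fibre n (graph_set m n k \<alpha>). f' p \<noteq> g' q"
    by (auto simp: same_fibre_def)
  then show "\<exists>f' g'. continuous_map (top_of_set ?W) (mtopology_of M) f' \<and>
           continuous_map (top_of_set ?W) (mtopology_of M) g' \<and>
           (\<forall>p\<in>?W. mdist M (f p) (f' p) < \<epsilon>) \<and> (\<forall>p\<in>?W. mdist M (g p) (g' p) < \<epsilon>) \<and>
           (\<forall>(p, q)\<in>same_fibre n (graph_set m n k \<alpha>). f' p \<noteq> g' q)"
    using fg' by blast
qed

text \<open>This is the inverse Vandermonde matrix: a polynomial of degree below \<open>N\<close> is
  determined by its values at \<open>N\<close> nodes, and \<open>\<Lambda> t i\<close> is the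
  coefficient of degree \<open>i\<close> of the Lagrange basis polynomial
  \<open>L t\<close>.\<close>

lemma lagrange_coefficients:
  fixes T :: "real set"
  assumes "finite T" "card T = N"
  obtains \<Lambda> where "\<And>c i. i < N \<Longrightarrow> c i = (\<Sum>t\<in>T. \<Lambda> t i * (\<Sum>j<N. c j * t ^ j))"
proof
  define L where "L t = (\<Prod>s\<in>T - {t}. smult (1 / (t - s)) [:- s, 1:])" for t
  have Lp: "poly (L t) s = (if s = t then 1 else 0)" if "s \<in> T" "t \<in> T" for s t
    using that \<open>finite T\<close>
    by (auto simp: L_def poly_prod diff_divide_distrib[symmetric] intro!: prod.neutral)
  have Ld: "degree (L t) < N" if "t \<in> T" for t
  proof -
    have "N > 0" using assms that card_gt_0_iff by blast
    have "degree (L t) \<le> (\<Sum>s\<in>T - {t}. degree (smult (1 / (t - s)) [:- s, 1:]))"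
      unfolding L_def using \<open>finite T\<close> by (intro order_trans[OF degree_prod_sum_le]) (auto simp: o_def)
    also have "\<dots> \<le> (\<Sum>s\<in>T - {t}. 1)" by (intro sum_mono) auto
    also have "\<dots> < N" using assms that \<open>N > 0\<close> by simp
    finally show ?thesis .
  qed
  fix c :: "nat \<Rightarrow> real" and i assume i: "i < N"
  define p where "p = (\<Sum>j<N. monom (c j) j)"
  have pp: "poly p t = (\<Sum>j<N. c j * t ^ j)" for t by (simp add: p_def poly_sum poly_monom)
  have pd: "degree p < N"
    unfolding p_def using i by (intro degree_sum_less) (auto intro: le_less_trans[OF degree_monom_le])
  define q where "q = (\<Sum>t\<in>T. smult (poly p t) (L t))"
  have qd: "degree q < N"
    unfolding q_def using i by (intro degree_sum_less) (auto intro: le_less_trans[OF degree_smult_le] Ld)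
  have "poly q t = poly p t" if "t \<in> T" for t
  proof -
    have "poly q t = (\<Sum>s\<in>T. if t = s then poly p s else 0)"
      unfolding q_def poly_sum poly_smult using Lp that by (intro sum.cong) auto
    then show ?thesis using that \<open>finite T\<close> by simp
  qed
  then have "q = p" using pd qd assms by (intro poly_eqI_degree[of T]) auto
  moreover have "coeff p i = c i" using i by (simp add: p_def coeff_sum)
  moreover have "coeff q i = (\<Sum>t\<in>T. poly p t * coeff (L t) i)" by (simp add: q_def coeff_sum)
  ultimately show "c i = (\<Sum>t\<in>T. coeff (L t) i * (\<Sum>j<N. c j * t ^ j))"
    by (simp add: pp mult.commute)
qed

subsection \<open>Vandermonde forms\<close>

text \<open>The coordinates \<open>k, \<dots>, n - 1\<close> of the fibre come first, since the graphs are solved for them.\<close>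

definition mixed_coord :: "nat \<Rightarrow> nat \<Rightarrow> (nat \<Rightarrow> real) \<times> (nat \<Rightarrow> real) \<Rightarrow> nat \<Rightarrow> real" where
  "mixed_coord n k p j = (if j < n - k then snd p (k + j)
     else if j < n then snd p (j - (n - k)) else fst p (j - n))"

lemma mixed_coord_eqs:
  assumes "k \<le> n"
  shows "k \<le> i \<Longrightarrow> i < n \<Longrightarrow> mixed_coord n k p (i - k) = snd p i"
    and "i < k \<Longrightarrow> mixed_coord n k p (n - k + i) = snd p i"
    and "mixed_coord n k p (n + i) = fst p i"
proof -
  assume "k \<le> i" "i < n"
  then have "i - k < n - k" by linarith
  then show "mixed_coord n k p (i - k) = snd p i" using \<open>k \<le> i\<close> by (simp add: mixed_coord_def)
next
  assume "i < k"
  then have "\<not> n - k + i < n - k" "n - k + i < n" using assms by linarith+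
  then show "mixed_coord n k p (n - k + i) = snd p i" unfolding mixed_coord_def by simp
next
  have "\<not> n + i < n - k" by linarith
  then show "mixed_coord n k p (n + i) = fst p i" unfolding mixed_coord_def by simp
qed

text \<open>The polynomial with coefficients \<open>mixed_coord n k p\<close>, evaluated at
  \<open>t\<close>; distinct nodes \<open>t\<close> give the rows of a Vandermonde matrix.\<close>

definition moment_form :: "nat \<Rightarrow> nat \<Rightarrow> nat \<Rightarrow> real \<Rightarrow> (nat \<Rightarrow> real) \<times> (nat \<Rightarrow> real) \<Rightarrow> real" where
  "moment_form m n k t p = (\<Sum>j<m + n. mixed_coord n k p j * t ^ j)"

lemma continuous_on_mixed_coord: "continuous_on S (\<lambda>p. mixed_coord n k p j)"
  unfolding mixed_coord_def
  by (intro continuous_on_if_const continuous_on_apply continuous_on_fst continuous_on_snd continuous_on_id)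

lemma continuous_on_moment_form: "continuous_on S (moment_form m n k t)"
  unfolding moment_form_def
  by (intro continuous_on_sum continuous_on_mult continuous_on_const continuous_on_mixed_coord)

text \<open>The Vandermonde matrix of \<open>m + n\<close> distinct nodes is invertible. This makes
  the forms eligible for measuring nearness in \<open>uniformly_close\<close>.\<close>

lemma moment_form_separates:
  assumes "finite T" "card T = m + n" "k \<le> n"
    and p: "p \<in> unit_cube_set m \<times> unit_cube_set n" and q: "q \<in> unit_cube_set m \<times> unit_cube_set n"
    and eq: "\<And>t. t \<in> T \<Longrightarrow> moment_form m n k t p = moment_form m n k t q"
  shows "p = q"
proof -
  obtain \<Lambda> where \<Lambda>: "\<And>c i. i < m + n \<Longrightarrow> c i = (\<Sum>t\<in>T. \<Lambda> t i * (\<Sum>j<m + n. c j * t ^ j))"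
    using lagrange_coefficients[OF assms(1,2)] by metis
  have mc: "mixed_coord n k p i = mixed_coord n k q i" if "i < m + n" for i
  proof -
    have "mixed_coord n k p i = (\<Sum>t\<in>T. \<Lambda> t i * moment_form m n k t p)"
      unfolding moment_form_def by (rule \<Lambda>[OF that])
    also have "\<dots> = (\<Sum>t\<in>T. \<Lambda> t i * moment_form m n k t q)"
      using eq by simp
    also have "\<dots> = mixed_coord n k q i"
      unfolding moment_form_def by (rule \<Lambda>[OF that, symmetric])
    finally show ?thesis .
  qed
  have "snd p i = snd q i" for i
  proof (cases "i < n")
    case True
    show ?thesis
    proof (cases "i < k")
      case True then show ?thesis
        using mc[of "n - k + i"] mixed_coord_eqs(2)[OF \<open>k \<le> n\<close>] \<open>i < n\<close> \<open>k \<le> n\<close> by simp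
    next
      case False then show ?thesis
        using mc[of "i - k"] mixed_coord_eqs(1)[OF \<open>k \<le> n\<close>] \<open>i < n\<close> by simp
    qed
  qed (use p q in \<open>auto simp: unit_cube_set_iff\<close>)
  moreover have "fst p i = fst q i" for i
  proof (cases "i < m")
    case True then show ?thesis
      using mc[of "n + i"] mixed_coord_eqs(3)[OF \<open>k \<le> n\<close>] by simp
  qed (use p q in \<open>auto simp: unit_cube_set_iff\<close>)
  ultimately show ?thesis by (simp add: prod_eq_iff fun_eq_iff)
qed

text \<open>The unknown coordinates carry the exponents \<open>0, \<dots>, n - k - 1\<close>, so the
  system for them at \<open>n - k\<close> distinct nodes is again Vandermonde, whichever nodes are
  chosen.\<close>

lemma moment_form_levels_in_graph:
  assumes "finite J" "card J = n - k" "k \<le> n"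
  obtains \<alpha> where "continuous_on (unit_cube_set m \<times> unit_cube_set k) \<alpha>"
    "\<And>p. p \<in> unit_cube_set m \<times> unit_cube_set n \<Longrightarrow> (\<And>t. t \<in> J \<Longrightarrow> moment_form m n k t p = c t) \<Longrightarrow>
       p \<in> graph_set m n k \<alpha>"
proof -
  obtain \<Lambda> where \<Lambda>: "\<And>c i. i < n - k \<Longrightarrow> c i = (\<Sum>t\<in>J. \<Lambda> t i * (\<Sum>j<n - k. c j * t ^ j))"
    using lagrange_coefficients[OF assms(1,2)] by metis
  \<comment> \<open>The contribution of the remaining coordinates is moved to the right-hand side.
    It depends only on the base and the first \<open>k\<close> fibre coordinates, so truncation does
    not affect it.\<close>
  define \<alpha> where "\<alpha> p i = (\<Sum>t\<in>J. \<Lambda> t (i - k) * (c t - (\<Sum>j\<in>{n - k..<m + n}. mixed_coord n k p j * t ^ j)))" for p i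
  show thesis
  proof (rule that)
    show "continuous_on (unit_cube_set m \<times> unit_cube_set k) \<alpha>"
      unfolding \<alpha>_def
      by (intro continuous_on_coordinatewise_then_product continuous_on_sum continuous_on_mult
          continuous_on_diff continuous_on_const continuous_on_mixed_coord)
    fix p assume p: "p \<in> unit_cube_set m \<times> unit_cube_set n"
      and lev: "\<And>t. t \<in> J \<Longrightarrow> moment_form m n k t p = c t"
    have "snd p i = \<alpha> (fst p, truncate_fun k (snd p)) i" if i: "k \<le> i" "i < n" for i
    proof -
      have tr: "mixed_coord n k (fst p, truncate_fun k (snd p)) j = mixed_coord n k p j"
        if "j \<in> {n - k..<m + n}" for j
        using that \<open>k \<le> n\<close> by (auto simp: mixed_coord_def truncate_fun_def)
      have "(\<Sum>j<n - k. mixed_coord n k p j * t ^ j)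
          = c t - (\<Sum>j\<in>{n - k..<m + n}. mixed_coord n k (fst p, truncate_fun k (snd p)) j * t ^ j)"
        if "t \<in> J" for t
      proof -
        have "{..<m + n} = {..<n - k} \<union> {n - k..<m + n}" by auto
        then have "moment_form m n k t p = (\<Sum>j<n - k. mixed_coord n k p j * t ^ j)
            + (\<Sum>j\<in>{n - k..<m + n}. mixed_coord n k p j * t ^ j)"
          unfolding moment_form_def by (simp add: sum.union_disjoint ivl_disj_int_one)
        then show ?thesis using lev[OF that] tr by simp
      qed
      moreover have "snd p i = mixed_coord n k p (i - k)"
        using i mixed_coord_eqs(1)[OF \<open>k \<le> n\<close>] by simp
      moreover have "mixed_coord n k p (i - k)
          = (\<Sum>t\<in>J. \<Lambda> t (i - k) * (\<Sum>j<n - k. mixed_coord n k p j * t ^ j))"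
        using i by (intro \<Lambda>) auto
      ultimately show ?thesis unfolding \<alpha>_def by simp
    qed
    then show "p \<in> graph_set m n k \<alpha>"
      using p unfolding graph_set_def by (auto simp: case_prod_unfold)
  qed
qed

text \<open>Compactness upgrades integrality to nearness: for each set \<open>J\<close> of
  \<open>l + 1\<close> coordinates the sum of the distances to the integers has no zero on
  \<open>P\<close>, hence a positive minimum.\<close>

lemma finite_near_integers:
  fixes v :: "nat \<Rightarrow> 'b::t2_space \<Rightarrow> real"
  assumes P: "compact P" and v: "\<And>j. continuous_on P (v j)"
    and few: "\<And>p. p \<in> P \<Longrightarrow> card {j. j < d \<and> v j p \<in> \<int>} \<le> l"
  obtains \<tau> where "0 < \<tau>" "\<tau> < 1/2" "\<And>p. p \<in> P \<Longrightarrow> card {j. j < d \<and> infdist (v j p) \<int> < \<tau>} \<le> l"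
proof (cases "P = {}")
  case True then show ?thesis using that[of "1/3"] by simp
next
  case False
  let ?\<J> = "{J. J \<subseteq> {..<d} \<and> card J = Suc l}"
  define s where "s J p = (\<Sum>j\<in>J. infdist (v j p) \<int>)" for J p
  have fin: "finite ?\<J>" by simp
  have "\<exists>\<mu>>0. \<forall>p\<in>P. \<mu> \<le> s J p" if J: "J \<in> ?\<J>" for J
  proof -
    have Jf: "finite J" using J finite_subset by blast
    have "continuous_on P (s J)"
      unfolding s_def by (intro continuous_on_sum continuous_on_infdist v)
    then obtain q where q: "q \<in> P" "\<forall>p\<in>P. s J q \<le> s J p"
      using continuous_attains_inf[OF P False] by blast
    have "s J q \<noteq> 0"
    proof
      assume "s J q = 0"
      then have "\<forall>j\<in>J. infdist (v j q) \<int> = 0"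
        unfolding s_def using Jf by (simp add: sum_nonneg_eq_0_iff infdist_nonneg)
      then have "J \<subseteq> {j. j < d \<and> v j q \<in> \<int>}"
        using J in_closed_iff_infdist_zero[of "\<int> :: real set"] closed_Ints Ints_0 by blast
      then have "Suc l \<le> card {j. j < d \<and> v j q \<in> \<int>}"
        using J card_mono[of "{j. j < d \<and> v j q \<in> \<int>}" J] by auto
      then show False using few[OF q(1)] by simp
    qed
    then have "s J q > 0" unfolding s_def by (simp add: sum_nonneg infdist_nonneg less_le)
    then show ?thesis using q(2) by blast
  qed
  then have "\<forall>J\<in>?\<J>. \<exists>\<mu>. \<mu> > 0 \<and> (\<forall>p\<in>P. \<mu> \<le> s J p)" by blast
  from bchoice[OF this] obtain \<mu> where
    \<mu>: "\<And>J. J \<in> ?\<J> \<Longrightarrow> \<mu> J > 0" "\<And>J p. J \<in> ?\<J> \<Longrightarrow> p \<in> P \<Longrightarrow> \<mu> J \<le> s J p"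
    by blast
  \<comment> \<open>If \<open>l + 1\<close> coordinates were closer than
    \<open>\<mu> J / Suc l\<close> to integers, the sum would drop below \<open>\<mu> J\<close>. The
    entry 1/3 keeps \<open>\<tau>\<close> below 1/2 and makes the minimum defined in every
    case.\<close>
  define \<tau> where "\<tau> = Min (insert (1/3) ((\<lambda>J. \<mu> J / Suc l) ` ?\<J>))"
  have \<tau>J: "\<tau> \<le> \<mu> J / Suc l" if "J \<in> ?\<J>" for J
    unfolding \<tau>_def using fin that by (intro Min_le) auto
  show thesis
  proof (rule that)
    show "0 < \<tau>" unfolding \<tau>_def using fin \<mu>(1) by (subst Min_gr_iff) auto
    have "\<tau> \<le> 1/3" unfolding \<tau>_def using fin by (intro Min_le) auto
    then show "\<tau> < 1/2" by simp
    fix p assume p: "p \<in> P"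
    show "card {j. j < d \<and> infdist (v j p) \<int> < \<tau>} \<le> l"
    proof (rule ccontr)
      assume "\<not> card {j. j < d \<and> infdist (v j p) \<int> < \<tau>} \<le> l"
      then have "Suc l \<le> card {j. j < d \<and> infdist (v j p) \<int> < \<tau>}" by simp
      then obtain J where J: "J \<subseteq> {j. j < d \<and> infdist (v j p) \<int> < \<tau>}" "card J = Suc l"
        by (rule obtain_subset_with_card_n)
      then have J': "J \<in> ?\<J>" by auto
      have ne: "J \<noteq> {}" "finite J" using J(2) by (auto intro: card_ge_0_finite)
      have "s J p < (\<Sum>j\<in>J. \<tau>)" unfolding s_def using J(1) ne by (intro sum_strict_mono) auto
      also have "\<dots> = Suc l * \<tau>" using J(2) by simp
      also have "\<dots> \<le> \<mu> J" using \<tau>J[OF J'] by (simp add: field_simps)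
      finally show False using \<mu>(2)[OF J' p] by simp
    qed
  qed
qed

text \<open>Elimination: an equation with a nonzero coefficient is solved for the unknown
  \<open>b\<close>, which leaves one equation and one unknown fewer.\<close>

lemma homogeneous_system_nontrivial:
  fixes v :: "'j \<Rightarrow> 'i \<Rightarrow> real"
  assumes "finite J" "finite I" "card J < card I"
  shows "\<exists>w. (\<exists>i\<in>I. w i \<noteq> 0) \<and> (\<forall>j\<in>J. (\<Sum>i\<in>I. w i * v j i) = 0)"
  using assms
proof (induction J arbitrary: I v rule: finite_induct)
  case empty
  then show ?case by (intro exI[of _ "\<lambda>_. 1"]) (auto simp: card_gt_0_iff)
next
  case (insert a J)
  show ?case
  proof (cases "\<forall>i\<in>I. v a i = 0")
    case True
    have "card J < card I" using insert by simp
    from insert.IH[OF insert.prems(1) this, of v] show ?thesis using True by auto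
  next
    case False
    then obtain b where b: "b \<in> I" "v a b \<noteq> 0" by blast
    let ?I = "I - {b}"
    define v' where "v' j i = v j i - v j b / v a b * v a i" for j i
    have "card J < card ?I" using insert b by simp
    then obtain w where w: "\<exists>i\<in>?I. w i \<noteq> 0" "\<forall>j\<in>J. (\<Sum>i\<in>?I. w i * v' j i) = 0"
      using insert.IH[of ?I v'] insert.prems(1) by auto
    define W where "W = w(b := - (\<Sum>i\<in>?I. w i * v a i) / v a b)"
    have S: "(\<Sum>i\<in>I. W i * v j i) = W b * v j b + (\<Sum>i\<in>?I. w i * v j i)" for j
      using b insert.prems(1) by (subst sum.remove[of I b]) (auto simp: W_def)
    have "(\<Sum>i\<in>I. W i * v j i) = 0" if "j \<in> J" for j
    proof -
      have "0 = (\<Sum>i\<in>?I. w i * v j i - v j b / v a b * (w i * v a i))"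
      proof -
        have "w i * v' j i = w i * v j i - v j b / v a b * (w i * v a i)" for i
          by (simp add: v'_def right_diff_distrib)
        then have "(\<Sum>i\<in>?I. w i * v' j i) = (\<Sum>i\<in>?I. w i * v j i - v j b / v a b * (w i * v a i))"
          by (intro sum.cong refl)
        then show ?thesis using w(2) that by metis
      qed
      also have "\<dots> = (\<Sum>i\<in>?I. w i * v j i) - v j b / v a b * (\<Sum>i\<in>?I. w i * v a i)"
        by (simp add: sum_subtractf sum_distrib_left)
      finally show ?thesis unfolding S by (simp add: W_def)
    qed
    moreover have "(\<Sum>i\<in>I. W i * v a i) = 0" unfolding S using b by (simp add: W_def)
    moreover have "\<exists>i\<in>I. W i \<noteq> 0" using w(1) by (auto simp: W_def)
    ultimately show ?thesis by (intro exI[of _ W]) auto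
  qed
qed

subsection \<open>Low-dimensional approximation and general position\<close>

text \<open>\<open>S\<close> consists of the floor vectors of \<open>x + \<sigma>\<close> for small
  shifts that leave no coordinate integral. They grow with \<open>\<sigma>\<close> and so form a
  chain, on which the number \<open>f\<close> of raised coordinates is injective; only the at most
  \<open>l\<close> near coordinates can be raised.\<close>

lemma card_shifted_floors:
  fixes x :: "nat \<Rightarrow> real"
  assumes \<tau>: "0 < \<tau>" "\<tau> < 1/2" and few: "card {j. j < d \<and> infdist (x j) \<int> < \<tau>} \<le> l"
  defines "S \<equiv> {c \<in> PiE {..<d} (\<lambda>_. UNIV :: int set).
      \<exists>\<sigma>. \<bar>\<sigma>\<bar> < \<tau> \<and> (\<forall>j<d. c j < x j + \<sigma> \<and> x j + \<sigma> < c j + 1)}"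
  shows "finite S \<and> card S \<le> Suc l"
proof -
  define near where "near = {j. j < d \<and> infdist (x j) \<int> < \<tau>}"
  \<comment> \<open>Floor at the lower end of a window of length \<open>2 * \<tau>\<close>, which is
    below 1: the floor rises by at most 1 within it.\<close>
  define b where "b j = \<lfloor>x j - \<tau>\<rfloor>" for j
  define f where "f c = (\<Sum>j<d. c j - b j)" for c :: "nat \<Rightarrow> int"
  have bnd: "0 \<le> c j - b j \<and> c j - b j \<le> (if j \<in> near then 1 else 0)" if "c \<in> S" "j < d" for c j
  proof -
    have "\<exists>\<sigma>. \<bar>\<sigma>\<bar> < \<tau> \<and> (\<forall>j<d. c j < x j + \<sigma> \<and> x j + \<sigma> < c j + 1)"
      using that(1) unfolding S_def by simp
    then obtain \<sigma> where \<sigma>: "\<bar>\<sigma>\<bar> < \<tau>" "c j < x j + \<sigma>" "x j + \<sigma> < c j + 1"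
      using \<open>j < d\<close> by blast
    have b: "b j \<le> x j - \<tau>" "x j - \<tau> < b j + 1" unfolding b_def by linarith+
    have "real_of_int (b j) < c j + 1" "real_of_int (c j) < b j + 2" using \<sigma> b \<tau> by linarith+
    then have bc: "b j \<le> c j" "c j \<le> b j + 1" by linarith+
    have "j \<in> near" if "c j = b j + 1"
    proof -
      have "dist (x j) (c j) < \<tau>" using \<sigma> b that unfolding dist_real_def by (simp add: abs_less_iff)
      moreover have "infdist (x j) \<int> \<le> dist (x j) (c j)" by (rule infdist_le) simp
      ultimately show ?thesis using \<open>j < d\<close> by (simp add: near_def)
    qed
    then show ?thesis using bc by (cases "c j = b j + 1") auto
  qed
  have "f c \<in> {0..int l}" if "c \<in> S" for c
  proof -
    have "f c \<le> (\<Sum>j<d. if j \<in> near then 1 else 0)"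
      unfolding f_def using bnd[OF that] by (intro sum_mono) auto
    also have "\<dots> = int (card ({..<d} \<inter> near))" by (simp add: sum.If_cases)
    also have "{..<d} \<inter> near = near" by (auto simp: near_def)
    finally have "f c \<le> int l" using few unfolding near_def by linarith
    moreover have "0 \<le> f c" unfolding f_def using bnd[OF that] by (intro sum_nonneg) auto
    ultimately show ?thesis by simp
  qed
  then have im: "f ` S \<subseteq> {0..int l}" by blast
  have mono: "c j \<le> c' j" if "\<forall>j<d. c j < x j + \<sigma> \<and> x j + \<sigma> < c j + 1"
    "\<forall>j<d. c' j < x j + \<sigma>' \<and> x j + \<sigma>' < c' j + 1" "\<sigma> \<le> \<sigma>'" "j < d" for c c' :: "nat \<Rightarrow> int" and \<sigma> \<sigma>' j
  proof -
    have "c j < x j + \<sigma>" "x j + \<sigma>' < c' j + 1" using that by auto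
    then have "real_of_int (c j) < c' j + 1" using that(3) by linarith
    then show ?thesis by linarith
  qed
  have eq: "c = c'" if "c \<in> S" "c' \<in> S" "\<forall>j<d. c j \<le> c' j" "f c = f c'" for c c'
  proof -
    have "c j = c' j" if "j \<in> {..<d}" for j
    proof (rule ccontr)
      assume "c j \<noteq> c' j"
      then have "c j < c' j" using \<open>\<forall>j<d. c j \<le> c' j\<close> that by (simp add: less_le)
      then have "f c < f c'"
        unfolding f_def using \<open>\<forall>j<d. c j \<le> c' j\<close> that by (intro sum_strict_mono_ex1) auto
      then show False using \<open>f c = f c'\<close> by simp
    qed
    moreover have "c \<in> PiE {..<d} (\<lambda>_. UNIV)" "c' \<in> PiE {..<d} (\<lambda>_. UNIV)"
      using that(1,2) unfolding S_def by simp_all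
    ultimately show ?thesis by (intro PiE_ext[of c "{..<d}" "\<lambda>_. UNIV" c'])
  qed
  have "inj_on f S"
  proof (rule inj_onI)
    fix c c' assume c: "c \<in> S" "c' \<in> S" "f c = f c'"
    from c(1) obtain \<sigma> where \<sigma>1: "\<forall>j<d. c j < x j + \<sigma> \<and> x j + \<sigma> < c j + 1"
      unfolding S_def by auto
    from c(2) obtain \<sigma>' where \<sigma>2: "\<forall>j<d. c' j < x j + \<sigma>' \<and> x j + \<sigma>' < c' j + 1"
      unfolding S_def by auto
    note \<sigma> = \<sigma>1 \<sigma>2
    show "c = c'"
    proof (cases "\<sigma> \<le> \<sigma>'")
      case True then show ?thesis using eq[OF c(1,2)] c(3) mono[OF \<sigma>] by blast
    next
      case False
      then have "\<sigma>' \<le> \<sigma>" by simp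
      then show ?thesis using eq[OF c(2,1)] c(3) mono[OF \<sigma>(2,1)] by metis
    qed
  qed
  then show ?thesis
    using inj_on_finite[OF _ im] card_inj_on_le[OF _ im] by simp
qed

text \<open>The sets \<open>U c\<close> come from the cubes of the integer grid in the \<open>v\<close>-coordinates by shifting the
  grid diagonally by less than \<open>\<tau>\<close>. Only the coordinates near an integer are affected by the shift,
  each of them at most once, so that a point lies in at most \<open>l + 1\<close> of these sets.\<close>

lemma low_dimensional_approximation:
  fixes v :: "nat \<Rightarrow> 'b::metric_space \<Rightarrow> real" and h :: "'b \<Rightarrow> nat \<Rightarrow> real"
  assumes P: "compact P" and v: "\<And>j. continuous_on UNIV (v j)"
    and few: "\<And>p. p \<in> P \<Longrightarrow> card {j. j < d \<and> v j p \<in> \<int>} \<le> l"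
    and osc: "\<And>p q i. \<lbrakk>p \<in> P; q \<in> P; \<And>j. j < d \<Longrightarrow> \<bar>v j p - v j q\<bar> \<le> 2\<rbrakk> \<Longrightarrow> \<bar>h p i - h q i\<bar> \<le> \<epsilon>"
  shows "\<exists>(C :: 'b set set) V F. finite C \<and> (\<forall>i. continuous_on P (\<lambda>p. F p i)) \<and>
    (\<forall>p\<in>P. \<forall>i. \<bar>h p i - F p i\<bar> \<le> \<epsilon>) \<and>
    (\<forall>p\<in>P. \<exists>E w. E \<subseteq> C \<and> card E \<le> Suc l \<and> sum w E = 1 \<and> (\<forall>i::nat. F p i = (\<Sum>U\<in>E. w U * V U i)))"
proof -
  obtain \<tau> where \<tau>: "0 < \<tau>" "\<tau> < 1/2"
    and near: "\<And>p. p \<in> P \<Longrightarrow> card {j. j < d \<and> infdist (v j p) \<int> < \<tau>} \<le> l"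
    using finite_near_integers[OF P continuous_on_subset[OF v subset_UNIV] few] by metis
  have "\<exists>R. \<forall>p\<in>P. \<bar>v j p\<bar> \<le> R" for j
    using compact_imp_bounded[OF compact_continuous_image[OF continuous_on_subset[OF v subset_UNIV] P, of j]]
    unfolding bounded_iff by auto
  then obtain R where R: "\<And>j p. p \<in> P \<Longrightarrow> \<bar>v j p\<bar> \<le> R j" by metis
  \<comment> \<open>The forms are bounded on \<open>P\<close>, so finitely many grid cubes matter;
    the extra 1 on either side makes room for the shift.\<close>
  define I where "I = PiE {..<d} (\<lambda>j. {- \<lceil>R j\<rceil> - 1..\<lceil>R j\<rceil> + 1})"
  have I: "finite I" "I \<subseteq> PiE {..<d} (\<lambda>_. UNIV)" unfolding I_def by (auto intro: finite_PiE)
  define U where "U c = {p. \<exists>\<sigma>. \<bar>\<sigma>\<bar> < \<tau> \<and> (\<forall>j<d. of_int (c j) < v j p + \<sigma> \<and> v j p + \<sigma> < of_int (c j) + 1)}"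
    for c :: "nat \<Rightarrow> int"
  define C where "C = U ` I"
  have C: "finite C" using I by (simp add: C_def)
  have opU: "open (U c)" for c
  proof -
    have "U c = (\<Union>\<sigma>\<in>{\<sigma>. \<bar>\<sigma>\<bar> < \<tau>}. \<Inter>j\<in>{..<d}. v j -` {of_int (c j) - \<sigma><..<of_int (c j) + 1 - \<sigma>})"
      unfolding U_def by (auto simp: less_diff_eq diff_less_eq)
    moreover have "open (v j -` {of_int (c j) - \<sigma><..<of_int (c j) + 1 - \<sigma>})" for j \<sigma>
      using v by (intro open_vimage) auto
    ultimately show ?thesis by (auto intro!: open_UN open_INT)
  qed
  have cover: "P \<subseteq> \<Union>C"
  proof
    fix p assume p: "p \<in> P"
    \<comment> \<open>Only countably many shifts put some coordinate of \<open>p\<close> on the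
      grid; any other shift below \<open>\<tau>\<close> places \<open>p\<close> inside an open grid
      cube.\<close>
    have "countable (\<Union>j<d. (\<lambda>z. of_int z - v j p) ` (UNIV :: int set))" by simp
    moreover have "uncountable {-\<tau><..<\<tau>}" using \<tau> uncountable_open_interval by simp
    ultimately have "\<not> {-\<tau><..<\<tau>} \<subseteq> (\<Union>j<d. (\<lambda>z. of_int z - v j p) ` (UNIV :: int set))"
      by (meson countable_subset)
    then obtain \<sigma> where \<sigma>: "\<sigma> \<in> {-\<tau><..<\<tau>}" "\<sigma> \<notin> (\<Union>j<d. (\<lambda>z. of_int z - v j p) ` (UNIV :: int set))"
      by blast
    define c where "c = (\<lambda>j\<in>{..<d}. \<lfloor>v j p + \<sigma>\<rfloor>)"
    have "of_int (c j) < v j p + \<sigma> \<and> v j p + \<sigma> < of_int (c j) + 1" if "j < d" for j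
    proof -
      have "\<sigma> \<noteq> of_int \<lfloor>v j p + \<sigma>\<rfloor> - v j p" using \<sigma>(2) that by blast
      then show ?thesis using that unfolding c_def by simp linarith
    qed
    then have "p \<in> U c" using \<sigma>(1) unfolding U_def by (auto intro!: exI[of _ \<sigma>])
    moreover have "\<lfloor>v j p + \<sigma>\<rfloor> \<in> {- \<lceil>R j\<rceil> - 1..\<lceil>R j\<rceil> + 1}" for j
    proof -
      have "- R j - 1 \<le> v j p + \<sigma>" "v j p + \<sigma> \<le> R j + 1" using R[OF p, of j] \<sigma>(1) \<tau> by auto
      then show ?thesis by simp linarith
    qed
    then have "c \<in> I" unfolding I_def c_def by auto
    ultimately show "p \<in> \<Union>C" unfolding C_def by blast
  qed
  obtain \<Phi> where \<Phi>: "\<And>A. A \<in> C \<Longrightarrow> continuous_on P (\<Phi> A) \<and> (\<forall>x \<in> P. 0 \<le> \<Phi> A x)"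
      "\<And>x A. \<lbrakk>A \<in> C; x \<in> P; x \<notin> A\<rbrakk> \<Longrightarrow> \<Phi> A x = 0"
      "\<And>x. x \<in> P \<Longrightarrow> supp_sum (\<lambda>A. \<Phi> A x) C = (1::real)"
  proof (rule subordinate_partition_of_unity[OF cover])
    show "open T" if "T \<in> C" for T using that opU by (auto simp: C_def)
    show "\<exists>V. open V \<and> x \<in> V \<and> finite {U \<in> C. U \<inter> V \<noteq> {}}" for x
      using C by (intro exI[of _ UNIV]) auto
  qed auto
  have \<Phi>1: "(\<Sum>A\<in>C. \<Phi> A p) = 1" if "p \<in> P" for p
  proof -
    have "(\<Sum>A\<in>C. \<Phi> A p) = (\<Sum>A\<in>{A \<in> C. \<Phi> A p \<noteq> 0}. \<Phi> A p)"
      using C by (intro sum.mono_neutral_right) auto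
    then show ?thesis using \<Phi>(3)[OF that] by (simp add: supp_sum_def support_on_def)
  qed
  \<comment> \<open>A sample point of each cover set, at which \<open>h\<close> is evaluated. If
    \<open>A\<close> misses \<open>P\<close> the choice is arbitrary, and \<open>\<Phi> A\<close>
    vanishes on \<open>P\<close>.\<close>
  define b where "b A = (SOME q. q \<in> A \<inter> P)" for A
  have b: "b A \<in> A \<inter> P" if "p \<in> A" "p \<in> P" for A p unfolding b_def using that by (intro someI) auto
  define V where "V A = h (b A)" for A
  define F where "F p i = (\<Sum>A\<in>C. \<Phi> A p * V A i)" for p i
  have "continuous_on P (\<lambda>p. F p i)" for i
    unfolding F_def using \<Phi>(1) by (intro continuous_on_sum continuous_on_mult continuous_on_const) auto
  moreover have "\<bar>h p i - F p i\<bar> \<le> \<epsilon>" if p: "p \<in> P" for p i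
  proof -
    have t: "\<bar>\<Phi> A p * (h p i - V A i)\<bar> \<le> \<Phi> A p * \<epsilon>" if A: "A \<in> C" for A
    proof (cases "p \<in> A")
      case True
      obtain c where c: "A = U c" using A by (auto simp: C_def)
      \<comment> \<open>Two points of one set may use different shifts, so their coordinates differ
        by less than \<open>1 + 2 * \<tau>\<close>; hence the bound 2 in \<open>osc\<close>.\<close>
      have "\<bar>v j p - v j (b A)\<bar> \<le> 2" if j: "j < d" for j
      proof -
        obtain \<sigma> where "\<bar>\<sigma>\<bar> < \<tau>" "of_int (c j) < v j p + \<sigma>" "v j p + \<sigma> < of_int (c j) + 1"
          using True j unfolding c U_def by blast
        moreover obtain \<sigma>' where "\<bar>\<sigma>'\<bar> < \<tau>" "of_int (c j) < v j (b A) + \<sigma>'" "v j (b A) + \<sigma>' < of_int (c j) + 1"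
          using b[OF True p] j unfolding c U_def by blast
        ultimately show ?thesis using \<tau> by linarith
      qed
      then have "\<bar>h p i - V A i\<bar> \<le> \<epsilon>" unfolding V_def using b[OF True p] p by (intro osc) auto
      then show ?thesis using \<Phi>(1)[OF A] p by (simp add: abs_mult mult_left_mono)
    qed (use \<Phi>(2)[OF A p] in simp)
    have "h p i - F p i = (\<Sum>A\<in>C. \<Phi> A p) * h p i - F p i" using \<Phi>1[OF p] by simp
    also have "\<dots> = (\<Sum>A\<in>C. \<Phi> A p * (h p i - V A i))"
      by (simp add: F_def sum_distrib_right right_diff_distrib sum_subtractf)
    finally have "\<bar>h p i - F p i\<bar> \<le> (\<Sum>A\<in>C. \<bar>\<Phi> A p * (h p i - V A i)\<bar>)" by (simp add: sum_abs)
    also have "\<dots> \<le> (\<Sum>A\<in>C. \<Phi> A p * \<epsilon>)" by (intro sum_mono t)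
    also have "\<dots> = \<epsilon>" using \<Phi>1[OF p] by (simp add: sum_distrib_right[symmetric])
    finally show ?thesis .
  qed
  moreover have "\<exists>E w. E \<subseteq> C \<and> card E \<le> Suc l \<and> sum w E = 1 \<and> (\<forall>i. F p i = (\<Sum>U\<in>E. w U * V U i))"
    if p: "p \<in> P" for p
  proof -
    \<comment> \<open>Only the cover sets containing \<open>p\<close> carry weight, and they come
      from the floor vectors counted in \<open>card_shifted_floors\<close>.\<close>
    let ?E = "{A \<in> C. p \<in> A}"
    let ?S = "{c \<in> PiE {..<d} (\<lambda>_. UNIV :: int set).
      \<exists>\<sigma>. \<bar>\<sigma>\<bar> < \<tau> \<and> (\<forall>j<d. c j < v j p + \<sigma> \<and> v j p + \<sigma> < c j + 1)}"
    have S: "finite ?S" "card ?S \<le> Suc l" using card_shifted_floors[OF \<tau> near[OF p]] by auto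
    have "?E \<subseteq> U ` ?S" using I(2) by (auto simp: C_def U_def)
    then have "card ?E \<le> Suc l" by (rule order_trans[OF surj_card_le[OF S(1)] S(2)])
    moreover have E: "(\<Sum>A\<in>?E. \<Phi> A p * x A) = (\<Sum>A\<in>C. \<Phi> A p * x A)" for x :: "'b set \<Rightarrow> real"
      using \<Phi>(2)[OF _ p] C by (intro sum.mono_neutral_left) auto
    moreover have "(\<Sum>A\<in>?E. \<Phi> A p) = 1" using E[of "\<lambda>_. 1"] \<Phi>1[OF p] by simp
    moreover have "?E \<subseteq> C" by blast
    ultimately show ?thesis
      unfolding F_def E[symmetric] by blast
  qed
  ultimately show ?thesis using C by (intro exI[of _ C] exI[of _ V] exI[of _ F] conjI) simp_all
qed

text \<open>Differences from the base points \<open>A\<close> and \<open>A'\<close> give at most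
  \<open>2 * l\<close> vectors, so some nonzero functional in \<open>2 * l + 1\<close> coordinates
  kills all of them. It is constant on each of the two affine hulls, hence on the differences of
  their points.\<close>

lemma affine_combinations_in_hyperplane:
  fixes V :: "'u \<Rightarrow> nat \<Rightarrow> real" and V' :: "'w \<Rightarrow> nat \<Rightarrow> real"
  assumes fin: "finite E" "finite E'" and ne: "E \<noteq> {}" "E' \<noteq> {}"
    and card: "card E \<le> Suc l" "card E' \<le> Suc l"
  shows "\<exists>a \<beta>. (\<exists>i<2 * l + 1. a i \<noteq> 0) \<and> (\<forall>w w'. sum w E = 1 \<longrightarrow> sum w' E' = 1 \<longrightarrow>
      (\<Sum>i<2 * l + 1. a i * ((\<Sum>U\<in>E'. w' U * V' U i) - (\<Sum>U\<in>E. w U * V U i))) = \<beta>)"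
proof -
  obtain A A' where A: "A \<in> E" "A' \<in> E'" using ne by blast
  define J where "J = (E - {A}) <+> (E' - {A'})"
  define x where "x j i = (case j of Inl U \<Rightarrow> V U i - V A i | Inr U \<Rightarrow> V' U i - V' A' i)" for j i
  have "finite J" using fin by (simp add: J_def)
  moreover have "card J < card {..<2 * l + 1}"
    using fin A card by (simp add: J_def card_Plus)
  ultimately obtain a where a: "\<exists>i\<in>{..<2 * l + 1}. a i \<noteq> 0"
    "\<forall>j\<in>J. (\<Sum>i<2 * l + 1. a i * x j i) = 0"
    using homogeneous_system_nontrivial[of J "{..<2 * l + 1}" x] by blast
  let ?s = "\<lambda>y. \<Sum>i<2 * l + 1. a i * y i"
  have sd: "?s (\<lambda>i. y i - z i) = ?s y - ?s z" for y z :: "nat \<Rightarrow> real"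
    by (simp add: right_diff_distrib sum_subtractf)
  have VA: "?s (V U) = ?s (V A)" if "U \<in> E" for U
  proof (cases "U = A")
    case False
    then have "Inl U \<in> J" using that by (auto simp: J_def)
    then have "?s (\<lambda>i. V U i - V A i) = 0" using a(2) by (fastforce simp: x_def)
    then show ?thesis using sd[of "V U" "V A"] by simp
  qed simp
  have VA': "?s (V' U) = ?s (V' A')" if "U \<in> E'" for U
  proof (cases "U = A'")
    case False
    then have "Inr U \<in> J" using that by (auto simp: J_def)
    then have "?s (\<lambda>i. V' U i - V' A' i) = 0" using a(2) by (fastforce simp: x_def)
    then show ?thesis using sd[of "V' U" "V' A'"] by simp
  qed simp
  have comb: "?s (\<lambda>i. \<Sum>U\<in>B. w U * Y U i) = (\<Sum>U\<in>B. w U * ?s (Y U))" for B and w :: "'c \<Rightarrow> real" and Y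
    by (simp add: sum_distrib_left sum.swap[of _ B] algebra_simps)
  have comb': "?s (\<lambda>i. \<Sum>U\<in>B. w U * Y U i) = (\<Sum>U\<in>B. w U * ?s (Y U))" for B and w :: "'d \<Rightarrow> real" and Y
    by (simp add: sum_distrib_left sum.swap[of _ B] algebra_simps)
  have "?s (\<lambda>i. (\<Sum>U\<in>E'. w' U * V' U i) - (\<Sum>U\<in>E. w U * V U i)) = ?s (V' A') - ?s (V A)"
    if "sum w E = 1" "sum w' E' = 1" for w w'
  proof -
    have "?s (\<lambda>i. \<Sum>U\<in>E. w U * V U i) = (\<Sum>U\<in>E. w U * ?s (V A))"
      unfolding comb using VA by (intro sum.cong) auto
    also have "\<dots> = ?s (V A)" using that(1) by (simp add: sum_distrib_right[symmetric])
    finally have 1: "?s (\<lambda>i. \<Sum>U\<in>E. w U * V U i) = ?s (V A)" .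
    have "?s (\<lambda>i. \<Sum>U\<in>E'. w' U * V' U i) = (\<Sum>U\<in>E'. w' U * ?s (V' A'))"
      unfolding comb' using VA' by (intro sum.cong) auto
    also have "\<dots> = ?s (V' A')" using that(2) by (simp add: sum_distrib_right[symmetric])
    finally show ?thesis using 1 by (simp only: sd)
  qed
  then show ?thesis using a(1) by (intro exI[of _ a] exI[of _ "?s (V' A') - ?s (V A)"]) auto
qed

text \<open>A coincidence after translation by the vector with entries \<open>s ^ Suc i\<close>
  would put that vector on the hyperplane belonging to \<open>(E, E')\<close>. This is a nontrivial
  polynomial equation in \<open>s\<close>, and there are finitely many pairs. The exponents start at
  1 so that a small \<open>s\<close> gives a small translation.\<close>

lemma moment_curve_translation:
  fixes V :: "'u \<Rightarrow> nat \<Rightarrow> real" and V' :: "'w \<Rightarrow> nat \<Rightarrow> real"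
  assumes fin: "finite C" "finite C'" and "e > 0"
  shows "\<exists>s>0. s < e \<and> (\<forall>E E' w w'. E \<subseteq> C \<longrightarrow> E' \<subseteq> C' \<longrightarrow> card E \<le> Suc l \<longrightarrow> card E' \<le> Suc l \<longrightarrow>
     sum w E = 1 \<longrightarrow> sum w' E' = 1 \<longrightarrow>
     (\<exists>i<2 * l + 1. (\<Sum>U\<in>E. w U * V U i) + s ^ Suc i \<noteq> (\<Sum>U\<in>E'. w' U * V' U i)))"
proof -
  define X where "X = {(E, E'). E \<subseteq> C \<and> E' \<subseteq> C' \<and> E \<noteq> {} \<and> E' \<noteq> {} \<and> card E \<le> Suc l \<and> card E' \<le> Suc l}"
  have "finite X" by (rule finite_subset[of _ "Pow C \<times> Pow C'"]) (use fin in \<open>auto simp: X_def\<close>)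
  define hyp where "hyp x y \<longleftrightarrow> (\<exists>i<2 * l + 1. fst y i \<noteq> 0) \<and>
      (\<forall>w w'. sum w (fst x) = 1 \<longrightarrow> sum w' (snd x) = 1 \<longrightarrow>
        (\<Sum>i<2 * l + 1. fst y i * ((\<Sum>U\<in>snd x. w' U * V' U i) - (\<Sum>U\<in>fst x. w U * V U i))) = snd y)"
    for x and y :: "(nat \<Rightarrow> real) \<times> real"
  have "\<exists>y. hyp x y" if x: "x \<in> X" for x
  proof -
    have "finite (fst x)" "finite (snd x)" "fst x \<noteq> {}" "snd x \<noteq> {}" "card (fst x) \<le> Suc l" "card (snd x) \<le> Suc l"
      using x finite_subset[OF _ fin(1)] finite_subset[OF _ fin(2)] by (auto simp: X_def)
    from affine_combinations_in_hyperplane[OF this, of V' V] show ?thesis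
      unfolding hyp_def by simp
  qed
  then obtain y where y: "\<And>x. x \<in> X \<Longrightarrow> hyp x (y x)" by metis
  define a where "a x = fst (y x)" for x
  define \<beta> where "\<beta> x = snd (y x)" for x
  have a: "\<exists>i<2 * l + 1. a x i \<noteq> 0" if "x \<in> X" for x
    using y[OF that] unfolding hyp_def a_def by blast
  have \<beta>: "(\<Sum>i<2 * l + 1. a x i * ((\<Sum>U\<in>snd x. w' U * V' U i) - (\<Sum>U\<in>fst x. w U * V U i))) = \<beta> x"
    if "x \<in> X" "sum w (fst x) = 1" "sum w' (snd x) = 1" for x w w'
    using y[OF that(1)] that(2,3) unfolding hyp_def a_def \<beta>_def by blast
  define B where "B x = {s. (\<Sum>i<2 * l + 1. a x i * s ^ Suc i) = \<beta> x}" for x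
  have "finite (B x)" if x: "x \<in> X" for x
  proof -
    \<comment> \<open>The constant coefficient is \<open>- \<beta> x\<close>; a nonzero
      \<open>a x i\<close> sits at degree \<open>i + 1\<close>, so the polynomial is nonzero
      whatever \<open>\<beta> x\<close> is.\<close>
    define c where "c i = (case i of 0 \<Rightarrow> - \<beta> x | Suc i \<Rightarrow> a x i)" for i
    obtain i where i: "i < 2 * l + 1" "a x i \<noteq> 0" using a[OF x] by blast
    then have "c (Suc i) \<noteq> 0" "Suc i \<le> 2 * l + 1" by (auto simp: c_def)
    then have "finite {s. (\<Sum>i\<le>2 * l + 1. c i * s ^ i) = 0}" by (rule polyfun_roots_finite)
    moreover have "(\<Sum>i\<le>2 * l + 1. c i * s ^ i) = (\<Sum>i<2 * l + 1. a x i * s ^ Suc i) - \<beta> x" for s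
      by (simp only: sum.atMost_shift) (simp add: c_def)
    ultimately show ?thesis unfolding B_def by simp
  qed
  then have "finite (\<Union>x\<in>X. B x)" using \<open>finite X\<close> by blast
  moreover have "infinite {0<..<e}" using \<open>e > 0\<close> by simp
  ultimately obtain s where s: "s \<in> {0<..<e}" "s \<notin> (\<Union>x\<in>X. B x)"
    by (meson finite_subset subsetI)
  show ?thesis
  proof (intro exI[of _ s] conjI allI impI)
    show "0 < s" "s < e" using s(1) by auto
    fix E E' and w :: "'u \<Rightarrow> real" and w' :: "'w \<Rightarrow> real"
    assume EE: "E \<subseteq> C" "E' \<subseteq> C'" "card E \<le> Suc l" "card E' \<le> Suc l" and w: "sum w E = 1" "sum w' E' = 1"
    \<comment> \<open>A sum equal to 1 excludes empty \<open>E\<close> and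
      \<open>E'\<close>.\<close>
    then have x: "(E, E') \<in> X" by (auto simp: X_def)
    show "\<exists>i<2 * l + 1. (\<Sum>U\<in>E. w U * V U i) + s ^ Suc i \<noteq> (\<Sum>U\<in>E'. w' U * V' U i)"
    proof (rule ccontr)
      assume "\<not> ?thesis"
      then have "(\<Sum>U\<in>E'. w' U * V' U i) - (\<Sum>U\<in>E. w U * V U i) = s ^ Suc i" if "i < 2 * l + 1" for i
        using that by (metis add_diff_cancel_left')
      then have "(\<Sum>i<2 * l + 1. a (E, E') i * s ^ Suc i) = \<beta> (E, E')"
        using \<beta>[OF x, of w w'] w by simp
      then show False using s(2) x by (auto simp: B_def)
    qed
  qed
qed

subsection \<open>Coincidences in the first factor\<close>

text \<open>Where more than \<open>l\<close> scaled forms are integral, \<open>l + 1\<close> of them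
  put the point on a graph. The forms are bounded on the cube, so only finitely many choices of
  forms and integer levels occur, and their graphs can be cleared together.\<close>

lemma generic_small_coincidence:
  assumes LC: "LC d (mtopology_of M)" "m + k \<le> d" and nk: "n - k = Suc l"
    and DD: "DD_property_metric m n k M"
    and f: "continuous_map (top_of_set (unit_cube_set m \<times> unit_cube_set n)) (mtopology_of M) f"
    and g: "continuous_map (top_of_set (unit_cube_set m \<times> unit_cube_set n)) (mtopology_of M) g"
    and "\<epsilon> > 0" "K > 0"
  defines "few \<equiv> \<lambda>p. card {j. j < m + n \<and> K * moment_form m n k (real j) p \<in> \<int>} \<le> l"
  shows "\<exists>f' g'. continuous_map (top_of_set (unit_cube_set m \<times> unit_cube_set n)) (mtopology_of M) f' \<and>
    continuous_map (top_of_set (unit_cube_set m \<times> unit_cube_set n)) (mtopology_of M) g' \<and>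
    (\<forall>p \<in> unit_cube_set m \<times> unit_cube_set n. mdist M (f p) (f' p) < \<epsilon>) \<and>
    (\<forall>p \<in> unit_cube_set m \<times> unit_cube_set n. mdist M (g p) (g' p) < \<epsilon>) \<and>
    (\<forall>p \<in> unit_cube_set m \<times> unit_cube_set n. \<forall>q \<in> unit_cube_set m \<times> unit_cube_set n.
       fst p = fst q \<longrightarrow> f' p = g' q \<longrightarrow> few p \<and> few q)"
proof -
  let ?W = "unit_cube_set m \<times> unit_cube_set n"
  have kn: "k \<le> n" using nk by simp
  have W: "compact ?W" by (simp add: compact_Times compact_unit_cube_set)
  define v where "v j p = K * moment_form m n k (real j) p" for j p
  have vc: "continuous_on ?W (v j)" for j
    unfolding v_def by (intro continuous_on_mult continuous_on_const continuous_on_moment_form)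
  have "\<exists>R. \<forall>p\<in>?W. \<bar>v j p\<bar> \<le> R" for j
    using compact_imp_bounded[OF compact_continuous_image[OF vc W, of j]] unfolding bounded_iff by auto
  then obtain R where R: "\<And>j p. p \<in> ?W \<Longrightarrow> \<bar>v j p\<bar> \<le> R j" by metis
  define X where "X = {J. J \<subseteq> {..<m + n} \<and> card J = Suc l} \<times> PiE {..<m + n} (\<lambda>j. {- \<lceil>R j\<rceil>..\<lceil>R j\<rceil>})"
  have X: "finite X" unfolding X_def by (auto intro: finite_PiE)
  define good where "good x \<alpha> \<longleftrightarrow> continuous_on (unit_cube_set m \<times> unit_cube_set k) \<alpha> \<and>
      (\<forall>p\<in>?W. (\<forall>j\<in>fst x. v j p = of_int (snd x j)) \<longrightarrow> p \<in> graph_set m n k \<alpha>)"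
    for x :: "nat set \<times> (nat \<Rightarrow> int)" and \<alpha>
  have "\<exists>\<alpha>. good x \<alpha>" if x: "x \<in> X" for x
  proof -
    have J: "finite (fst x)" "card (fst x) = n - k"
      using x nk by (auto simp: X_def intro: finite_subset)
    then have "finite (real ` fst x)" "card (real ` fst x) = n - k" by (auto simp: card_image)
    \<comment> \<open>The nodes are \<open>real j\<close>, so \<open>nat \<lfloor>t\<rfloor>\<close>
      recovers the index \<open>j\<close> of the level.\<close>
    then obtain \<alpha> where \<alpha>: "continuous_on (unit_cube_set m \<times> unit_cube_set k) \<alpha>"
      "\<And>p. p \<in> ?W \<Longrightarrow> (\<And>t. t \<in> real ` fst x \<Longrightarrow> moment_form m n k t p = of_int (snd x (nat \<lfloor>t\<rfloor>)) / K)
        \<Longrightarrow> p \<in> graph_set m n k \<alpha>"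
      using moment_form_levels_in_graph[OF _ _ kn, where c = "\<lambda>t. of_int (snd x (nat \<lfloor>t\<rfloor>)) / K"] by metis
    have "p \<in> graph_set m n k \<alpha>" if "p \<in> ?W" "\<forall>j\<in>fst x. v j p = of_int (snd x j)" for p
    proof (rule \<alpha>(2)[OF that(1)])
      fix t assume "t \<in> real ` fst x"
      then show "moment_form m n k t p = of_int (snd x (nat \<lfloor>t\<rfloor>)) / K"
        using that(2) \<open>K > 0\<close> by (auto simp: v_def field_simps)
    qed
    then show ?thesis using \<alpha>(1) unfolding good_def by blast
  qed
  then obtain \<alpha> where \<alpha>: "\<And>x. x \<in> X \<Longrightarrow> good x (\<alpha> x)" by metis
  define S where "S x = same_fibre n (graph_set m n k (\<alpha> x))" for x
  have S: "generic_avoidance M ?W (S x)" "compact (S x)" "S x \<subseteq> ?W \<times> ?W" if "x \<in> X" for x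
  proof -
    have c: "continuous_on (unit_cube_set m \<times> unit_cube_set k) (\<alpha> x)"
      using \<alpha>[OF that] unfolding good_def by blast
    show "generic_avoidance M ?W (S x)"
      unfolding S_def by (rule generic_avoidance_same_fibre_graph[OF LC kn DD c])
    show "compact (S x)"
      unfolding S_def by (rule compact_same_fibre[OF compact_graph_set[OF c kn]])
    show "S x \<subseteq> ?W \<times> ?W"
      unfolding S_def same_fibre_def graph_set_def by (auto simp: mem_Times_iff)
  qed
  have S': "generic_avoidance M ?W ((S x)\<inverse>)" "compact ((S x)\<inverse>)" "(S x)\<inverse> \<subseteq> ?W \<times> ?W" if "x \<in> X" for x
  proof -
    show "generic_avoidance M ?W ((S x)\<inverse>)" by (rule generic_avoidance_converse[OF S(1)[OF that]])
    have "(S x)\<inverse> = prod.swap ` S x" by force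
    moreover have "continuous_on (S x) prod.swap"
      unfolding prod.swap_def by (intro continuous_on_Pair continuous_on_fst continuous_on_snd continuous_on_id)
    ultimately show "compact ((S x)\<inverse>)" using S(2)[OF that] compact_continuous_image by metis
    show "(S x)\<inverse> \<subseteq> ?W \<times> ?W" using S(3)[OF that] by blast
  qed
  \<comment> \<open>For a coincidence \<open>f' p = g' q\<close>, the set \<open>S x\<close> keeps
    \<open>q\<close> off the graph and its converse keeps \<open>p\<close> off it.\<close>
  have "generic_avoidance M ?W (\<Union> (S ` X \<union> (\<lambda>x. (S x)\<inverse>) ` X))"
  proof (rule generic_avoidance_Union)
    show "finite (S ` X \<union> (\<lambda>x. (S x)\<inverse>) ` X)" using X by simp
    show "generic_avoidance M ?W C \<and> compact C \<and> C \<subseteq> ?W \<times> ?W" if "C \<in> S ` X \<union> (\<lambda>x. (S x)\<inverse>) ` X" for C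
      using that S S' by blast
  qed
  from this[unfolded generic_avoidance_def, rule_format, OF f g \<open>\<epsilon> > 0\<close>]
  obtain f' g' where fg': "continuous_map (top_of_set ?W) (mtopology_of M) f'"
    "continuous_map (top_of_set ?W) (mtopology_of M) g'"
    "\<forall>p\<in>?W. mdist M (f p) (f' p) < \<epsilon>" "\<forall>p\<in>?W. mdist M (g p) (g' p) < \<epsilon>"
    and av: "\<forall>(p, q)\<in>\<Union> (S ` X \<union> (\<lambda>x. (S x)\<inverse>) ` X). f' p \<noteq> g' q"
    by blast
  have many: "\<exists>x\<in>X. p \<in> graph_set m n k (\<alpha> x)" if p: "p \<in> ?W" "\<not> few p" for p
  proof -
    have "Suc l \<le> card {j. j < m + n \<and> v j p \<in> \<int>}" using p(2) by (simp add: few_def v_def)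
    then obtain J where J: "J \<subseteq> {j. j < m + n \<and> v j p \<in> \<int>}" "card J = Suc l"
      by (rule obtain_subset_with_card_n)
    define c where "c = (\<lambda>j\<in>{..<m + n}. \<lfloor>v j p\<rfloor>)"
    have "\<lfloor>v j p\<rfloor> \<in> {- \<lceil>R j\<rceil>..\<lceil>R j\<rceil>}" for j
    proof -
      have "- R j \<le> v j p" "v j p \<le> R j" using R[OF p(1), of j] by auto
      then show ?thesis by simp linarith
    qed
    then have x: "(J, c) \<in> X" using J unfolding X_def c_def by auto
    have "v j p = of_int (c j)" if "j \<in> J" for j
      using J(1) that by (auto simp: c_def elim!: Ints_cases)
    then have "p \<in> graph_set m n k (\<alpha> (J, c))"
      using \<alpha>[OF x] p(1) unfolding good_def fst_conv snd_conv by blast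
    then show ?thesis using x by blast
  qed
  have "few p \<and> few q" if pq: "p \<in> ?W" "q \<in> ?W" "fst p = fst q" "f' p = g' q" for p q
  proof (intro conjI; rule ccontr)
    assume "\<not> few p"
    then obtain x where x: "x \<in> X" "p \<in> graph_set m n k (\<alpha> x)" using many pq(1) by blast
    have "snd q \<in> unit_cube_set n" using pq(2) by (simp add: mem_Times_iff)
    then have "(p, q) \<in> (S x)\<inverse>" using x(2) pq(3) by (simp add: S_def same_fibre_def)
    then show False using av x(1) pq(4) by blast
  next
    assume "\<not> few q"
    then obtain x where x: "x \<in> X" "q \<in> graph_set m n k (\<alpha> x)" using many pq(2) by blast
    have "snd p \<in> unit_cube_set n" using pq(1) by (simp add: mem_Times_iff)
    then have "(p, q) \<in> S x" using x(2) pq(3) by (simp add: S_def same_fibre_def)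
    then show False using av x(1) pq(4) by blast
  qed
  then show ?thesis using fg' by blast
qed

section \<open>Moduli, distances and extensions for the Euclidean components\<close>

lemma coordinatewise_oscillation:
  fixes W :: "'b::t2_space set" and h :: "'b \<Rightarrow> nat \<Rightarrow> real" and G :: "'b \<times> 'b \<Rightarrow> real"
  assumes W: "compact W" and h: "\<And>i. continuous_on W (\<lambda>p. h p i)" and h0: "\<And>p i. p \<in> W \<Longrightarrow> N \<le> i \<Longrightarrow> h p i = 0"
    and G: "continuous_on (W \<times> W) G" "\<And>x y. x \<in> W \<Longrightarrow> y \<in> W \<Longrightarrow> x \<noteq> y \<Longrightarrow> 0 < G (x, y)"
    and "\<epsilon> > 0"
  shows "\<exists>\<eta>>0. \<forall>p\<in>W. \<forall>q\<in>W. G (p, q) < \<eta> \<longrightarrow> (\<forall>i. \<bar>h p i - h q i\<bar> \<le> \<epsilon>)"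
proof -
  have "\<exists>\<eta>>0. \<forall>p\<in>W. \<forall>q\<in>W. G (p, q) < \<eta> \<longrightarrow> \<bar>h p i - h q i\<bar> \<le> \<epsilon>" for i
  proof -
    have c: "continuous_map (top_of_set W) (mtopology_of euclidean_metric) (\<lambda>p. h p i)"
      using h by simp
    obtain \<eta> where "\<eta> > 0" "\<And>x y. x \<in> W \<Longrightarrow> y \<in> W \<Longrightarrow> G (x, y) < \<eta> \<Longrightarrow> mdist euclidean_metric (h x i) (h y i) < \<epsilon>"
      using uniformly_close[OF W c \<open>\<epsilon> > 0\<close> G] by metis
    then show ?thesis by (intro exI[of _ \<eta>]) (auto simp: dist_real_def intro: less_imp_le)
  qed
  then obtain \<eta> where \<eta>: "\<And>i. \<eta> i > 0" "\<And>i p q. p \<in> W \<Longrightarrow> q \<in> W \<Longrightarrow> G (p, q) < \<eta> i \<Longrightarrow> \<bar>h p i - h q i\<bar> \<le> \<epsilon>"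
    by metis
  define e where "e = Min (insert 1 (\<eta> ` {..<N}))"
  have "e > 0" unfolding e_def using \<eta>(1) by (subst Min_gr_iff) auto
  moreover have "\<bar>h p i - h q i\<bar> \<le> \<epsilon>" if "p \<in> W" "q \<in> W" "G (p, q) < e" for p q i
  proof (cases "i < N")
    case True
    then have "e \<le> \<eta> i" unfolding e_def by (intro Min_le) auto
    then show ?thesis using \<eta>(2) that by (meson order_less_le_trans)
  next
    case False then show ?thesis using h0[of p i] h0[of q i] that \<open>\<epsilon> > 0\<close> by simp
  qed
  ultimately show ?thesis by blast
qed

text \<open>The metric on functions sums truncated coordinate distances with the weights
  \<open>(1/2) ^ n\<close>, whose total is 2.\<close>

lemma dist_fun_le:
  fixes x y :: "nat \<Rightarrow> real"
  assumes "\<And>i. \<bar>x i - y i\<bar> \<le> e"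
  shows "dist x y \<le> 2 * e"
proof -
  have s: "summable (\<lambda>n. (1/2::real) ^ n)" by (simp add: summable_geometric_iff)
  have "dist x y \<le> (\<Sum>n. (1/2) ^ n * e)"
    unfolding dist_fun_def
  proof (rule suminf_le)
    show "(1/2) ^ n * min (dist (x (from_nat n)) (y (from_nat n))) 1 \<le> (1/2) ^ n * e" for n
      using assms by (intro mult_left_mono) (auto simp: dist_real_def min_le_iff_disj)
    show "summable (\<lambda>n. (1/2) ^ n * min (dist (x (from_nat n)) (y (from_nat n))) 1)"
      by (rule summable_comparison_test'[OF s]) auto
    show "summable (\<lambda>n. (1/2) ^ n * e)" using s by (rule summable_mult2)
  qed
  also have "\<dots> = 2 * e" using s suminf_geometric[of "1/2::real"] by (simp add: suminf_mult2[symmetric])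
  finally show ?thesis .
qed

text \<open>Tietze is applied to the difference of \<open>F\<close> and \<open>h\<close> rather than
  to \<open>F\<close>: its bound \<open>e\<close> survives the extension, which keeps
  \<open>H\<close> close to \<open>h\<close> on all of \<open>W\<close>.\<close>

lemma extend_coordinatewise:
  fixes P W :: "'b::{metric_space,second_countable_topology} set" and h :: "'b \<Rightarrow> nat \<Rightarrow> real"
  assumes "compact P" "P \<subseteq> W" and h: "\<And>i. continuous_on W (\<lambda>p. h p i)"
    and F: "\<And>i. continuous_on P (\<lambda>p. F p i)" and "0 \<le> e" and cl: "\<And>p i. p \<in> P \<Longrightarrow> \<bar>F p i - h p i\<bar> \<le> e"
  shows "\<exists>H. (\<forall>i. continuous_on W (\<lambda>p. H p i)) \<and> (\<forall>p\<in>P. \<forall>i. H p i = F p i) \<and>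
    (\<forall>p\<in>W. \<forall>i. \<bar>h p i - H p i\<bar> \<le> e)"
proof -
  have "\<exists>a. continuous_on W a \<and> (\<forall>p\<in>P. a p = F p i - h p i) \<and> (\<forall>p\<in>W. \<bar>a p\<bar> \<le> e)" for i
  proof -
    have "continuous_on P (\<lambda>p. F p i - h p i)"
      by (intro continuous_on_diff F continuous_on_subset[OF h \<open>P \<subseteq> W\<close>])
    moreover have "closedin (top_of_set W) P"
      using assms(1,2) by (intro closed_subset compact_imp_closed)
    ultimately obtain a where "continuous_on W a" "\<And>p. p \<in> P \<Longrightarrow> a p = F p i - h p i"
      "\<And>p. p \<in> W \<Longrightarrow> norm (a p) \<le> e"
      by (rule Tietze[of P "\<lambda>p. F p i - h p i" W e]) (use \<open>0 \<le> e\<close> cl in auto)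
    then show ?thesis by auto
  qed
  then obtain a where a: "\<And>i. continuous_on W (a i)" "\<And>i p. p \<in> P \<Longrightarrow> a i p = F p i - h p i"
    "\<And>i p. p \<in> W \<Longrightarrow> \<bar>a i p\<bar> \<le> e" by metis
  then show ?thesis
    using h by (intro exI[of _ "\<lambda>p i. h p i + a i p"]) (auto intro: continuous_on_add)
qed

theorem proposition1p4:
  fixes m n k l :: nat and M :: "'a metric"
  assumes "k + 1 \<le> n" and "l = n - k - 1"
    and "mcomplete_of M" and "separable_space (mtopology_of M)"
    and "LC (2 * m + n - 1) (mtopology_of M)"
    and "DD_property m n k (mtopology_of M)"
  shows "DD_property m n n (prod_topology (mtopology_of M) (Euclidean_space (2 * l + 1)))"
proof -
  let ?N = "2 * l + 1" and ?W = "unit_cube_set m \<times> unit_cube_set n"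
  let ?E = "topspace (Euclidean_space ?N)"
  \<comment> \<open>By \<open>DD_property_iff_metric\<close> any metric for the product topology
    will do; this one is bounded by the sum of the distances in the factors.\<close>
  define D where "D = prod_metric M (submetric euclidean_metric ?E)"
  have topD: "mtopology_of D = prod_topology (mtopology_of M) (Euclidean_space ?N)"
    unfolding D_def mtopology_of_prod_metric mtopology_of_submetric mtopology_of_euclidean
    by (simp only: Euclidean_space_eq_top_of_set[symmetric])
  have nk: "n - k = Suc l" and kn: "k \<le> n" using assms(1,2) by auto
  have mk: "m + k \<le> 2 * m + n - 1" using assms(1) by simp
  have DDM: "DD_property_metric m n k M" using assms(6) DD_property_iff_metric by blast
  have W: "compact ?W" by (simp add: compact_Times compact_unit_cube_set)
  define u where "u j p = moment_form m n k (real j) p" for j p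
  \<comment> \<open>Nearness is measured by the same forms whose integral levels make up the grid,
    so that a fine grid has cells that are small for \<open>G\<close>.\<close>
  define G where "G c = (\<Sum>j<m + n. \<bar>u j (fst c) - u j (snd c)\<bar>)" for c
  have uc: "continuous_on S (u j)" for S j
    unfolding u_def by (rule continuous_on_moment_form)
  have Gc: "continuous_on (?W \<times> ?W) G"
    unfolding G_def
    by (intro continuous_on_sum continuous_on_rabs continuous_on_diff
        continuous_on_compose2[OF uc[of UNIV]] continuous_on_fst continuous_on_snd continuous_on_id) auto
  have G0: "0 < G (p, q)" if pq: "p \<in> ?W" "q \<in> ?W" "p \<noteq> q" for p q
  proof -
    have "G (p, q) \<noteq> 0"
    proof
      assume "G (p, q) = 0"
      then have "\<forall>j<m + n. u j p = u j q" unfolding G_def by (simp add: sum_nonneg_eq_0_iff)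
      then have "moment_form m n k t p = moment_form m n k t q" if "t \<in> real ` {..<m + n}" for t
        using that by (auto simp: u_def)
      then have "p = q"
        using moment_form_separates[of "real ` {..<m + n}" m n k p q] kn pq by (simp add: card_image)
      then show False using pq(3) by simp
    qed
    moreover have "0 \<le> G (p, q)" unfolding G_def by (simp add: sum_nonneg)
    ultimately show ?thesis by simp
  qed
  have "DD_property_metric m n n D"
    unfolding DD_property_metric_def prod_unit_cube_eq_top_of_set
  proof (intro allI impI, elim conjE)
    fix f g and \<epsilon> :: real
    assume f: "continuous_map (top_of_set ?W) (mtopology_of D) f"
      and g: "continuous_map (top_of_set ?W) (mtopology_of D) g" and "0 < \<epsilon>"
    have comp: "continuous_map (top_of_set ?W) (mtopology_of M) (\<lambda>p. fst (h p))"
      "continuous_on ?W (\<lambda>p. snd (h p) i)" "p \<in> ?W \<Longrightarrow> ?N \<le> i \<Longrightarrow> snd (h p) i = 0"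
      "p \<in> ?W \<Longrightarrow> fst (h p) \<in> mspace M \<and> snd (h p) \<in> ?E"
      if h: "continuous_map (top_of_set ?W) (mtopology_of D) h" for h i p
    proof -
      have h1: "continuous_map (top_of_set ?W) (mtopology_of M) (\<lambda>p. fst (h p))"
        and h2: "continuous_map (top_of_set ?W) (top_of_set ?E) (\<lambda>p. snd (h p))"
        using h unfolding topD continuous_map_pairwise o_def Euclidean_space_eq_top_of_set[symmetric] by auto
      show "continuous_map (top_of_set ?W) (mtopology_of M) (\<lambda>p. fst (h p))" by (rule h1)
      show "continuous_on ?W (\<lambda>p. snd (h p) i)"
        using h2 by (intro continuous_on_apply) simp
      show mem: "fst (h p) \<in> mspace M \<and> snd (h p) \<in> ?E" if "p \<in> ?W"
        using continuous_map_to_mspace[OF h1 that] continuous_map_image_subset_topspace[OF h2] that by auto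
      show "snd (h p) i = 0" if "p \<in> ?W" "?N \<le> i"
        using mem[OF that(1)] that(2) by (simp add: topspace_Euclidean_space)
    qed
    \<comment> \<open>The new Euclidean components are within \<open>2 * \<zeta>\<close> in each
      coordinate, which \<open>dist_fun_le\<close> turns into \<open>4 * \<zeta>\<close>, less than
      the \<open>\<epsilon> / 2\<close> allotted to this factor.\<close>
    define \<zeta> where "\<zeta> = \<epsilon> / 10"
    have "\<zeta> > 0" using \<open>0 < \<epsilon>\<close> by (simp add: \<zeta>_def)
    have osc: "\<exists>\<eta>>0. \<forall>p\<in>?W. \<forall>q\<in>?W. G (p, q) < \<eta> \<longrightarrow> (\<forall>i. \<bar>snd (h p) i - snd (h q) i\<bar> \<le> \<zeta>)"
      if h: "continuous_map (top_of_set ?W) (mtopology_of D) h" for h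
      by (rule coordinatewise_oscillation[OF W, where N = ?N]) (fact comp[OF h] Gc G0 \<open>\<zeta> > 0\<close>)+
    obtain \<eta>1 where \<eta>1: "\<eta>1 > 0" "\<forall>p\<in>?W. \<forall>q\<in>?W. G (p, q) < \<eta>1 \<longrightarrow> (\<forall>i. \<bar>snd (f p) i - snd (f q) i\<bar> \<le> \<zeta>)"
      using osc[OF f] by blast
    obtain \<eta>2 where \<eta>2: "\<eta>2 > 0" "\<forall>p\<in>?W. \<forall>q\<in>?W. G (p, q) < \<eta>2 \<longrightarrow> (\<forall>i. \<bar>snd (g p) i - snd (g q) i\<bar> \<le> \<zeta>)"
      using osc[OF g] by blast
    define \<eta> where "\<eta> = min \<eta>1 \<eta>2"
    have "\<eta> > 0" using \<eta>1 \<eta>2 by (simp add: \<eta>_def)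
    \<comment> \<open>Changes of at most 2 in all scaled forms add up to at most
      \<open>2 * (m + n) / K\<close> in \<open>G\<close>, which is less than
      \<open>\<eta>\<close>.\<close>
    define K where "K = 2 * (real (m + n) + 1) / \<eta>"
    have "K > 0" using \<open>\<eta> > 0\<close> by (simp add: K_def)
    define v where "v j p = K * u j p" for j p
    have vc: "continuous_on UNIV (v j)" for j
      unfolding v_def by (intro continuous_on_mult continuous_on_const uc)
    have small: "G (p, q) < \<eta>" if "\<And>j. j < m + n \<Longrightarrow> \<bar>v j p - v j q\<bar> \<le> 2" for p q
    proof -
      have "\<bar>u j p - u j q\<bar> \<le> 2 / K" if "j < m + n" for j
      proof -
        have "K * \<bar>u j p - u j q\<bar> = \<bar>v j p - v j q\<bar>"
          using \<open>K > 0\<close> by (simp add: v_def right_diff_distrib[symmetric] abs_mult)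
        then show ?thesis using \<open>\<And>j. j < m + n \<Longrightarrow> \<bar>v j p - v j q\<bar> \<le> 2\<close>[OF that] \<open>K > 0\<close>
          by (simp add: field_simps)
      qed
      then have "G (p, q) \<le> real (card {..<m + n}) * (2 / K)"
        unfolding G_def by (intro sum_bounded_above) auto
      also have "\<dots> < \<eta>" using \<open>\<eta> > 0\<close> by (simp add: K_def field_simps)
      finally show ?thesis .
    qed
    have "\<epsilon> / 2 > 0" using \<open>0 < \<epsilon>\<close> by simp
    from generic_small_coincidence[OF assms(5) mk nk DDM comp(1)[OF f] comp(1)[OF g] this \<open>K > 0\<close>]
    obtain f1 g1 where f1: "continuous_map (top_of_set ?W) (mtopology_of M) f1"
      and g1: "continuous_map (top_of_set ?W) (mtopology_of M) g1"
      and f1cl: "\<forall>p\<in>?W. mdist M (fst (f p)) (f1 p) < \<epsilon> / 2"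
      and g1cl: "\<forall>p\<in>?W. mdist M (fst (g p)) (g1 p) < \<epsilon> / 2"
      and few: "\<forall>p\<in>?W. \<forall>q\<in>?W. fst p = fst q \<longrightarrow> f1 p = g1 q \<longrightarrow>
        card {j. j < m + n \<and> v j p \<in> \<int>} \<le> l \<and> card {j. j < m + n \<and> v j q \<in> \<int>} \<le> l"
      unfolding v_def u_def by blast
    \<comment> \<open>Fibrewise coincidences of the components in \<open>M\<close>; the Euclidean
      components have to be separated only on the projections \<open>P\<close> and
      \<open>Q\<close>.\<close>
    define Z where "Z = (?W \<times> ?W) \<inter> {c. fst (fst c) = fst (snd c)} \<inter> {c. f1 (fst c) = g1 (snd c)}"
    have "compact Z"
    proof -
      let ?d = "\<lambda>c. mdist M (f1 (fst c)) (g1 (snd c))"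
      have "continuous_map (top_of_set (?W \<times> ?W)) (mtopology_of M) (\<lambda>c. f1 (fst c))"
        "continuous_map (top_of_set (?W \<times> ?W)) (mtopology_of M) (\<lambda>c. g1 (snd c))"
        by (auto intro!: continuous_map_compose_on[OF f1] continuous_map_compose_on[OF g1]
            continuous_on_fst continuous_on_snd continuous_on_id)
      then have "continuous_on (?W \<times> ?W) ?d"
        using continuous_map_mdist[of "top_of_set (?W \<times> ?W)" M] by simp
      then have "closedin (top_of_set (?W \<times> ?W)) ((?W \<times> ?W) \<inter> ?d -` {0})"
        by (rule continuous_closedin_preimage) simp
      moreover have "compact (?W \<times> ?W)" using W by (simp add: compact_Times)
      ultimately have "compact ((?W \<times> ?W) \<inter> ?d -` {0})" using closedin_compact by blast
      moreover have "closed {c :: ((nat \<Rightarrow> real) \<times> (nat \<Rightarrow> real)) \<times> ((nat \<Rightarrow> real) \<times> (nat \<Rightarrow> real)). fst (fst c) = fst (snd c)}"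
        by (intro closed_Collect_eq continuous_on_fst continuous_on_snd continuous_on_id)
      ultimately have "compact ((?W \<times> ?W) \<inter> ?d -` {0} \<inter> {c. fst (fst c) = fst (snd c)})"
        by (rule compact_Int_closed)
      moreover have "?d c = 0 \<longleftrightarrow> f1 (fst c) = g1 (snd c)" if "c \<in> ?W \<times> ?W" for c
        using that continuous_map_to_mspace[OF f1, of "fst c"] continuous_map_to_mspace[OF g1, of "snd c"]
        by (intro mdist_zero) (auto simp: mem_Times_iff)
      then have "(?W \<times> ?W) \<inter> ?d -` {0} \<inter> {c. fst (fst c) = fst (snd c)} = Z"
        unfolding Z_def by blast
      ultimately show ?thesis by simp
    qed
    define P where "P = fst ` Z"
    define Q where "Q = snd ` Z"
    have P: "compact P" and Q: "compact Q"
      unfolding P_def Q_def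
      by (rule compact_continuous_image[OF _ \<open>compact Z\<close>],
          intro continuous_on_fst continuous_on_snd continuous_on_id)+
    have ZW: "fst c \<in> ?W \<and> snd c \<in> ?W" if "c \<in> Z" for c
    proof -
      have "c \<in> ?W \<times> ?W" using that unfolding Z_def by blast
      then show ?thesis by (rule mem_Times_iff[THEN iffD1])
    qed
    have PW: "P \<subseteq> ?W" and QW: "Q \<subseteq> ?W"
      unfolding P_def Q_def using ZW by (simp_all only: image_subset_iff) blast+
    have Zfew: "card {j. j < m + n \<and> v j (fst c) \<in> \<int>} \<le> l \<and> card {j. j < m + n \<and> v j (snd c) \<in> \<int>} \<le> l"
      if "c \<in> Z" for c
    proof -
      have "fst (fst c) = fst (snd c)" "f1 (fst c) = g1 (snd c)" using that unfolding Z_def by blast+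
      from few[rule_format, OF conjunct1[OF ZW[OF that]] conjunct2[OF ZW[OF that]] this]
      show ?thesis .
    qed
    have fewP: "card {j. j < m + n \<and> v j p \<in> \<int>} \<le> l" if "p \<in> P" for p
      using that Zfew unfolding P_def image_iff by metis
    have fewQ: "card {j. j < m + n \<and> v j p \<in> \<int>} \<le> l" if "p \<in> Q" for p
      using that Zfew unfolding Q_def image_iff by metis
    have oscP: "\<bar>snd (f p) i - snd (f q) i\<bar> \<le> \<zeta>"
      if "p \<in> P" "q \<in> P" "\<And>j. j < m + n \<Longrightarrow> \<bar>v j p - v j q\<bar> \<le> 2" for p q i
    proof -
      have "G (p, q) < \<eta>1" using small[OF that(3)] unfolding \<eta>_def by simp
      then show ?thesis using \<eta>1(2) subsetD[OF PW that(1)] subsetD[OF PW that(2)] by blast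
    qed
    have oscQ: "\<bar>snd (g p) i - snd (g q) i\<bar> \<le> \<zeta>"
      if "p \<in> Q" "q \<in> Q" "\<And>j. j < m + n \<Longrightarrow> \<bar>v j p - v j q\<bar> \<le> 2" for p q i
    proof -
      have "G (p, q) < \<eta>2" using small[OF that(3)] unfolding \<eta>_def by simp
      then show ?thesis using \<eta>2(2) subsetD[OF QW that(1)] subsetD[OF QW that(2)] by blast
    qed
    have "\<exists>(C :: ((nat \<Rightarrow> real) \<times> (nat \<Rightarrow> real)) set set) V F. finite C \<and> (\<forall>i. continuous_on P (\<lambda>p. F p i)) \<and>
      (\<forall>p\<in>P. \<forall>i. \<bar>snd (f p) i - F p i\<bar> \<le> \<zeta>) \<and>
      (\<forall>p\<in>P. \<exists>E w. E \<subseteq> C \<and> card E \<le> Suc l \<and> sum w E = 1 \<and> (\<forall>i::nat. F p i = (\<Sum>U\<in>E. w U * V U i)))"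
      by (rule low_dimensional_approximation[OF P, where v = v and d = "m + n"]) (fact vc fewP oscP)+
    then obtain C :: "((nat \<Rightarrow> real) \<times> (nat \<Rightarrow> real)) set set" and V F where
      C: "finite C" and Fc: "\<forall>i. continuous_on P (\<lambda>p. F p i)"
      and Fcl: "\<forall>p\<in>P. \<forall>i. \<bar>snd (f p) i - F p i\<bar> \<le> \<zeta>"
      and Fe: "\<forall>p\<in>P. \<exists>E w. E \<subseteq> C \<and> card E \<le> Suc l \<and> sum w E = 1 \<and> (\<forall>i. F p i = (\<Sum>U\<in>E. w U * V U i))"
      by blast
    have "\<exists>(C :: ((nat \<Rightarrow> real) \<times> (nat \<Rightarrow> real)) set set) V F. finite C \<and> (\<forall>i. continuous_on Q (\<lambda>p. F p i)) \<and>
      (\<forall>p\<in>Q. \<forall>i. \<bar>snd (g p) i - F p i\<bar> \<le> \<zeta>) \<and>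
      (\<forall>p\<in>Q. \<exists>E w. E \<subseteq> C \<and> card E \<le> Suc l \<and> sum w E = 1 \<and> (\<forall>i::nat. F p i = (\<Sum>U\<in>E. w U * V U i)))"
      by (rule low_dimensional_approximation[OF Q, where v = v and d = "m + n"]) (fact vc fewQ oscQ)+
    then obtain C' :: "((nat \<Rightarrow> real) \<times> (nat \<Rightarrow> real)) set set" and V' F' where
      C': "finite C'" and Fc': "\<forall>i. continuous_on Q (\<lambda>p. F' p i)"
      and Fcl': "\<forall>p\<in>Q. \<forall>i. \<bar>snd (g p) i - F' p i\<bar> \<le> \<zeta>"
      and Fe': "\<forall>p\<in>Q. \<exists>E w. E \<subseteq> C' \<and> card E \<le> Suc l \<and> sum w E = 1 \<and> (\<forall>i. F' p i = (\<Sum>U\<in>E. w U * V' U i))"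
      by blast
    \<comment> \<open>With \<open>s < 1\<close> every \<open>s ^ Suc i\<close> is at most
      \<open>s\<close>, so the translation stays below \<open>\<zeta>\<close> in all coordinates at
      once.\<close>
    have \<zeta>1: "min \<zeta> 1 > 0" using \<open>\<zeta> > 0\<close> by simp
    from moment_curve_translation[OF C C' \<zeta>1, of l V V'] obtain s where s: "0 < s" "s < min \<zeta> 1"
      and gen: "\<forall>E E' w w'. E \<subseteq> C \<longrightarrow> E' \<subseteq> C' \<longrightarrow> card E \<le> Suc l \<longrightarrow> card E' \<le> Suc l \<longrightarrow>
        sum w E = 1 \<longrightarrow> sum w' E' = 1 \<longrightarrow>
        (\<exists>i<?N. (\<Sum>U\<in>E. w U * V U i) + s ^ Suc i \<noteq> (\<Sum>U\<in>E'. w' U * V' U i))"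
      by blast
    have spow: "0 \<le> s ^ Suc i" "s ^ Suc i \<le> \<zeta>" for i
    proof -
      have "s ^ Suc i \<le> s" using s power_decreasing[of 1 "Suc i" s] by simp
      then show "s ^ Suc i \<le> \<zeta>" using s by linarith
      show "0 \<le> s ^ Suc i" using s by simp
    qed
    have Fs: "\<bar>(F p i + s ^ Suc i) - snd (f p) i\<bar> \<le> 2 * \<zeta>" if "p \<in> P" for p i
      using Fcl[rule_format, OF that, of i] spow[of i] by linarith
    have Fsc: "continuous_on P (\<lambda>p. F p i + s ^ Suc i)" for i
      using Fc by (intro continuous_on_add continuous_on_const) blast
    have \<zeta>2: "0 \<le> 2 * \<zeta>" using \<open>\<zeta> > 0\<close> by simp
    have "\<exists>H. (\<forall>i. continuous_on ?W (\<lambda>p. H p i)) \<and> (\<forall>p\<in>P. \<forall>i. H p i = F p i + s ^ Suc i) \<and>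
      (\<forall>p\<in>?W. \<forall>i. \<bar>snd (f p) i - H p i\<bar> \<le> 2 * \<zeta>)"
      by (rule extend_coordinatewise[OF P PW]) (fact comp(2)[OF f] Fsc \<zeta>2 Fs)+
    then obtain f2 where f2: "\<And>i. continuous_on ?W (\<lambda>p. f2 p i)" "\<And>p i. p \<in> P \<Longrightarrow> f2 p i = F p i + s ^ Suc i"
      "\<And>p i. p \<in> ?W \<Longrightarrow> \<bar>snd (f p) i - f2 p i\<bar> \<le> 2 * \<zeta>"
      by blast
    have Fs': "\<bar>F' p i - snd (g p) i\<bar> \<le> 2 * \<zeta>" if "p \<in> Q" for p i
      using Fcl'[rule_format, OF that, of i] \<open>\<zeta> > 0\<close> by linarith
    have "\<exists>H. (\<forall>i. continuous_on ?W (\<lambda>p. H p i)) \<and> (\<forall>p\<in>Q. \<forall>i. H p i = F' p i) \<and>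
      (\<forall>p\<in>?W. \<forall>i. \<bar>snd (g p) i - H p i\<bar> \<le> 2 * \<zeta>)"
      by (rule extend_coordinatewise[OF Q QW]) (fact comp(2)[OF g] Fc'[rule_format] \<zeta>2 Fs')+
    then obtain g2 where g2: "\<And>i. continuous_on ?W (\<lambda>p. g2 p i)" "\<And>p i. p \<in> Q \<Longrightarrow> g2 p i = F' p i"
      "\<And>p i. p \<in> ?W \<Longrightarrow> \<bar>snd (g p) i - g2 p i\<bar> \<le> 2 * \<zeta>"
      by blast
    \<comment> \<open>\<open>f2\<close> and \<open>g2\<close> may be nonzero in coordinates from
      \<open>?N\<close> on, so they are truncated. The separation survives, since it occurs in a
      coordinate below \<open>?N\<close>.\<close>
    have out: "continuous_map (top_of_set ?W) (mtopology_of D) (\<lambda>p. (h1 p, truncate_fun ?N (h2 p)))"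
      "\<forall>p\<in>?W. mdist D (h p) (h1 p, truncate_fun ?N (h2 p)) < \<epsilon>"
      if h: "continuous_map (top_of_set ?W) (mtopology_of D) h"
        and h1: "continuous_map (top_of_set ?W) (mtopology_of M) h1"
        and h1cl: "\<forall>p\<in>?W. mdist M (fst (h p)) (h1 p) < \<epsilon> / 2"
        and h2: "\<And>i. continuous_on ?W (\<lambda>p. h2 p i)"
        and h2cl: "\<And>p i. p \<in> ?W \<Longrightarrow> \<bar>snd (h p) i - h2 p i\<bar> \<le> 2 * \<zeta>" for h h1 h2
    proof -
      have tE: "truncate_fun ?N y \<in> ?E" for y by (simp add: truncate_fun_def topspace_Euclidean_space)
      have "continuous_on ?W (\<lambda>p. truncate_fun ?N (h2 p))"
        by (intro continuous_on_compose2[OF continuous_on_truncate[of UNIV]]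
            continuous_on_coordinatewise_then_product h2) auto
      then have "continuous_map (top_of_set ?W) (Euclidean_space ?N) (\<lambda>p. truncate_fun ?N (h2 p))"
        using tE unfolding Euclidean_space_def euclidean_product_topology
        by (auto simp: continuous_map_in_subtopology truncate_fun_def)
      then show "continuous_map (top_of_set ?W) (mtopology_of D) (\<lambda>p. (h1 p, truncate_fun ?N (h2 p)))"
        unfolding topD using h1 by (simp add: continuous_map_paired)
      show "\<forall>p\<in>?W. mdist D (h p) (h1 p, truncate_fun ?N (h2 p)) < \<epsilon>"
      proof
        fix p assume p: "p \<in> ?W"
        let ?y = "truncate_fun ?N (h2 p)"
        have "\<bar>snd (h p) i - ?y i\<bar> \<le> 2 * \<zeta>" for i
          using h2cl[OF p, of i] comp(3)[OF h p, of i] \<open>\<zeta> > 0\<close> by (cases "i < ?N") (auto simp: truncate_fun_def)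
        then have "dist (snd (h p)) ?y \<le> 2 * (2 * \<zeta>)" by (rule dist_fun_le)
        then have d2: "dist (snd (h p)) ?y < \<epsilon> / 2" using \<open>0 < \<epsilon>\<close> by (simp add: \<zeta>_def)
        have "mdist D (h p) (h1 p, ?y) = sqrt ((mdist M (fst (h p)) (h1 p))\<^sup>2 + (dist (snd (h p)) ?y)\<^sup>2)"
          by (simp add: D_def prod_dist_def case_prod_unfold)
        also have "\<dots> \<le> mdist M (fst (h p)) (h1 p) + dist (snd (h p)) ?y"
          by (intro sqrt_sum_squares_le_sum) auto
        also have "\<dots> < \<epsilon>" using bspec[OF h1cl p] d2 by linarith
        finally show "mdist D (h p) (h1 p, ?y) < \<epsilon>" .
      qed
    qed
    let ?f = "\<lambda>p. (f1 p, truncate_fun ?N (f2 p))" and ?g = "\<lambda>p. (g1 p, truncate_fun ?N (g2 p))"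
    have disj: "?f ` ({z} \<times> unit_cube_set n) \<inter> ?g ` ({z} \<times> unit_cube_set n) = {}" if z: "z \<in> unit_cube_set m" for z
    proof (rule ccontr)
      assume "\<not> ?thesis"
      then obtain x y where xy: "x \<in> unit_cube_set n" "y \<in> unit_cube_set n" "?f (z, x) = ?g (z, y)"
        by blast
      then have e1: "f1 (z, x) = g1 (z, y)" and e2: "truncate_fun ?N (f2 (z, x)) = truncate_fun ?N (g2 (z, y))"
        by auto
      have "((z, x), (z, y)) \<in> Z" using xy z e1 by (simp add: Z_def)
      then have p: "(z, x) \<in> P" and q: "(z, y) \<in> Q" unfolding P_def Q_def by force+
      have e3: "f2 (z, x) i = g2 (z, y) i" if "i < ?N" for i
        using fun_cong[OF e2, of i] that by (simp add: truncate_fun_def)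
      obtain E w where E: "E \<subseteq> C" "card E \<le> Suc l" "sum w E = 1" "\<forall>i. F (z, x) i = (\<Sum>U\<in>E. w U * V U i)"
        using Fe p by blast
      obtain E' w' where E': "E' \<subseteq> C'" "card E' \<le> Suc l" "sum w' E' = 1" "\<forall>i. F' (z, y) i = (\<Sum>U\<in>E'. w' U * V' U i)"
        using Fe' q by blast
      obtain i where "i < ?N" "F (z, x) i + s ^ Suc i \<noteq> F' (z, y) i"
        using gen[rule_format, OF E(1) E'(1) E(2) E'(2) E(3) E'(3)] E(4) E'(4) by auto
      then show False using e3[of i] f2(2)[OF p] g2(2)[OF q] by simp
    qed
    show "\<exists>f' g'. continuous_map (top_of_set ?W) (mtopology_of D) f' \<and>
        continuous_map (top_of_set ?W) (mtopology_of D) g' \<and>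
        (\<forall>p\<in>?W. mdist D (f p) (f' p) < \<epsilon>) \<and> (\<forall>p\<in>?W. mdist D (g p) (g' p) < \<epsilon>) \<and>
        (\<forall>z\<in>unit_cube_set m. f' ` ({z} \<times> unit_cube_set n) \<inter> g' ` ({z} \<times> unit_cube_set n) = {})"
    proof (rule exI[of _ ?f], rule exI[of _ ?g], intro conjI)
      show "continuous_map (top_of_set ?W) (mtopology_of D) ?f"
        by (rule out(1)[OF f f1 f1cl]) (fact f2)+
      show "continuous_map (top_of_set ?W) (mtopology_of D) ?g"
        by (rule out(1)[OF g g1 g1cl]) (fact g2)+
      show "\<forall>p\<in>?W. mdist D (f p) (?f p) < \<epsilon>"
        by (rule out(2)[OF f f1 f1cl]) (fact f2)+
      show "\<forall>p\<in>?W. mdist D (g p) (?g p) < \<epsilon>"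
        by (rule out(2)[OF g g1 g1cl]) (fact g2)+
      show "\<forall>z\<in>unit_cube_set m. ?f ` ({z} \<times> unit_cube_set n) \<inter> ?g ` ({z} \<times> unit_cube_set n) = {}"
        by (intro ballI disj)
    qed
  qed
  then show ?thesis using DD_property_iff_metric[of m n n D] topD by simp
qed

end
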